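(* Let $G$ be a locally compact group, $1<p<\infty$, and $\varphi\in\Delta(A_p(G))\cup\{0\}$. If $\ker(\varphi)$ has a bounded $\Delta$-weak approximate identity, then $G$ is an amenable group.
   Context: Integrals, $L^p(G)$ spaces and convolution are taken with respect to a left Haar measure on $G$, with $(f\ast g)(x)=\int_G f(y)g(y^{-1}x)\,dy$. For a function $f:G\to\mathbb{C}$, $\widetilde{f}(x)=\overline{f(x^{-1})}$. Figa-Talamanca Herz algebra: for $1<p<\infty$ and $1/p+1/q=1$, $A_p(G)$ is the subspace of $C_0(G)$ consisting of the functions of the form $u=\sum_{i=1}^\infty f_i\ast\widetilde{g_i}$ with $f_i\in L^p(G)$, $g_i\in L^q(G)$ and $\sum_{i=1}^\infty\|f_i\|_p\|g_i\|_q<\infty$. With pointwise operations and the norm $\|u\|_{A_p(G)}=\inf\{\sum_{i=1}^\infty\|f_i\|_p\|g_i\|_q : u=\sum_{i=1}^\infty f_i\ast\widetilde{g_i}\}$ it is a (commutative) Banach algebra. Character space: for a Banach algebra $A$, $\Delta(A)$ is the set of all nonzero homomorphisms $A\to\mathbb{C}$, with the Gelfand (weak-$*$) topology. It is known that $\Delta(A_p(G))=G$, each character being evaluation at a point of $G$. For $\varphi=0$ (the zero functional), $\ker(\varphi)=A_p(G)$. Bounded $\Delta$-weak approximate identity of a subset: for a Banach algebra $A$ with $\Delta(A)\neq\emptyset$ and a subset $B\subseteq A$, $B$ has a bounded $\Delta$-weak approximate identity if there is a net $(b_\alpha)$ in $B$, bounded in the norm of $A$, such that for each $b\in B$ and each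 compact $K\subseteq\Delta(A)$, $\lim_\alpha\sup_{\phi\in K}|\phi(bb_\alpha)-\phi(b)|=0$. Here this is applied with $A=A_p(G)$ and $B=\ker(\varphi)$. Amenable: $G$ is amenable if there exists $m\in L^\infty(G)^*$ with $m\ge0$, $m(1)=1$ and $m(L_xf)=m(f)$ for all $x\in G$, $f\in L^\infty(G)$, where $L_xf(y)=f(x^{-1}y)$. *)

theory Defs
  imports "HOL-Analysis.Analysis"
begin

text \<open>
  Topological groups are those of the class \<^class>\<open>topological_group_add\<close>, which are not assumed
  commutative. The group law is thus written additively: \<open>x + y\<close>, \<open>- x\<close> and \<open>0\<close>
  stand for the product \<open>xy\<close>, the inverse \<open>x\<^sup>-\<^sup>1\<close> and the neutral element.
\<close>

section \<open>Haar measure and function spaces\<close>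

definition left_haar_measure :: "'a::{topological_group_add, t2_space} measure \<Rightarrow> bool" where
  "left_haar_measure \<mu> \<longleftrightarrow>
     sets \<mu> = sets borel \<and>
     emeasure \<mu> UNIV \<noteq> 0 \<and>
     (\<forall>K. compact K \<longrightarrow> emeasure \<mu> K < \<infinity>) \<and>
     (\<forall>E\<in>sets borel. emeasure \<mu> E = (INF U\<in>{U. open U \<and> E \<subseteq> U}. emeasure \<mu> U)) \<and>
     (\<forall>U. open U \<longrightarrow> emeasure \<mu> U = (SUP K\<in>{K. compact K \<and> K \<subseteq> U}. emeasure \<mu> K)) \<and>
     (\<forall>x. \<forall>E\<in>sets borel. emeasure \<mu> ((\<lambda>y. x + y) ` E) = emeasure \<mu> E)"

definition C0 :: "('a::topological_space \<Rightarrow> complex) set" where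
  "C0 = {u. continuous_on UNIV u \<and>
            (\<forall>e>0. \<exists>K. compact K \<and> (\<forall>x. x \<notin> K \<longrightarrow> norm (u x) < e))}"

text \<open>
  The elements of \<open>L\<^sup>p\<close> and \<open>L\<^sup>\<infinity>\<close> are represented by Borel functions
  rather than by equivalence classes; the (semi)norms identify equivalent functions.
\<close>

definition Lp :: "'a measure \<Rightarrow> real \<Rightarrow> ('a \<Rightarrow> complex) set" where
  "Lp \<mu> p = {f \<in> borel_measurable \<mu>. integrable \<mu> (\<lambda>x. norm (f x) powr p)}"

definition Lp_norm :: "'a measure \<Rightarrow> real \<Rightarrow> ('a \<Rightarrow> complex) \<Rightarrow> real" where
  "Lp_norm \<mu> p f = (\<integral>x. norm (f x) powr p \<partial>\<mu>) powr (1 / p)"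

text \<open>
  A Haar measure need not be \<open>\<sigma>\<close>-finite. As usual in harmonic analysis, \<open>L\<^sup>\<infinity>\<close> is
  formed modulo locally null sets, that is, sets that meet every compact set in a null set;
  this is what makes it the dual of \<open>L\<^sup>1\<close>.
\<close>

definition locally_AE :: "'a::topological_space measure \<Rightarrow> ('a \<Rightarrow> bool) \<Rightarrow> bool" where
  "locally_AE \<mu> P \<longleftrightarrow> (\<forall>K. compact K \<longrightarrow> (AE x in \<mu>. x \<in> K \<longrightarrow> P x))"

definition Linf :: "'a::topological_space measure \<Rightarrow> ('a \<Rightarrow> complex) set" where
  "Linf \<mu> = {f \<in> borel_measurable \<mu>. \<exists>C. locally_AE \<mu> (\<lambda>x. norm (f x) \<le> C)}"

definition Linf_norm :: "'a::topological_space measure \<Rightarrow> ('a \<Rightarrow> complex) \<Rightarrow> real" where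
  "Linf_norm \<mu> f = Inf {C. 0 \<le> C \<and> locally_AE \<mu> (\<lambda>x. norm (f x) \<le> C)}"

section \<open>The Figa-Talamanca Herz algebra\<close>

definition convolution ::
    "'a::group_add measure \<Rightarrow> ('a \<Rightarrow> complex) \<Rightarrow> ('a \<Rightarrow> complex) \<Rightarrow> 'a \<Rightarrow> complex" where
  "convolution \<mu> f g x = (\<integral>y. f y * g (- y + x) \<partial>\<mu>)"

definition tilde :: "('a::group_add \<Rightarrow> complex) \<Rightarrow> 'a \<Rightarrow> complex" where
  "tilde f x = cnj (f (- x))"

definition conjugate_exponent :: "real \<Rightarrow> real" where
  "conjugate_exponent p = p / (p - 1)"

lemma conjugate_exponent_iff:
  assumes "1 < p"
  shows "1 / p + 1 / q = 1 \<longleftrightarrow> q = conjugate_exponent p"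
proof (cases "q = 0")
  case True
  then show ?thesis using assms by (simp add: conjugate_exponent_def)
next
  case False
  then have "1 / p + 1 / q = 1 \<longleftrightarrow> q + p = p * q"
    using assms by (auto simp: field_simps)
  also have "\<dots> \<longleftrightarrow> q * (p - 1) = p" by (auto simp: algebra_simps)
  also have "\<dots> \<longleftrightarrow> q = conjugate_exponent p"
    using assms by (auto simp: conjugate_exponent_def field_simps)
  finally show ?thesis .
qed

text \<open>
  The sequences \<open>f\<close> and \<open>g\<close> represent \<open>u\<close> as a series. By Hoelder's inequality the
  partial sums converge uniformly, so that pointwise and uniform sum agree.
\<close>

definition Ap_representation ::
    "'a::group_add measure \<Rightarrow> real \<Rightarrow> (nat \<Rightarrow> 'a \<Rightarrow> complex) \<Rightarrow> (nat \<Rightarrow> 'a \<Rightarrow> complex) \<Rightarrow> ('a \<Rightarrow> complex) \<Rightarrow> bool"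
  where
  "Ap_representation \<mu> p f g u \<longleftrightarrow>
     (\<forall>i. f i \<in> Lp \<mu> p) \<and>
     (\<forall>i. g i \<in> Lp \<mu> (conjugate_exponent p)) \<and>
     summable (\<lambda>i. Lp_norm \<mu> p (f i) * Lp_norm \<mu> (conjugate_exponent p) (g i)) \<and>
     (\<forall>x. (\<lambda>i. convolution \<mu> (f i) (tilde (g i)) x) sums u x)"

definition Ap :: "'a::{topological_group_add, t2_space} measure \<Rightarrow> real \<Rightarrow> ('a \<Rightarrow> complex) set" where
  "Ap \<mu> p = {u \<in> C0. \<exists>f g. Ap_representation \<mu> p f g u}"

definition Ap_norm :: "'a::group_add measure \<Rightarrow> real \<Rightarrow> ('a \<Rightarrow> complex) \<Rightarrow> real" where
  "Ap_norm \<mu> p u =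
     Inf {(\<Sum>i. Lp_norm \<mu> p (f i) * Lp_norm \<mu> (conjugate_exponent p) (g i)) | f g.
            Ap_representation \<mu> p f g u}"

section \<open>Characters and \<open>\<Delta>\<close>-weak approximate identities\<close>

text \<open>
  In this section \<open>A\<close> is an algebra of complex functions on \<open>'a\<close> with pointwise operations.
  Functionals on \<open>A\<close> are \<^const>\<open>extensional\<close> functions, that is, \<^const>\<open>undefined\<close> off
  \<open>A\<close>, so that they are determined by their values on \<open>A\<close>.
\<close>

definition homomorphisms :: "('a \<Rightarrow> complex) set \<Rightarrow> (('a \<Rightarrow> complex) \<Rightarrow> complex) set" where
  "homomorphisms A = {\<phi> \<in> extensional A.
     (\<forall>u\<in>A. \<forall>v\<in>A. \<phi> (\<lambda>x. u x + v x) = \<phi> u + \<phi> v) \<and>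
     (\<forall>c. \<forall>u\<in>A. \<phi> (\<lambda>x. c * u x) = c * \<phi> u) \<and>
     (\<forall>u\<in>A. \<forall>v\<in>A. \<phi> (\<lambda>x. u x * v x) = \<phi> u * \<phi> v)}"

definition zero_functional :: "('a \<Rightarrow> complex) set \<Rightarrow> ('a \<Rightarrow> complex) \<Rightarrow> complex" where
  "zero_functional A = restrict (\<lambda>_. 0) A"

definition character_space :: "('a \<Rightarrow> complex) set \<Rightarrow> (('a \<Rightarrow> complex) \<Rightarrow> complex) set" where
  "character_space A = homomorphisms A - {zero_functional A}"

text \<open>The weak-* topology is the topology of pointwise convergence on \<open>A\<close>.\<close>

definition gelfand_topology :: "('a \<Rightarrow> complex) set \<Rightarrow> (('a \<Rightarrow> complex) \<Rightarrow> complex) topology" where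
  "gelfand_topology A = subtopology (product_topology (\<lambda>_. euclidean) A) (character_space A)"

definition ker :: "('a \<Rightarrow> complex) set \<Rightarrow> (('a \<Rightarrow> complex) \<Rightarrow> complex) \<Rightarrow> ('a \<Rightarrow> complex) set" where
  "ker A \<phi> = {u \<in> A. \<phi> u = 0}"

definition directed_set :: "'i set \<Rightarrow> ('i \<Rightarrow> 'i \<Rightarrow> bool) \<Rightarrow> bool" where
  "directed_set I le \<longleftrightarrow>
     I \<noteq> {} \<and>
     (\<forall>a\<in>I. le a a) \<and>
     (\<forall>a\<in>I. \<forall>b\<in>I. \<forall>c\<in>I. le a b \<longrightarrow> le b c \<longrightarrow> le a c) \<and>
     (\<forall>a\<in>I. \<forall>b\<in>I. \<exists>c\<in>I. le a c \<and> le b c)"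

definition net_filter :: "'i set \<Rightarrow> ('i \<Rightarrow> 'i \<Rightarrow> bool) \<Rightarrow> 'i filter" where
  "net_filter I le = (INF a\<in>I. principal {b \<in> I. le a b})"

lemma eventually_net_filter:
  assumes "directed_set I le"
  shows "eventually P (net_filter I le) \<longleftrightarrow> (\<exists>a\<in>I. \<forall>b\<in>I. le a b \<longrightarrow> P b)"
proof -
  have "\<exists>c\<in>I. principal {d \<in> I. le c d} \<le> inf (principal {d \<in> I. le a d}) (principal {d \<in> I. le b d})"
    if ab: "a \<in> I" "b \<in> I" for a b
  proof -
    obtain c where "c \<in> I" "le a c" "le b c"
      using assms ab unfolding directed_set_def by blast
    then have "{d \<in> I. le c d} \<subseteq> {d \<in> I. le a d} \<inter> {d \<in> I. le b d}"
      using assms ab unfolding directed_set_def by blast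
    then show ?thesis using \<open>c \<in> I\<close> by auto
  qed
  moreover have "I \<noteq> {}" using assms by (simp add: directed_set_def)
  ultimately show ?thesis
    unfolding net_filter_def by (subst eventually_INF_base) (auto simp: eventually_principal)
qed

text \<open>
  The index set \<open>I\<close> of the net is a subset of the type \<open>'i\<close>. A statement that assumes this
  property for an arbitrary type \<open>'i\<close> covers all nets. The supremum is taken in
  \<^typ>\<open>ennreal\<close>, where it always exists and is \<open>0\<close> for empty \<open>K\<close>.
\<close>

definition has_bounded_Delta_weak_ai ::
    "'i itself \<Rightarrow> ('a \<Rightarrow> complex) set \<Rightarrow> (('a \<Rightarrow> complex) \<Rightarrow> real) \<Rightarrow> ('a \<Rightarrow> complex) set \<Rightarrow> bool" where
  "has_bounded_Delta_weak_ai _ A N B \<longleftrightarrow>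
     (\<exists>(I :: 'i set) le (e :: 'i \<Rightarrow> 'a \<Rightarrow> complex).
        directed_set I le \<and>
        (\<forall>i\<in>I. e i \<in> B) \<and>
        (\<exists>C. \<forall>i\<in>I. N (e i) \<le> C) \<and>
        (\<forall>b\<in>B. \<forall>K. compactin (gelfand_topology A) K \<longrightarrow>
           ((\<lambda>i. SUP \<phi>\<in>K. ennreal (norm (\<phi> (\<lambda>x. b x * e i x) - \<phi> b))) \<longlongrightarrow> 0)
             (net_filter I le)))"

section \<open>Amenability\<close>

text \<open>Boundedness of \<open>m\<close> forces it to factor through the quotient by locally null functions.\<close>

definition Linf_dual :: "'a::topological_space measure \<Rightarrow> (('a \<Rightarrow> complex) \<Rightarrow> complex) set" where
  "Linf_dual \<mu> = {m.
     (\<forall>f\<in>Linf \<mu>. \<forall>g\<in>Linf \<mu>. m (\<lambda>x. f x + g x) = m f + m g) \<and>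
     (\<forall>c. \<forall>f\<in>Linf \<mu>. m (\<lambda>x. c * f x) = c * m f) \<and>
     (\<exists>C. \<forall>f\<in>Linf \<mu>. norm (m f) \<le> C * Linf_norm \<mu> f)}"

definition left_translate :: "'a::group_add \<Rightarrow> ('a \<Rightarrow> complex) \<Rightarrow> 'a \<Rightarrow> complex" where
  "left_translate x f y = f (- x + y)"

definition amenable :: "'a::{topological_group_add, t2_space} measure \<Rightarrow> bool" where
  "amenable \<mu> \<longleftrightarrow>
     (\<exists>m\<in>Linf_dual \<mu>.
        (\<forall>f\<in>Linf \<mu>. locally_AE \<mu> (\<lambda>x. f x \<in> \<real>\<^sub>\<ge>\<^sub>0) \<longrightarrow> m f \<in> \<real>\<^sub>\<ge>\<^sub>0) \<and>
        m (\<lambda>_. 1) = 1 \<and>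
        (\<forall>x. \<forall>f\<in>Linf \<mu>. m (left_translate x f) = m f))"

end

theory Submission
  imports Defs
begin

text \<open>
  Write \<open>\<langle>k, g\<rangle>\<close> for the integral of \<open>k\<close> times the conjugate of \<open>g\<close>. A function in \<open>A\<^sub>p\<close> is an
  absolutely convergent series of coefficient functions
  \<open>coef f g x = \<langle>f (x + \<cdot>), g\<rangle>\<close> with \<open>f\<close> in \<open>L\<^sup>p\<close> and \<open>g\<close> in \<open>L\<^sup>q\<close>. Averaging such a
  function over finitely many left translations amounts to averaging all the vectors \<open>f\<close>: if \<open>T\<close>
  is the average over a finite set \<open>F\<close> of the isometries \<open>f \<mapsto> f (s + \<cdot>)\<close>, then
  \<open>coef (T f) g\<close> is the same average of \<open>coef f g\<close> (\<open>coef_avg\<close>). Hence the \<open>m\<close>-th iterate of the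
  average of \<open>u\<close> is bounded by the \<open>m\<close>-th power of the norm of \<open>T\<close> on \<open>L\<^sup>p\<close> times the norm of \<open>u\<close>,
  up to a factor 2.

  Let \<open>e\<^sub>i\<close> be the bounded net. For \<open>b\<close> in the kernel, applying its defining property to the
  character of evaluation at \<open>x\<close> gives \<open>b(x) e\<^sub>i(x) \<rightarrow> b(x)\<close>, so that \<open>e\<^sub>i(x) \<rightarrow> 1\<close> unless the whole
  kernel vanishes at \<open>x\<close>. As the kernel is all of \<open>A\<^sub>p\<close> or of codimension one and \<open>A\<^sub>p\<close> separates
  points, at most one point is exceptional (\<open>ker_zeros_unique\<close>). In an infinite group the finitely
  many points that enter an iterated average can be translated away from it. The iterated
  averages of the \<open>e\<^sub>i\<close> then tend to 1 at a suitable point, whereas they are bounded by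
  a constant times the \<open>m\<close>-th power of the norm of \<open>T\<close>. So that norm is 1 for every \<open>F\<close>
  (\<open>almost_norm_attaining\<close>).

  Strict convexity of \<open>t \<mapsto> t\<^sup>p\<close> turns this into almost invariance. If \<open>T f\<close> has nearly the norm of
  \<open>f\<close>, then Jensen's inequality for the average of the values \<open>|f (s + y)|\<close> is nearly an equality
  in the mean over \<open>y\<close>, and if \<open>0 \<in> F\<close> this forces the normalised density \<open>|f|\<^sup>p\<close> to be nearly
  invariant in \<open>L\<^sup>1\<close> under each \<open>s \<in> F\<close> (\<open>reiter_if_almost_norm_attaining\<close>). A cluster point of the
  functionals on \<open>L\<^sup>\<infinity>\<close> given by these densities is an invariant mean (\<open>amenable_if_reiter\<close>). On a
  finite group a constant density serves.

  That evaluations are multiplicative functionals requires that \<open>A\<^sub>p\<close> be closed under products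
  (\<open>Ap_mult\<close>). Herz's argument is the identity
  \<open>coef f\<^sub>1 g\<^sub>1 x * coef f\<^sub>2 g\<^sub>2 x = \<integral> coef (f\<^sub>1 \<cdot> R\<^sub>z f\<^sub>2) (g\<^sub>1 \<cdot> R\<^sub>z g\<^sub>2) x dz\<close> with
  \<open>R\<^sub>z f y = f (y + z)\<close>. For continuous functions with compact support the integrand is
  norm continuous in \<open>z\<close>; Riemann sums of it stay bounded and converge in the norm of \<open>A\<^sub>p\<close>. The general case
  follows because \<open>C\<^sub>c\<close> is dense in \<open>L\<^sup>p\<close> and in \<open>L\<^sup>q\<close>.
\<close>

section \<open>Absolutely convergent combinations of bounded functions\<close>

text \<open>
  For the set \<open>A\<close> of normalised coefficient functions below, \<open>A\<^sub>p\<close> consists of the elements of these sets in \<open>C\<^sub>0\<close>, and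
  its norm is the infimum of the admissible \<open>r\<close>. Carrying the bound \<open>r\<close> along replaces infima of
  norms by explicit series.
\<close>

definition l1_hull :: "('x \<Rightarrow> complex) set \<Rightarrow> real \<Rightarrow> ('x \<Rightarrow> complex) set" where
  "l1_hull A r = {u. \<exists>c a. (\<forall>i::nat. a i \<in> A) \<and> summable (\<lambda>i. norm (c i)) \<and> (\<Sum>i. norm (c i)) \<le> r \<and>
                 (\<forall>x. (\<lambda>i. c i * a i x) sums u x)}"

lemma hullI:
  assumes "\<And>i. a i \<in> A" "summable (\<lambda>i. norm (c i))" "(\<Sum>i. norm (c i)) \<le> r"
    "\<And>x. (\<lambda>i. c i * a i x) sums u x"
  shows "u \<in> l1_hull A r"
  using assms unfolding l1_hull_def by blast

lemma hullE:
  assumes "u \<in> l1_hull A r"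
  obtains a :: "nat \<Rightarrow> 'x \<Rightarrow> complex" and c where "\<And>i. a i \<in> A" "summable (\<lambda>i. norm (c i))" "(\<Sum>i. norm (c i)) \<le> r"
    "\<And>x. (\<lambda>i. c i * a i x) sums u x"
  using assms unfolding l1_hull_def by blast

lemma hull_mono: "u \<in> l1_hull A r \<Longrightarrow> r \<le> s \<Longrightarrow> u \<in> l1_hull A s"
  unfolding l1_hull_def by fastforce

lemma hull_nonneg: 
  assumes "u \<in> l1_hull A r" shows "0 \<le> r"
proof -
  from assms obtain a and c :: "nat \<Rightarrow> complex" where "summable (\<lambda>i. norm (c i))" "(\<Sum>i. norm (c i)) \<le> r"
    by (rule hullE) 
  with suminf_nonneg[of "\<lambda>i. norm (c i)"] show ?thesis by simp
qed

lemma atom_in_hull: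
  assumes "a \<in> A" shows "(\<lambda>x. c * a x) \<in> l1_hull A (norm c)"
proof (rule hullI[where a="\<lambda>_. a" and c="\<lambda>i. if i = 0 then c else 0"])
  have *: "(\<lambda>i::nat. if i = 0 then norm c else 0) sums norm c"
    using sums_single[of 0 "\<lambda>_. norm c"] by simp
  have **: "(\<lambda>i::nat. norm (if i = 0 then c else 0)) = (\<lambda>i. if i = 0 then norm c else 0)"
    by auto
  show "summable (\<lambda>i::nat. norm (if i = 0 then c else 0))" "(\<Sum>i::nat. norm (if i = 0 then c else 0)) \<le> norm c"
    unfolding ** using sums_summable[OF *] sums_unique[OF *] by auto
  show "(\<lambda>i. (if i = 0 then c else 0) * a x) sums (c * a x)" for x
    using sums_single[of 0 "\<lambda>_. c * a x"] by (simp add: if_distrib[of "\<lambda>t. t * _"] cong: if_cong)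
qed (use assms in auto)

lemma hull_scale:
  assumes "u \<in> l1_hull A r" shows "(\<lambda>x. d * u x) \<in> l1_hull A (norm d * r)"
proof -
  from assms obtain a c where ac: "\<And>i::nat. a i \<in> A" "summable (\<lambda>i. norm (c i))" "(\<Sum>i. norm (c i)) \<le> r"
    "\<And>x. (\<lambda>i. c i * a i x) sums u x" by (rule hullE) blast
  show ?thesis
  proof (rule hullI[where a=a and c="\<lambda>i. d * c i"])
    show "summable (\<lambda>i. norm (d * c i))" using ac(2) by (simp add: norm_mult summable_mult)
    show "(\<Sum>i. norm (d * c i)) \<le> norm d * r"
      using ac(2,3) by (simp add: norm_mult suminf_mult mult_left_mono)
    show "(\<lambda>i. d * c i * a i x) sums (d * u x)" for x
      using sums_mult[OF ac(4)] by (simp add: mult.assoc)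
  qed (use ac in auto)
qed

definition bounded_atoms :: "('x \<Rightarrow> complex) set \<Rightarrow> real \<Rightarrow> bool" where
  "bounded_atoms A B \<longleftrightarrow> (\<forall>a\<in>A. \<forall>x. norm (a x) \<le> B)"

lemma hull_bound:
  assumes "\<And>a. a \<in> A \<Longrightarrow> norm (a x) \<le> B" "u \<in> l1_hull A r" "B \<ge> 0"
  shows "norm (u x) \<le> B * r"
proof -
  from assms(2) obtain a c where ac: "\<And>i::nat. a i \<in> A" "summable (\<lambda>i. norm (c i))" "(\<Sum>i. norm (c i)) \<le> r"
    "\<And>x. (\<lambda>i. c i * a i x) sums u x" by (rule hullE) blast
  have le: "norm (c i * a i x) \<le> B * norm (c i)" for i
    using mult_left_mono[OF assms(1)[OF ac(1)[of i]], of "norm (c i)"] by (simp add: norm_mult mult.commute)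
  have s: "summable (\<lambda>i. B * norm (c i))" using ac(2) by (rule summable_mult)
  have "norm (u x) = norm (\<Sum>i. c i * a i x)" using sums_unique[OF ac(4)] by simp
  also have "\<dots> \<le> (\<Sum>i. norm (c i * a i x))"
    by (intro summable_norm summable_comparison_test'[OF s, of 0]) (use le in auto)
  also have "\<dots> \<le> (\<Sum>i. B * norm (c i))"
    by (intro suminf_le le s summable_comparison_test'[OF s, of 0]) (use le in auto)
  also have "\<dots> \<le> B * r" using ac(2,3) assms(3) by (simp add: suminf_mult mult_left_mono)
  finally show ?thesis .
qed

text \<open>
  This is completeness. The double series formed by the series of all \<open>u n\<close> converges absolutely at each
  point because the functions in \<open>A\<close> are uniformly bounded; it is enumerated along a bijection
  of \<open>\<nat> \<times> \<nat>\<close> with \<open>\<nat>\<close>.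
\<close>

lemma hull_sums:
  fixes u :: "nat \<Rightarrow> 'x \<Rightarrow> complex"
  assumes bnd: "bounded_atoms A B"
    and u: "\<And>n. u n \<in> l1_hull A (r n)" and r: "summable r"
    and v: "\<And>x. (\<lambda>n. u n x) sums v x"
  shows "v \<in> l1_hull A (suminf r)"
proof -
  have "\<forall>n. \<exists>a c. (\<forall>i::nat. a i \<in> A) \<and> summable (\<lambda>i. norm (c i)) \<and> (\<Sum>i. norm (c i)) \<le> r n \<and>
                 (\<forall>x. (\<lambda>i. c i * a i x) sums u n x)"
    using u unfolding l1_hull_def by blast
  then obtain a c where a: "\<And>n i. a n i \<in> A" and c: "\<And>n. summable (\<lambda>i::nat. norm (c n i))"
    and cr: "\<And>n. (\<Sum>i. norm (c n i)) \<le> r n" and s: "\<And>n x. (\<lambda>i. c n i * a n i x) sums u n x"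
    by metis
  define S where "S = (\<Sum>n. \<Sum>i. norm (c n i))"
  have cn0: "0 \<le> (\<Sum>i. norm (c n i))" for n by (intro suminf_nonneg c) auto
  have sr: "summable (\<lambda>n. \<Sum>i. norm (c n i))"
    by (rule summable_comparison_test'[OF r, of 0]) (use cr cn0 in auto)
  have Sr: "S \<le> suminf r" unfolding S_def by (intro suminf_le sr r cr)
  have inner: "((\<lambda>i. norm (c n i)) has_sum (\<Sum>i. norm (c n i))) UNIV" for n
    by (intro sums_nonneg_imp_has_sum summable_sums c) auto
  have outer: "((\<lambda>n. \<Sum>i. norm (c n i)) has_sum S) UNIV"
    unfolding S_def by (intro sums_nonneg_imp_has_sum summable_sums sr cn0)
  have dsum: "(\<lambda>(n,i). norm (c n i)) summable_on (UNIV \<times> UNIV)"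
    by (rule summable_on_SigmaI[OF _ has_sum_imp_summable[OF outer]]) (use inner in auto)
  have dhas: "((\<lambda>(n,i). norm (c n i)) has_sum S) (UNIV \<times> UNIV)"
    by (rule has_sum_SigmaI[OF _ outer dsum]) (use inner in auto)
  have bij: "bij_betw prod_decode UNIV (UNIV \<times> UNIV)" using bij_prod_decode by simp
  have P1: "(\<lambda>k. norm (case_prod c (prod_decode k))) sums S"
    using has_sum_reindex_bij_betw[OF bij, of "\<lambda>(n,i). norm (c n i)" S] dhas
    by (intro has_sum_imp_sums) (simp add: case_prod_unfold)
  have P2: "(\<lambda>k. case_prod c (prod_decode k) * case_prod a (prod_decode k) x) sums v x" for x
  proof -
    have B0: "B \<ge> 0" using order_trans[OF norm_ge_zero, of "a 0 0 x" B] bnd a unfolding bounded_atoms_def by simp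
    have le: "norm (c n i * a n i x) \<le> B * norm (c n i)" for n i
      using mult_left_mono[of "norm (a n i x)" B "norm (c n i)"] bnd a
      by (auto simp: norm_mult mult.commute bounded_atoms_def)
    have absn: "summable (\<lambda>i. norm (c n i * a n i x))" for n
      by (rule summable_comparison_test'[OF summable_mult[OF c, of B], of 0]) (use le in auto)
    have inn: "((\<lambda>i. c n i * a n i x) has_sum u n x) UNIV" for n
      by (rule norm_summable_imp_has_sum[OF absn s])
    have un: "norm (u n x) \<le> B * r n" for n
      by (rule hull_bound[OF _ u]) (use bnd B0 in \<open>auto simp: bounded_atoms_def\<close>)
    have out: "((\<lambda>n. u n x) has_sum v x) UNIV"
      by (rule norm_summable_imp_has_sum[OF _ v])
        (rule summable_comparison_test'[OF summable_mult[OF r, of B], of 0], use un in auto)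
    have "(\<lambda>ni. norm (case ni of (n, i) \<Rightarrow> c n i * a n i x)) summable_on (UNIV \<times> UNIV)"
    proof (rule Infinite_Sum.abs_summable_on_comparison_test')
      show "(\<lambda>ni. B * (case ni of (n, i) \<Rightarrow> norm (c n i))) summable_on (UNIV \<times> UNIV)"
        by (rule summable_on_cmult_right[OF dsum])
      show "norm (case ni of (n, i) \<Rightarrow> c n i * a n i x) \<le> B * (case ni of (n, i) \<Rightarrow> norm (c n i))" for ni
        using le by (cases ni) simp
    qed
    then have "(\<lambda>(n,i). c n i * a n i x) summable_on (UNIV \<times> UNIV)"
      by (rule abs_summable_summable)
    then have "((\<lambda>(n,i). c n i * a n i x) has_sum v x) (UNIV \<times> UNIV)"
      by (intro has_sum_SigmaI[OF _ out]) (use inn in auto)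
    then show ?thesis
      using has_sum_reindex_bij_betw[OF bij, of "\<lambda>(n,i). c n i * a n i x" "v x"]
      by (intro has_sum_imp_sums) (simp add: case_prod_unfold)
  qed
  show ?thesis
    by (rule hullI[where a="\<lambda>k. case_prod a (prod_decode k)" and c="\<lambda>k. case_prod c (prod_decode k)"])
       (use a P1 P2 Sr in \<open>auto simp: sums_iff split: prod.split\<close>)
qed

lemma hull_sums_le:
  fixes u :: "nat \<Rightarrow> 'x \<Rightarrow> complex"
  assumes "bounded_atoms A B" "\<And>n. u n \<in> l1_hull A (r n)" "r sums s" "\<And>x. (\<lambda>n. u n x) sums v x"
  shows "v \<in> l1_hull A s"
  using hull_sums[OF assms(1,2) _ assms(4)] assms(3) by (auto simp: sums_iff)

lemma zero_in_hull:
  assumes "A \<noteq> {}" shows "(\<lambda>x. 0) \<in> l1_hull A 0"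
proof -
  from assms obtain a where "a \<in> A" by blast
  then have "(\<lambda>x. 0 * a x) \<in> l1_hull A (norm (0::complex))" by (rule atom_in_hull)
  then show ?thesis by (simp only: mult_zero_left norm_zero)
qed

lemma hull_add:
  assumes bnd: "bounded_atoms A B" and u: "u \<in> l1_hull A r" and v: "v \<in> l1_hull A s"
  shows "(\<lambda>x. u x + v x) \<in> l1_hull A (r + s)"
proof (rule hull_sums_le[OF bnd, where u="\<lambda>n. if n = 0 then u else if n = 1 then v else (\<lambda>_. 0)"
        and r="\<lambda>n. if n = 0 then r else if n = 1 then s else 0"])
  have "A \<noteq> {}" using u by (auto elim: hullE)
  then show "(if n = 0 then u else if n = 1 then v else (\<lambda>_. 0))
          \<in> l1_hull A (if n = 0 then r else if n = 1 then s else 0)" for n :: nat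
    using u v zero_in_hull by auto
  show "(\<lambda>n::nat. if n = 0 then r else if n = 1 then s else 0) sums (r + s)"
    using sums_finite[of "{0,1::nat}" "\<lambda>n::nat. if n = 0 then r else if n = 1 then s else 0"] by auto
  show "(\<lambda>n::nat. (if n = 0 then u else if n = 1 then v else (\<lambda>_. 0)) x) sums (u x + v x)" for x
    using sums_finite[of "{0,1::nat}" "\<lambda>n::nat. (if n = 0 then u else if n = 1 then v else (\<lambda>_. 0)) x"] by auto
qed

lemma hull_finite_sum:
  assumes bnd: "bounded_atoms A B" and "A \<noteq> {}" and "finite J"
    and "\<And>j. j \<in> J \<Longrightarrow> u j \<in> l1_hull A (r j)"
  shows "(\<lambda>x. \<Sum>j\<in>J. u j x) \<in> l1_hull A (\<Sum>j\<in>J. r j)"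
  using assms(3,4) by (induction J) (auto intro: zero_in_hull[OF assms(2)] hull_add[OF bnd])

lemma hull_times:
  assumes bnd: "bounded_atoms A' B"
    and A: "\<And>a b. a \<in> A \<Longrightarrow> b \<in> A \<Longrightarrow> (\<lambda>x. a x * b x) \<in> l1_hull A' r"
    and u: "u \<in> l1_hull A s" and v: "v \<in> l1_hull A t"
  shows "(\<lambda>x. u x * v x) \<in> l1_hull A' (r * t * s)"
proof -
  from u obtain a c where ac: "\<And>i::nat. a i \<in> A" "summable (\<lambda>i. norm (c i))" "(\<Sum>i. norm (c i)) \<le> s"
    "\<And>x. (\<lambda>i. c i * a i x) sums u x" by (rule hullE) blast
  from v obtain b d where bd: "\<And>i::nat. b i \<in> A" "summable (\<lambda>i. norm (d i))" "(\<Sum>i. norm (d i)) \<le> t"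
    "\<And>x. (\<lambda>i. d i * b i x) sums v x" by (rule hullE) blast
  have r0: "0 \<le> r" using hull_nonneg[OF A[OF ac(1) ac(1)]] .
  have t0: "0 \<le> t" using hull_nonneg[OF v] .
  have av: "(\<lambda>x. a i x * v x) \<in> l1_hull A' (r * t)" for i
  proof -
    have "(\<lambda>x. a i x * v x) \<in> l1_hull A' ((\<Sum>i. norm (d i)) * r)"
    proof (rule hull_sums_le[OF bnd hull_scale[OF A[OF ac(1)[of i] bd(1)]]])
      show "(\<lambda>j. norm (d j) * r) sums ((\<Sum>i. norm (d i)) * r)"
        by (intro sums_mult2 summable_sums bd)
      show "(\<lambda>j. d j * (a i x * b j x)) sums (a i x * v x)" for x
        using sums_mult[OF bd(4), where c="a i x"] by (simp add: mult_ac)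
    qed
    then show ?thesis using r0 bd(3) by (auto simp: mult.commute intro: hull_mono mult_left_mono)
  qed
  have "(\<lambda>x. u x * v x) \<in> l1_hull A' ((\<Sum>i. norm (c i)) * (r * t))"
  proof (rule hull_sums_le[OF bnd hull_scale[OF av]])
    show "(\<lambda>i. norm (c i) * (r * t)) sums ((\<Sum>i. norm (c i)) * (r * t))"
      by (intro sums_mult2 summable_sums ac)
    show "(\<lambda>i. c i * (a i x * v x)) sums (u x * v x)" for x
      using sums_mult2[OF ac(4), where c="v x"] by (simp add: mult.assoc)
  qed
  moreover have "(\<Sum>i. norm (c i)) * (r * t) \<le> r * t * s"
    using mult_left_mono[OF ac(3), of "r * t"] r0 t0 by (simp add: mult.commute)
  ultimately show ?thesis by (rule hull_mono)
qed

text \<open>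
  This is the successive approximation of the open mapping theorem. If the atoms of \<open>A\<close> can be approximated
  by combinations of \<open>A'\<close> up to an error of size \<open>1/2\<close>, the errors can be approximated in turn.
  The \<open>n\<close>-th remainder has size \<open>s / 2 ^ n\<close>, and boundedness of \<open>A\<close> makes it tend to \<open>0\<close> pointwise.
\<close>

lemma hull_approx:
  assumes bnd: "bounded_atoms A B" and bnd': "bounded_atoms A' B'"
    and A: "\<And>a. a \<in> A \<Longrightarrow> \<exists>h \<in> l1_hull A' r. (\<lambda>x. a x - h x) \<in> l1_hull A (1/2)"
    and u: "u \<in> l1_hull A s"
  shows "u \<in> l1_hull A' (2 * r * s)"
proof -
  have step: "\<exists>h. h \<in> l1_hull A' (r * t) \<and> (\<lambda>x. w x - h x) \<in> l1_hull A (t / 2)" if w: "w \<in> l1_hull A t" for w t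
  proof -
    from w obtain a c where ac: "\<And>i::nat. a i \<in> A" "summable (\<lambda>i. norm (c i))" "(\<Sum>i. norm (c i)) \<le> t"
      "\<And>x. (\<lambda>i. c i * a i x) sums w x" by (rule hullE) blast
    have "\<forall>i. \<exists>h. h \<in> l1_hull A' r \<and> (\<lambda>x. a i x - h x) \<in> l1_hull A (1/2)" using A[OF ac(1)] by blast
    then obtain h where h: "\<And>i. h i \<in> l1_hull A' r" "\<And>i. (\<lambda>x. a i x - h i x) \<in> l1_hull A (1/2)" by metis
    have r0: "0 \<le> r" using h(1) hull_nonneg by blast
    define B0 where "B0 = max 0 B'"
    have B0: "norm (b x) \<le> B0" if "b \<in> A'" for b x
      using bnd' that unfolding bounded_atoms_def B0_def by (blast intro: max.coboundedI2)
    have hb: "norm (h i x) \<le> B0 * r" for i x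
      by (rule hull_bound[OF B0 h(1)]) (simp_all add: B0_def)
    have sm: "summable (\<lambda>i. c i * h i x)" for x
    proof (rule summable_comparison_test'[OF summable_mult[OF ac(2), of "B0 * r"], of 0])
      show "norm (c i * h i x) \<le> B0 * r * norm (c i)" for i
        using mult_left_mono[OF hb[of i x], of "norm (c i)"] by (simp add: norm_mult mult.commute)
    qed
    define H where "H x = (\<Sum>i. c i * h i x)" for x
    have Hs: "(\<lambda>i. c i * h i x) sums H x" for x unfolding H_def using sm by (rule summable_sums)
    have "H \<in> l1_hull A' ((\<Sum>i. norm (c i)) * r)"
      by (rule hull_sums_le[OF bnd' hull_scale[OF h(1)] _ Hs]) (intro sums_mult2 summable_sums ac)
    then have 1: "H \<in> l1_hull A' (r * t)"
      using r0 ac(3) by (auto simp: mult.commute intro: hull_mono mult_left_mono)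
    have "(\<lambda>x. w x - H x) \<in> l1_hull A ((\<Sum>i. norm (c i)) * (1/2))"
    proof (rule hull_sums_le[OF bnd hull_scale[OF h(2)]])
      show "(\<lambda>i. norm (c i) * (1/2)) sums ((\<Sum>i. norm (c i)) * (1/2))"
        by (intro sums_mult2 summable_sums ac)
      show "(\<lambda>i. c i * (a i x - h i x)) sums (w x - H x)" for x
        using sums_diff[OF ac(4) Hs] by (simp add: right_diff_distrib)
    qed
    then have "(\<lambda>x. w x - H x) \<in> l1_hull A (t / 2)" using ac(3) by (auto intro: hull_mono)
    with 1 show ?thesis by blast
  qed
  define nxt where "nxt t w = (SOME h. h \<in> l1_hull A' (r * t) \<and> (\<lambda>x. w x - h x) \<in> l1_hull A (t / 2))" for t and w :: "'a \<Rightarrow> complex"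
  have nxt: "nxt t w \<in> l1_hull A' (r * t)" "(\<lambda>x. w x - nxt t w x) \<in> l1_hull A (t / 2)" if "w \<in> l1_hull A t" for w t
    using someI_ex[OF step[OF that]] unfolding nxt_def by auto
  \<comment> \<open>\<open>w n\<close> is the remainder after \<open>n\<close> approximations, of size \<open>s / 2 ^ n\<close>.\<close>
  define w where "w = rec_nat u (\<lambda>n v x. v x - nxt (s / 2 ^ n) v x)"
  have w0: "w 0 = u" and wS: "w (Suc n) = (\<lambda>x. w n x - nxt (s / 2 ^ n) (w n) x)" for n
    by (simp_all add: w_def)
  have w: "w n \<in> l1_hull A (s / 2 ^ n)" for n
  proof (induction n)
    case (Suc n) then show ?case using nxt(2)[OF Suc] by (simp add: wS field_simps)
  qed (use u w0 in auto)
  define B0 where "B0 = max 0 B"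
  have B0: "norm (b x) \<le> B0" if "b \<in> A" for b x
    using bnd that unfolding bounded_atoms_def B0_def by (blast intro: max.coboundedI2)
  have wb: "norm (w n x) \<le> B0 * (s / 2 ^ n)" for n x
    by (rule hull_bound[OF B0 w]) (simp_all add: B0_def)
  have lim: "(\<lambda>n. w n x) \<longlonglongrightarrow> 0" for x
  proof (rule Lim_null_comparison)
    have "(\<lambda>n. B0 * s * (1/2) ^ n) \<longlonglongrightarrow> B0 * s * 0" by (intro tendsto_intros) auto
    then show "(\<lambda>n. B0 * (s / 2 ^ n)) \<longlonglongrightarrow> 0" by (simp add: power_one_over)
    show "\<forall>\<^sub>F n in sequentially. norm (w n x) \<le> B0 * (s / 2 ^ n)" using wb by simp
  qed
  have sumd: "(\<Sum>n<N. nxt (s / 2 ^ n) (w n) x) = u x - w N x" for N x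
    by (induction N) (auto simp: w0 wS)
  have "(\<lambda>n. nxt (s / 2 ^ n) (w n) x) sums u x" for x
    unfolding sums_def sumd using tendsto_diff[OF tendsto_const lim[of x], of "u x"] by simp
  moreover have "(\<lambda>n. r * (s / 2 ^ n)) sums (r * s * 2)"
    using sums_mult[OF geometric_sums[of "1/2::real"], of "r * s"] by (simp add: power_one_over)
  ultimately have "u \<in> l1_hull A' (r * s * 2)"
    by (rule hull_sums_le[OF bnd' nxt(1)[OF w], rotated])
  then show ?thesis by (simp add: mult_ac)
qed


section \<open>Integrals of powers of the modulus\<close>

lemma powr_add_le:
  fixes a b p :: real
  assumes "0 \<le> a" "0 \<le> b" "0 \<le> p"
  shows "(a + b) powr p \<le> 2 powr p * (a powr p + b powr p)"
proof -
  have "(a + b) powr p \<le> (2 * max a b) powr p"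
    using assms by (intro powr_mono2) auto
  also have "\<dots> = 2 powr p * max a b powr p"
    by (rule powr_mult)
  also have "\<dots> \<le> 2 powr p * (a powr p + b powr p)"
    by (intro mult_left_mono) (simp_all add: max_def)
  finally show ?thesis .
qed

lemma norm_add_powr_le:
  fixes a b :: "'b::real_normed_vector"
  assumes "0 \<le> p"
  shows "norm (a + b) powr p \<le> 2 powr p * (norm a powr p + norm b powr p)"
  using powr_mono2[OF assms norm_ge_zero norm_triangle_ineq[of a b]]
    powr_add_le[of "norm a" "norm b" p] assms by simp

text \<open>
  The \<open>p\<close>-th power of the \<open>L\<^sup>p\<close> norm: being an integral, it passes through the sums and
  interchanges of integration below, where the norm would need roots and Minkowski's inequality.
\<close>

definition pint :: "'a measure \<Rightarrow> real \<Rightarrow> ('a \<Rightarrow> complex) \<Rightarrow> real" where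
  "pint M p f = (\<integral>x. norm (f x) powr p \<partial>M)"

lemma pint_nonneg [simp]: "0 \<le> pint M p f"
  unfolding pint_def by (rule integral_nonneg_AE) simp

lemma Lp_norm_pint: "Lp_norm M p f = pint M p f powr (1 / p)"
  by (simp add: Lp_norm_def pint_def)

lemma Lp_measurable: "f \<in> Lp M p \<Longrightarrow> f \<in> borel_measurable M"
  and Lp_integrable: "f \<in> Lp M p \<Longrightarrow> integrable M (\<lambda>x. norm (f x) powr p)"
  by (auto simp: Lp_def)

lemma LpI:
  assumes "f \<in> borel_measurable M" "integrable M g" "\<And>x. norm (f x) powr p \<le> g x"
  shows "f \<in> Lp M p"
proof -
  note [measurable] = assms(1)
  have "integrable M (\<lambda>x. norm (f x) powr p)"
    by (rule Bochner_Integration.integrable_bound[OF assms(2)])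
       (use assms(3) in \<open>auto intro!: AE_I2 order_trans[OF _ abs_ge_self]\<close>)
  then show ?thesis using assms(1) by (simp add: Lp_def)
qed

lemma pint_mono:
  assumes "f \<in> borel_measurable M" "integrable M g" "\<And>x. norm (f x) powr p \<le> g x"
  shows "pint M p f \<le> (\<integral>x. g x \<partial>M)"
  unfolding pint_def using LpI[OF assms] assms(2,3) by (intro integral_mono Lp_integrable)

lemma Lp_add:
  assumes "f \<in> Lp M p" "g \<in> Lp M p" "0 \<le> p"
  shows "(\<lambda>x. f x + g x) \<in> Lp M p"
    and "pint M p (\<lambda>x. f x + g x) \<le> 2 powr p * (pint M p f + pint M p g)"
proof -
  have m: "(\<lambda>x. f x + g x) \<in> borel_measurable M"
    using assms by (intro borel_measurable_add Lp_measurable)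
  have i: "integrable M (\<lambda>x. 2 powr p * (norm (f x) powr p + norm (g x) powr p))"
    using assms by (intro Bochner_Integration.integrable_mult_right Bochner_Integration.integrable_add Lp_integrable)
  show "(\<lambda>x. f x + g x) \<in> Lp M p" 
    by (rule LpI[OF m i]) (use assms norm_add_powr_le in auto)
  have "pint M p (\<lambda>x. f x + g x) \<le> (\<integral>x. 2 powr p * (norm (f x) powr p + norm (g x) powr p) \<partial>M)"
    by (rule pint_mono[OF m i]) (use assms norm_add_powr_le in auto)
  also have "\<dots> = 2 powr p * (pint M p f + pint M p g)"
    unfolding pint_def using assms by (simp add: Lp_integrable)
  finally show "pint M p (\<lambda>x. f x + g x) \<le> 2 powr p * (pint M p f + pint M p g)" .
qed

lemma Lp_scale:
  assumes "f \<in> Lp M p"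
  shows "(\<lambda>x. c * f x) \<in> Lp M p" "pint M p (\<lambda>x. c * f x) = norm c powr p * pint M p f"
proof -
  have *: "norm (c * f x) powr p = norm c powr p * norm (f x) powr p" for x
    by (simp add: norm_mult powr_mult)
  show "(\<lambda>x. c * f x) \<in> Lp M p" "pint M p (\<lambda>x. c * f x) = norm c powr p * pint M p f"
    using assms by (auto simp: Lp_def pint_def *)
qed

lemma Lp_diff:
  assumes "f \<in> Lp M p" "g \<in> Lp M p" "0 \<le> p"
  shows "(\<lambda>x. f x - g x) \<in> Lp M p"
    and "pint M p (\<lambda>x. f x - g x) \<le> 2 powr p * (pint M p f + pint M p g)"
  using Lp_add[OF assms(1) Lp_scale(1)[OF assms(2), of "-1"] assms(3)] Lp_scale(2)[OF assms(2), of "-1"]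
  by auto

lemma Lp_cnj: "f \<in> Lp M p \<Longrightarrow> (\<lambda>x. cnj (f x)) \<in> Lp M p"
  unfolding Lp_def by (auto intro: borel_measurable_continuous_on continuous_intros)

text \<open>
  This is Young's inequality with the factors \<open>1/p\<close> and \<open>1/q\<close> bounded by 1. It bounds the pairing of
  the unit balls by 2; functions of other norms are scaled into the unit balls first
  (\<open>coef_in_hull\<close>).
\<close>

lemma Lp_mult_integrable:
  fixes f g :: "'a \<Rightarrow> complex"
  assumes pq: "1 < p" "1 < q" "1 / p + 1 / q = 1" and f: "f \<in> Lp M p" and g: "g \<in> Lp M q"
  shows "integrable M (\<lambda>x. f x * g x)" and "norm (\<integral>x. f x * g x \<partial>M) \<le> pint M p f + pint M q g"
proof -
  have le: "norm (f x * g x) \<le> norm (f x) powr p + norm (g x) powr q" for x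
  proof -
    have "norm (f x) * norm (g x) \<le> norm (f x) powr p / p + norm (g x) powr q / q"
      using pq by (intro Youngs_inequality) auto
    also have "\<dots> \<le> norm (f x) powr p + norm (g x) powr q"
      using pq by (intro add_mono) (auto simp: divide_le_eq mult_le_cancel_left1)
    finally show ?thesis by (simp add: norm_mult)
  qed
  have i: "integrable M (\<lambda>x. norm (f x) powr p + norm (g x) powr q)"
    using f g by (intro Bochner_Integration.integrable_add Lp_integrable)
  show I: "integrable M (\<lambda>x. f x * g x)"
    by (rule Bochner_Integration.integrable_bound[OF i])
       (use Lp_measurable[OF f] Lp_measurable[OF g] in \<open>auto intro!: borel_measurable_times AE_I2 order_trans[OF le]\<close>)
  have "norm (\<integral>x. f x * g x \<partial>M) \<le> (\<integral>x. norm (f x) powr p + norm (g x) powr q \<partial>M)"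
    using integral_norm_bound integral_mono[OF integrable_norm[OF I] i le] by (rule order_trans)
  also have "\<dots> = pint M p f + pint M q g"
    unfolding pint_def using f g by (intro Bochner_Integration.integral_add Lp_integrable)
  finally show "norm (\<integral>x. f x * g x \<partial>M) \<le> pint M p f + pint M q g" .
qed

section \<open>Haar measure on a locally compact group\<close>

locale haar_group =
  fixes \<mu> :: "'a::{topological_group_add, t2_space} measure"
  assumes locally_compact: "locally_compact_space (euclidean :: 'a topology)"
    and haar: "left_haar_measure \<mu>"
begin

lemma sets_mu [measurable_cong]: "sets \<mu> = sets borel"
  using haar by (simp add: left_haar_measure_def)

lemma space_mu [simp]: "space \<mu> = UNIV"
  using sets_eq_imp_space_eq[OF sets_mu] by simp

lemma measurable_mu: "borel_measurable \<mu> = borel_measurable borel"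
  by (rule measurable_cong_sets[OF sets_mu refl])

lemma continuous_measurable:
  fixes f :: "'a \<Rightarrow> 'b::topological_space"
  shows "continuous_on UNIV f \<Longrightarrow> f \<in> borel_measurable \<mu>"
  unfolding measurable_mu by (rule borel_measurable_continuous_onI)

lemma translate_measurable [measurable]:
  "(\<lambda>y. x + y) \<in> measurable \<mu> \<mu>" "(\<lambda>y. y + x) \<in> measurable \<mu> \<mu>"
proof -
  have "(\<lambda>y. x + y) \<in> borel_measurable \<mu>" "(\<lambda>y. y + x) \<in> borel_measurable \<mu>"
    by (intro continuous_measurable continuous_intros)+
  then show "(\<lambda>y. x + y) \<in> measurable \<mu> \<mu>" "(\<lambda>y. y + x) \<in> measurable \<mu> \<mu>"
    by (simp_all add: measurable_cong_sets[OF refl sets_mu])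
qed

lemma borel_translate:
  fixes f :: "'a \<Rightarrow> 'b::topological_space"
  assumes "f \<in> borel_measurable \<mu>"
  shows "(\<lambda>y. f (x + y)) \<in> borel_measurable \<mu>" "(\<lambda>y. f (y + x)) \<in> borel_measurable \<mu>"
  using measurable_compose[OF translate_measurable(1) assms] measurable_compose[OF translate_measurable(2) assms] by auto

lemma compact_sets [simp]: "compact K \<Longrightarrow> K \<in> sets \<mu>"
  and open_sets [simp]: "open U \<Longrightarrow> U \<in> sets \<mu>"
  unfolding sets_mu by (auto intro: borel_closed compact_imp_closed)

lemma emeasure_compact: "compact K \<Longrightarrow> emeasure \<mu> K < \<infinity>"
  using haar by (auto simp: left_haar_measure_def)

lemma distr_translate: "distr \<mu> \<mu> (\<lambda>y. x + y) = \<mu>"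
proof (rule measure_eqI)
  fix E assume "E \<in> sets (distr \<mu> \<mu> (\<lambda>y. x + y))"
  then have E: "E \<in> sets borel" by (simp add: sets_mu)
  have "(\<lambda>y. x + y) -` E = (\<lambda>y. - x + y) ` E"
    by (auto simp: image_iff add.assoc[symmetric] intro!: bexI[of _ "x + _"])
  then show "emeasure (distr \<mu> \<mu> (\<lambda>y. x + y)) E = emeasure \<mu> E"
    using haar E by (subst emeasure_distr) (auto simp: left_haar_measure_def sets_mu)
qed simp

lemma integrable_translate:
  fixes f :: "'a \<Rightarrow> 'b::{banach, second_countable_topology}"
  assumes "f \<in> borel_measurable \<mu>"
  shows "integrable \<mu> (\<lambda>y. f (x + y)) \<longleftrightarrow> integrable \<mu> f"
  using integrable_distr_eq[OF translate_measurable(1)[of x] assms] distr_translate by simp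

lemma integral_translate:
  fixes f :: "'a \<Rightarrow> 'b::{banach, second_countable_topology}"
  assumes "f \<in> borel_measurable \<mu>"
  shows "(\<integral>y. f (x + y) \<partial>\<mu>) = (\<integral>y. f y \<partial>\<mu>)"
  using integral_distr[OF translate_measurable(1)[of x] assms] distr_translate by simp

lemma Lp_translate:
  assumes "f \<in> Lp \<mu> p"
  shows "(\<lambda>y. f (x + y)) \<in> Lp \<mu> p" "pint \<mu> p (\<lambda>y. f (x + y)) = pint \<mu> p f"
proof -
  have f: "f \<in> borel_measurable \<mu>" and i: "integrable \<mu> (\<lambda>x. norm (f x) powr p)"
    using assms by (auto simp: Lp_def)
  have g: "(\<lambda>x. norm (f x) powr p) \<in> borel_measurable \<mu>"
    using i by (rule borel_measurable_integrable)
  show "(\<lambda>y. f (x + y)) \<in> Lp \<mu> p"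
    using borel_translate(1)[OF f, of x] integrable_translate[OF g, of x] i by (simp add: Lp_def)
  show "pint \<mu> p (\<lambda>y. f (x + y)) = pint \<mu> p f"
    unfolding pint_def using integral_translate[OF g] .
qed

definition Cc :: "('a \<Rightarrow> complex) set" where
  "Cc = {f. continuous_on UNIV f \<and> (\<exists>K. compact K \<and> (\<forall>x. x \<notin> K \<longrightarrow> f x = 0))}"

lemma CcE:
  assumes "f \<in> Cc"
  obtains K where "compact K" "\<And>x. x \<notin> K \<Longrightarrow> f x = 0"
  using assms unfolding Cc_def by blast

lemma Cc_continuous: "f \<in> Cc \<Longrightarrow> continuous_on UNIV f"
  by (simp add: Cc_def)

lemma CcI: "continuous_on UNIV f \<Longrightarrow> compact K \<Longrightarrow> (\<And>x. x \<notin> K \<Longrightarrow> f x = 0) \<Longrightarrow> f \<in> Cc"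
  unfolding Cc_def by blast

lemma Cc_bounded:
  assumes "f \<in> Cc"
  obtains M where "M \<ge> 0" "\<And>x. norm (f x) \<le> M"
proof -
  from assms obtain K where K: "compact K" "\<And>x. x \<notin> K \<Longrightarrow> f x = 0" by (rule CcE) blast
  have "compact (f ` K)"
    using K(1) Cc_continuous[OF assms] by (intro compact_continuous_image) (auto intro: continuous_on_subset)
  then obtain M where M: "\<And>x. x \<in> K \<Longrightarrow> norm (f x) \<le> M"
    using compact_imp_bounded[of "f ` K"] unfolding bounded_iff by (metis imageI)
  show ?thesis
  proof (rule that[of "max M 0"])
    show "norm (f x) \<le> max M 0" for x
      using M[of x] K(2)[of x] by (cases "x \<in> K") auto
  qed simp
qed

lemma bounded_compact_integrable:
  fixes f :: "'a \<Rightarrow> 'b::{banach, second_countable_topology}"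
  assumes f: "f \<in> borel_measurable \<mu>" and K: "compact K" "\<And>x. x \<notin> K \<Longrightarrow> f x = 0" and M: "\<And>x. norm (f x) \<le> M"
  shows "integrable \<mu> f" "norm (\<integral>x. f x \<partial>\<mu>) \<le> M * measure \<mu> K"
proof -
  have i: "integrable \<mu> (\<lambda>x. M * indicator K x :: real)"
    using emeasure_compact[OF K(1)] K(1) by (intro Bochner_Integration.integrable_mult_right integrable_real_indicator) auto
  have le: "norm (f x) \<le> M * indicator K x" for x
    using K(2)[of x] M[of x] by (cases "x \<in> K") auto
  show I: "integrable \<mu> f"
    by (rule Bochner_Integration.integrable_bound[OF i f]) (use le in \<open>auto intro!: AE_I2 order_trans[OF _ abs_ge_self]\<close>)
  have "norm (\<integral>x. f x \<partial>\<mu>) \<le> (\<integral>x. M * indicator K x \<partial>\<mu>)"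
    using integral_norm_bound integral_mono[OF integrable_norm[OF I] i le] by (rule order_trans)
  then show "norm (\<integral>x. f x \<partial>\<mu>) \<le> M * measure \<mu> K" using K(1) by simp
qed

lemma bounded_compact_Lp:
  assumes f: "f \<in> borel_measurable \<mu>" and K: "compact K" "\<And>x. x \<notin> K \<Longrightarrow> f x = 0"
    and M: "\<And>x. norm (f x) \<le> M" and p: "0 < p"
  shows "f \<in> Lp \<mu> p" "pint \<mu> p f \<le> M powr p * measure \<mu> K"
proof -
  note [measurable] = f
  have m: "(\<lambda>x. norm (f x) powr p) \<in> borel_measurable \<mu>" by measurable
  have le: "norm (norm (f x) powr p) \<le> M powr p" for x
    using M[of x] p by (auto intro: powr_mono2)
  note * = bounded_compact_integrable[OF m K(1) _ le]
  show "f \<in> Lp \<mu> p" using * K(2) f by (auto simp: Lp_def)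
  show "pint \<mu> p f \<le> M powr p * measure \<mu> K" using *(2) K(2) unfolding pint_def by auto
qed

lemma Cc_Lp:
  assumes "f \<in> Cc" "0 < p" shows "f \<in> Lp \<mu> p"
proof -
  from assms(1) obtain K where K: "compact K" "\<And>x. x \<notin> K \<Longrightarrow> f x = 0" by (rule CcE) blast
  from Cc_bounded[OF assms(1)] obtain M where "\<And>x. norm (f x) \<le> M" by blast
  from bounded_compact_Lp(1)[OF continuous_measurable[OF Cc_continuous[OF assms(1)]] K this assms(2)] show ?thesis .
qed

text \<open>
  Besides separating \<open>K\<close> from the complement of \<open>U\<close>, the function has compact support: it also
  vanishes off a relatively compact neighbourhood \<open>V\<close> of \<open>K\<close>.
\<close>

lemma Urysohn_compact_open:
  assumes K: "compact K" and U: "open U" and KU: "K \<subseteq> U"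
  obtains h :: "'a \<Rightarrow> real" where "continuous_on UNIV h" "\<And>x. 0 \<le> h x" "\<And>x. h x \<le> 1" "\<And>x. x \<in> K \<Longrightarrow> h x = 1"
    "\<And>x. x \<notin> U \<Longrightarrow> h x = 0" "(\<lambda>x. complex_of_real (h x)) \<in> Cc"
proof -
  have H: "Hausdorff_space (euclidean :: 'a topology)"
    unfolding Hausdorff_space_def by (auto simp: disjnt_def) (metis hausdorff)
  have R: "completely_regular_space (euclidean :: 'a topology)"
    using locally_compact locally_compact_Hausdorff_imp_regular_space[OF locally_compact H] completely_regular_eq_regular_space by blast
  obtain V L where VL: "open V" "compact L" "K \<subseteq> V" "V \<subseteq> L"
    using locally_compact_space_compact_closed_compact[of "euclidean :: 'a topology"] locally_compact H K
    by (auto simp: compactin_euclidean_iff)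
  have "closedin euclidean (- (U \<inter> V))" using open_Int[OF U VL(1)] by (simp add: closed_def del: Compl_Int)
  moreover have "disjnt K (- (U \<inter> V))" using KU VL by (auto simp: disjnt_def)
  ultimately obtain h where h: "continuous_map (euclidean :: 'a topology) (top_of_set {0..1::real}) h"
     "h ` (- (U \<inter> V)) \<subseteq> {0}" "h ` K \<subseteq> {1}"
    using Urysohn_completely_regular_compact_closed[of 0 1, OF _ R, of K "- (U \<inter> V)"] K by auto
  show ?thesis
  proof
    show c: "continuous_on UNIV h" using h(1) by (auto simp: continuous_map_in_subtopology)
    show "0 \<le> h x" "h x \<le> 1" for x using h(1) by (auto simp: continuous_map_in_subtopology image_subset_iff Pi_iff)
    show "h x = 1" if "x \<in> K" for x using h(3) that by auto
    show "h x = 0" if "x \<notin> U" for x using h(2) that by auto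
    show "(\<lambda>x. complex_of_real (h x)) \<in> Cc"
      by (rule CcI[OF _ VL(2)]) (use c h(2) VL(4) in \<open>auto intro!: continuous_intros\<close>)
  qed
qed

text \<open>
  Finitely many left translates of \<open>U\<close> cover any given compact set. If \<open>U\<close> were null, so would be
  all compact sets, and by inner regularity the whole group.
\<close>

lemma open_emeasure_pos:
  assumes "open U" "U \<noteq> {}" shows "emeasure \<mu> U > 0"
proof (rule ccontr)
  assume "\<not> emeasure \<mu> U > 0"
  then have U0: "emeasure \<mu> U = 0" by simp
  obtain u where u: "u \<in> U" using assms by blast
  have null: "emeasure \<mu> K = 0" if K: "compact K" for K
  proof -
    define W where "W x = (\<lambda>y. (u - x) + y) -` U" for x
    have Wo: "open (W x)" for x unfolding W_def by (intro open_vimage assms continuous_intros)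
    have xW: "x \<in> W x" for x using u by (simp add: W_def)
    have W0: "emeasure \<mu> (W x) = 0" for x
    proof -
      have "emeasure \<mu> (W x) = emeasure (distr \<mu> \<mu> (\<lambda>y. (u - x) + y)) U"
        using assms by (subst emeasure_distr) (auto simp: W_def)
      then show ?thesis using U0 by (simp add: distr_translate)
    qed
    obtain T where T: "T \<subseteq> K" "finite T" "K \<subseteq> (\<Union>x\<in>T. W x)"
    proof (rule compactE_image[OF K, of K W])
      show "K \<subseteq> \<Union> (W ` K)" using xW by blast
    qed (use Wo in auto)
    have "emeasure \<mu> K \<le> emeasure \<mu> (\<Union>x\<in>T. W x)"
      using T Wo by (intro emeasure_mono sets.finite_UN) auto
    also have "\<dots> \<le> (\<Sum>x\<in>T. emeasure \<mu> (W x))"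
      using T(2) Wo by (intro emeasure_subadditive_finite) auto
    finally show ?thesis using W0 by simp
  qed
  have "emeasure \<mu> UNIV = (SUP K\<in>{K. compact K \<and> K \<subseteq> UNIV}. emeasure \<mu> K)"
    using haar open_UNIV unfolding left_haar_measure_def by blast
  also have "\<dots> \<le> 0" using null by (intro SUP_least) auto
  finally show False using haar by (simp add: left_haar_measure_def)
qed

lemma outer_approx:
  assumes E: "E \<in> sets \<mu>" "emeasure \<mu> E < \<infinity>" and e: "0 < e"
  obtains U where "open U" "E \<subseteq> U" "emeasure \<mu> U < emeasure \<mu> E + ennreal e"
proof -
  have "(INF U\<in>{U. open U \<and> E \<subseteq> U}. emeasure \<mu> U) = emeasure \<mu> E"
    using haar E(1) by (auto simp: left_haar_measure_def)
  also have "\<dots> < emeasure \<mu> E + ennreal e"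
    using E(2) e by (simp add: ennreal_add_left_cancel_less)
  finally show ?thesis using that by (auto simp: INF_less_iff)
qed

lemma inner_approx:
  assumes U: "open U" "emeasure \<mu> U < \<infinity>" and e: "0 < e"
  obtains K where "compact K" "K \<subseteq> U" "emeasure \<mu> (U - K) \<le> ennreal e"
proof (cases "emeasure \<mu> U = 0")
  case True
  then show ?thesis using that[of "{}"] by simp
next
  case False
  then have pos: "0 < emeasure \<mu> U" by (simp add: zero_less_iff_neq_zero)
  obtain r where r: "emeasure \<mu> U = ennreal r" "0 < r"
    using pos U(2) by (cases "emeasure \<mu> U") (auto simp: ennreal_less_zero_iff)
  have "emeasure \<mu> U - ennreal e < emeasure \<mu> U"
    using r e by (simp add: ennreal_minus ennreal_lessI)
  also have "\<dots> = (SUP K\<in>{K. compact K \<and> K \<subseteq> U}. emeasure \<mu> K)"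
    using haar U(1) by (auto simp: left_haar_measure_def)
  finally obtain K where K: "compact K" "K \<subseteq> U" "emeasure \<mu> U - ennreal e < emeasure \<mu> K"
    by (auto simp: less_SUP_iff)
  have "emeasure \<mu> (U - K) = emeasure \<mu> U - emeasure \<mu> K"
    using K U emeasure_compact[OF K(1)] by (intro emeasure_Diff) auto
  also have "\<dots> \<le> ennreal e"
    using K(3) U(2) by (metis ennreal_minus_le_iff infinity_ennreal_def less_imp_le top.not_eq_extremum add.commute)
  finally show ?thesis using K that by blast
qed

end


section \<open>Density of the compactly supported continuous functions\<close>

context haar_group
begin

definition Cc_approximable :: "real \<Rightarrow> ('a \<Rightarrow> complex) \<Rightarrow> bool" where
  "Cc_approximable p f \<longleftrightarrow>
     (\<forall>\<delta>>0. \<exists>h\<in>Cc. (\<lambda>x. f x - h x) \<in> Lp \<mu> p \<and> pint \<mu> p (\<lambda>x. f x - h x) \<le> \<delta>)"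

lemma Cc_add: assumes "f \<in> Cc" "g \<in> Cc" shows "(\<lambda>x. f x + g x) \<in> Cc"
proof -
  from assms(1) obtain K where K: "compact K" "\<And>x. x \<notin> K \<Longrightarrow> f x = 0" by (rule CcE) blast
  from assms(2) obtain L where L: "compact L" "\<And>x. x \<notin> L \<Longrightarrow> g x = 0" by (rule CcE) blast
  show ?thesis
  proof (rule CcI)
    show "continuous_on UNIV (\<lambda>x. f x + g x)"
      by (intro continuous_on_add Cc_continuous assms)
    show "compact (K \<union> L)" using K(1) L(1) by (rule compact_Un)
    show "f x + g x = 0" if "x \<notin> K \<union> L" for x using that K(2) L(2) by simp
  qed
qed

lemma Cc_scale: assumes "f \<in> Cc" shows "(\<lambda>x. c * f x) \<in> Cc"
proof -
  from assms(1) obtain K where K: "compact K" "\<And>x. x \<notin> K \<Longrightarrow> f x = 0" by (rule CcE) blast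
  show ?thesis
  proof (rule CcI)
    show "continuous_on UNIV (\<lambda>x. c * f x)"
      by (intro continuous_on_mult_left Cc_continuous assms)
    show "c * f x = 0" if "x \<notin> K" for x using that K(2) by simp
  qed (rule K(1))
qed

lemma zero_Cc: "(\<lambda>x. 0) \<in> Cc"
  by (rule CcI[of _ "{}"]) auto

lemma approximable_zero: "Cc_approximable p (\<lambda>x. 0)"
  unfolding Cc_approximable_def by (intro allI impI bexI[of _ "\<lambda>x. 0"]) (auto simp: zero_Cc Lp_def pint_def)

lemma approximable_add:
  assumes "Cc_approximable p f" "Cc_approximable p g" "0 \<le> p"
  shows "Cc_approximable p (\<lambda>x. f x + g x)"
  unfolding Cc_approximable_def
proof (intro allI impI)
  fix \<delta> :: real assume \<delta>: "\<delta> > 0"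
  define \<eta> where "\<eta> = \<delta> / (2 powr p * 2)"
  have \<eta>: "\<eta> > 0" using \<delta> by (simp add: \<eta>_def)
  obtain h where h: "h \<in> Cc" "(\<lambda>x. f x - h x) \<in> Lp \<mu> p" "pint \<mu> p (\<lambda>x. f x - h x) \<le> \<eta>"
    using assms(1) \<eta> unfolding Cc_approximable_def by blast
  obtain k where k: "k \<in> Cc" "(\<lambda>x. g x - k x) \<in> Lp \<mu> p" "pint \<mu> p (\<lambda>x. g x - k x) \<le> \<eta>"
    using assms(2) \<eta> unfolding Cc_approximable_def by blast
  have eq: "(\<lambda>x. (f x + g x) - (h x + k x)) = (\<lambda>x. (f x - h x) + (g x - k x))" by auto
  have "pint \<mu> p (\<lambda>x. (f x - h x) + (g x - k x)) \<le> 2 powr p * (\<eta> + \<eta>)"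
    by (rule order_trans[OF Lp_add(2)[OF h(2) k(2) assms(3)]]) (use h k in \<open>auto intro!: mult_left_mono\<close>)
  also have "\<dots> = \<delta>" by (simp add: \<eta>_def)
  finally show "\<exists>h\<in>Cc. (\<lambda>x. f x + g x - h x) \<in> Lp \<mu> p \<and> pint \<mu> p (\<lambda>x. f x + g x - h x) \<le> \<delta>"
    using Lp_add(1)[OF h(2) k(2) assms(3)] Cc_add[OF h(1) k(1)] eq by (intro bexI[of _ "\<lambda>x. h x + k x"]) auto
qed

lemma approximable_scale:
  assumes "Cc_approximable p f"
  shows "Cc_approximable p (\<lambda>x. c * f x)"
  unfolding Cc_approximable_def
proof (intro allI impI)
  fix \<delta> :: real assume \<delta>: "\<delta> > 0"
  define \<eta> where "\<eta> = \<delta> / (norm c powr p + 1)"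
  have pos: "norm c powr p + 1 > 0" by (simp add: add_nonneg_pos)
  have \<eta>: "\<eta> > 0" using \<delta> pos by (simp add: \<eta>_def)
  obtain h where h: "h \<in> Cc" "(\<lambda>x. f x - h x) \<in> Lp \<mu> p" "pint \<mu> p (\<lambda>x. f x - h x) \<le> \<eta>"
    using assms(1) \<eta> unfolding Cc_approximable_def by blast
  have eq: "(\<lambda>x. c * f x - c * h x) = (\<lambda>x. c * (f x - h x))" by (auto simp: right_diff_distrib)
  have "pint \<mu> p (\<lambda>x. c * (f x - h x)) \<le> norm c powr p * \<eta>"
    unfolding Lp_scale(2)[OF h(2)] using h by (intro mult_left_mono) auto
  also have "\<dots> \<le> (norm c powr p + 1) * \<eta>" using \<eta> by simp
  also have "\<dots> = \<delta>" using pos by (simp add: \<eta>_def)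
  finally show "\<exists>h\<in>Cc. (\<lambda>x. c * f x - h x) \<in> Lp \<mu> p \<and> pint \<mu> p (\<lambda>x. c * f x - h x) \<le> \<delta>"
    using Lp_scale(1)[OF h(2)] Cc_scale[OF h(1)] eq by (intro bexI[of _ "\<lambda>x. c * h x"]) auto
qed

text \<open>
  By regularity an open \<open>U\<close> exceeds \<open>E\<close> by measure at most \<open>d\<close>, and \<open>U\<close> in turn exceeds a
  compact \<open>K\<close> by measure at most \<open>d\<close>. A Urysohn function for \<open>K \<subseteq> U\<close> differs from the indicator of
  \<open>E\<close> by at most 1, and only on the small set \<open>B\<close>.
\<close>

lemma approximable_indicator:
  assumes E: "E \<in> sets \<mu>" "emeasure \<mu> E < \<infinity>" and p: "0 < p"
  shows "Cc_approximable p (\<lambda>x. indicator E x)"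
  unfolding Cc_approximable_def
proof (intro allI impI)
  fix \<delta> :: real assume \<delta>: "\<delta> > 0"
  define d where "d = \<delta> / 2"
  have d: "d > 0" using \<delta> by (simp add: d_def)
  obtain U where U: "open U" "E \<subseteq> U" "emeasure \<mu> U < emeasure \<mu> E + ennreal d"
    using outer_approx[OF E d] by blast
  have Uf: "emeasure \<mu> U < \<infinity>"
    using U(3) E(2) by (auto intro: less_trans)
  obtain K where K: "compact K" "K \<subseteq> U" "emeasure \<mu> (U - K) \<le> ennreal d"
    using inner_approx[OF U(1) Uf d] by blast
  have UE: "emeasure \<mu> (U - E) \<le> ennreal d"
  proof -
    have "emeasure \<mu> (U - E) = emeasure \<mu> U - emeasure \<mu> E"
      using E U by (intro emeasure_Diff) auto
    also have "\<dots> \<le> ennreal d"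
      using U(3) E(2) by (intro ennreal_minus_le_iff[THEN iffD2]) (auto simp: add.commute)
    finally show ?thesis .
  qed
  obtain h where h: "continuous_on UNIV h" "\<And>x. 0 \<le> h x" "\<And>x. h x \<le> 1" "\<And>x. x \<in> K \<Longrightarrow> h x = 1"
    "\<And>x. x \<notin> U \<Longrightarrow> h x = 0" "(\<lambda>x. complex_of_real (h x)) \<in> Cc"
    using Urysohn_compact_open[OF K(1) U(1) K(2)] by metis
  define B where "B = (U - K) \<union> (U - E)"
  have Bs: "B \<in> sets \<mu>" using U K E unfolding B_def by (intro sets.Un sets.Diff) auto
  have "emeasure \<mu> B \<le> emeasure \<mu> (U - K) + emeasure \<mu> (U - E)"
    unfolding B_def using U K E by (intro emeasure_subadditive sets.Diff) auto
  also have "\<dots> \<le> ennreal d + ennreal d" by (intro add_mono K UE)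
  also have "\<dots> = ennreal \<delta>" using d by (simp add: ennreal_plus[symmetric] d_def del: ennreal_plus)
  finally have Bd: "emeasure \<mu> B \<le> ennreal \<delta>" .
  have Bf: "emeasure \<mu> B < \<infinity>" using Bd le_less_trans by fastforce
  have Bm: "measure \<mu> B \<le> \<delta>" using Bd \<delta> by (simp add: measure_def enn2real_leI)
  have m: "(\<lambda>x. indicator E x - complex_of_real (h x)) \<in> borel_measurable \<mu>"
    using E continuous_measurable[OF Cc_continuous[OF h(6)]] by (intro borel_measurable_diff borel_measurable_indicator) auto
  have i: "integrable \<mu> (\<lambda>x. indicator B x :: real)" using Bs Bf by (intro integrable_real_indicator) auto
  have le: "norm (indicator E x - complex_of_real (h x)) powr p \<le> indicator B x" for x
  proof (cases "x \<in> B")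
    case True
    have "norm (indicator E x - complex_of_real (h x)) = norm (complex_of_real (indicator E x - h x))"
      by (simp add: indicator_def)
    also have "\<dots> = \<bar>indicator E x - h x\<bar>" by (rule norm_of_real)
    also have "\<dots> \<le> 1" using h(2,3)[of x] by (auto simp: indicator_def)
    finally show ?thesis using True p powr_mono2[of p _ 1] by simp
  next
    case False
    then have "x \<notin> U \<or> (x \<in> K \<and> x \<in> E)" by (auto simp: B_def)
    then show ?thesis using False h(4,5)[of x] U(2) by (auto simp: indicator_def)
  qed
  have "pint \<mu> p (\<lambda>x. indicator E x - complex_of_real (h x)) \<le> (\<integral>x. indicator B x \<partial>\<mu>)"
    by (rule pint_mono[OF m i le])
  also have "\<dots> = measure \<mu> B" using Bs by simp
  finally show "\<exists>h\<in>Cc. (\<lambda>x. indicator E x - h x) \<in> Lp \<mu> p \<and> pint \<mu> p (\<lambda>x. indicator E x - h x) \<le> \<delta>"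
    using Bm h(6) LpI[OF m i le] by (intro bexI[OF _ h(6)]) auto
qed

lemma approximable_finite_sum:
  assumes "finite J" "0 \<le> p" "\<And>j. j \<in> J \<Longrightarrow> Cc_approximable p (f j)"
  shows "Cc_approximable p (\<lambda>x. \<Sum>j\<in>J. f j x)"
  using assms(1,3) by (induction J) (auto intro: approximable_zero approximable_add[OF _ _ assms(2)])

lemma approximable_simple:
  assumes s: "simple_function \<mu> s" and sL: "s \<in> Lp \<mu> p" and p: "0 < p"
  shows "Cc_approximable p s"
proof -
  have fin: "finite (range s)" using s by (simp add: simple_function_def)
  have "s = (\<lambda>x. \<Sum>c\<in>range s - {0}. c * indicator (s -` {c}) x)"
  proof
    fix x
    have "(\<Sum>c\<in>range s - {0}. c * indicator (s -` {c}) x) = (\<Sum>c\<in>range s - {0}. if s x = c then c else 0)"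
      by (intro sum.cong) (auto simp: indicator_def)
    also have "\<dots> = s x" using fin by (simp add: sum.delta)
    finally show "s x = (\<Sum>c\<in>range s - {0}. c * indicator (s -` {c}) x)" by simp
  qed
  moreover have "Cc_approximable p (\<lambda>x. \<Sum>c\<in>range s - {0}. c * indicator (s -` {c}) x)"
  proof (intro approximable_finite_sum approximable_scale approximable_indicator)
    fix c assume c: "c \<in> range s - {0}"
    show S: "s -` {c} \<in> sets \<mu>" using s c by (auto simp: simple_function_def)
    have "integrable \<mu> (\<lambda>x. indicator (s -` {c}) x * norm c powr p)"
    proof (rule Bochner_Integration.integrable_bound[OF Lp_integrable[OF sL]])
      show "(\<lambda>x. indicator (s -` {c}) x * norm c powr p) \<in> borel_measurable \<mu>"
        by (intro borel_measurable_times borel_measurable_indicator S borel_measurable_const)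
    qed (auto simp: indicator_def)
    then have "integrable \<mu> (\<lambda>x. indicator (s -` {c}) x :: real)"
      using c by simp
    then show "emeasure \<mu> (s -` {c}) < \<infinity>" by (simp add: integrable_indicator_iff)
  qed (use fin p in auto)
  ultimately show ?thesis by simp
qed

text \<open>
  Simple functions with \<open>|s i| \<le> 2 |f|\<close> converge to \<open>f\<close> in \<open>L\<^sup>p\<close> by dominated convergence, and simple
  functions in \<open>L\<^sup>p\<close> are combinations of indicators of sets of finite measure.
\<close>

lemma Cc_dense:
  assumes f: "f \<in> Lp \<mu> p" and p: "0 < p"
  shows "Cc_approximable p f"
  unfolding Cc_approximable_def
proof (intro allI impI)
  fix \<delta> :: real assume \<delta>: "\<delta> > 0"
  have fm: "f \<in> borel_measurable \<mu>" by (rule Lp_measurable[OF f])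
  obtain s where s: "\<And>i. simple_function \<mu> (s i)" "\<And>x. (\<lambda>i. s i x) \<longlonglongrightarrow> f x"
     "\<And>i x. dist (s i x) 0 \<le> 2 * dist (f x) 0"
    using borel_measurable_implies_sequence_metric[OF fm, of 0] by auto
  have sm: "s i \<in> borel_measurable \<mu>" for i using s(1) by (rule borel_measurable_simple_function)
  have "(\<lambda>i. \<integral>x. norm (f x - s i x) powr p \<partial>\<mu>) \<longlonglongrightarrow> (\<integral>x. 0 \<partial>\<mu>)"
  proof (rule integral_dominated_convergence[where w="\<lambda>x. 3 powr p * norm (f x) powr p"])
    \<comment> \<open>\<open>|f - s i| \<le> |f| + 2 |f|\<close>\<close>
    show "integrable \<mu> (\<lambda>x. 3 powr p * norm (f x) powr p)" using Lp_integrable[OF f] by simp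
    show "(\<lambda>x. norm (f x - s i x) powr p) \<in> borel_measurable \<mu>" for i
      using fm sm[of i] by measurable
    show "AE x in \<mu>. (\<lambda>i. norm (f x - s i x) powr p) \<longlonglongrightarrow> 0"
    proof (rule AE_I2)
      fix x
      have "(\<lambda>i. norm (f x - s i x)) \<longlonglongrightarrow> norm (f x - f x)" by (intro tendsto_intros s)
      then have "(\<lambda>i. norm (f x - s i x)) \<longlonglongrightarrow> 0" by simp
      then show "(\<lambda>i. norm (f x - s i x) powr p) \<longlonglongrightarrow> 0"
        using tendsto_powr'[OF _ tendsto_const, of "\<lambda>i. norm (f x - s i x)" 0 sequentially p] p by simp
    qed
    show "AE x in \<mu>. norm (norm (f x - s i x) powr p) \<le> 3 powr p * norm (f x) powr p" for i
    proof (rule AE_I2)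
      fix x
      have "norm (f x - s i x) \<le> 3 * norm (f x)"
        using norm_triangle_ineq4[of "f x" "s i x"] s(3)[of i x] by simp
      then have "norm (f x - s i x) powr p \<le> (3 * norm (f x)) powr p"
        using p by (intro powr_mono2) auto
      then show "norm (norm (f x - s i x) powr p) \<le> 3 powr p * norm (f x) powr p"
        by (simp add: powr_mult)
    qed
  qed simp
  then have lim: "(\<lambda>i. pint \<mu> p (\<lambda>x. f x - s i x)) \<longlonglongrightarrow> 0" by (simp add: pint_def)
  define \<eta> where "\<eta> = \<delta> / (2 powr p * 2)"
  have \<eta>: "\<eta> > 0" using \<delta> by (simp add: \<eta>_def)
  have "eventually (\<lambda>i. pint \<mu> p (\<lambda>x. f x - s i x) < \<eta>) sequentially"
    by (rule order_tendstoD(2)[OF lim \<eta>])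
  then obtain i where i: "pint \<mu> p (\<lambda>x. f x - s i x) < \<eta>"
    using eventually_happens'[OF sequentially_bot] by blast
  have sL: "s i \<in> Lp \<mu> p"
  proof (rule LpI[OF sm])
    show "integrable \<mu> (\<lambda>x. 2 powr p * norm (f x) powr p)" using Lp_integrable[OF f] by simp
    show "norm (s i x) powr p \<le> 2 powr p * norm (f x) powr p" for x
      using s(3)[of i x] p powr_mono2[of p "norm (s i x)" "2 * norm (f x)"] by (simp add: powr_mult)
  qed
  obtain h where h: "h \<in> Cc" "(\<lambda>x. s i x - h x) \<in> Lp \<mu> p" "pint \<mu> p (\<lambda>x. s i x - h x) \<le> \<eta>"
    using approximable_simple[OF s(1) sL p] \<eta> unfolding Cc_approximable_def by blast
  have fs: "(\<lambda>x. f x - s i x) \<in> Lp \<mu> p" using Lp_diff(1)[OF f sL] p by simp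
  have eq: "(\<lambda>x. (f x - s i x) + (s i x - h x)) = (\<lambda>x. f x - h x)" by auto
  have "pint \<mu> p (\<lambda>x. (f x - s i x) + (s i x - h x)) \<le> 2 powr p * (\<eta> + \<eta>)"
    by (rule order_trans[OF Lp_add(2)[OF fs h(2)]]) (use h i p in \<open>auto intro!: mult_left_mono\<close>)
  also have "\<dots> = \<delta>" by (simp add: \<eta>_def)
  finally show "\<exists>h\<in>Cc. (\<lambda>x. f x - h x) \<in> Lp \<mu> p \<and> pint \<mu> p (\<lambda>x. f x - h x) \<le> \<delta>"
    using Lp_add(1)[OF fs h(2)] p eq h(1) by (intro bexI[of _ h]) auto
qed

end

section \<open>Coefficient functions and \<open>A\<^sub>p\<close>\<close>

locale haar_exponents = haar_group \<mu> for \<mu> :: "'a::{topological_group_add, t2_space} measure" +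
  fixes p q :: real
  assumes p_gt_1: "1 < p" and q_def: "q = conjugate_exponent p"
begin

lemma conjugate: "1 / p + 1 / q = 1"
  using conjugate_exponent_iff[OF p_gt_1] q_def by simp

lemma q_gt_1: "1 < q"
  using p_gt_1 unfolding q_def conjugate_exponent_def by (simp add: field_simps)

lemmas pq = p_gt_1 q_gt_1 conjugate

definition coef :: "('a \<Rightarrow> complex) \<Rightarrow> ('a \<Rightarrow> complex) \<Rightarrow> 'a \<Rightarrow> complex" where
  "coef f g = convolution \<mu> f (tilde g)"

lemma coef_eq: "coef f g x = (\<integral>y. f y * cnj (g (- x + y)) \<partial>\<mu>)"
  by (simp add: coef_def convolution_def tilde_def minus_add)

text \<open>
  Left invariance moves the translation from \<open>g\<close> to \<open>f\<close>. In this form \<open>coef f g x\<close> is the pairing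
  of a left translate of \<open>f\<close> with the fixed function \<open>g\<close>.
\<close>

lemma coef_translate: 
  assumes "f \<in> Lp \<mu> p" "g \<in> Lp \<mu> q"
  shows "coef f g x = (\<integral>y. f (x + y) * cnj (g y) \<partial>\<mu>)"
proof -
  have m: "(\<lambda>y. f y * cnj (g (- x + y))) \<in> borel_measurable \<mu>"
    using Lp_measurable[OF assms(1)] Lp_measurable[OF Lp_cnj[OF Lp_translate(1)[OF assms(2)]]]
    by (intro borel_measurable_times)
  show ?thesis unfolding coef_eq
    using integral_translate[OF m, of x] by (simp add: add.assoc[symmetric])
qed

lemma coef_integrable:
  assumes "f \<in> Lp \<mu> p" "g \<in> Lp \<mu> q"
  shows "integrable \<mu> (\<lambda>y. f y * cnj (g (- x + y)))"
  by (rule Lp_mult_integrable(1)[OF pq assms(1) Lp_cnj[OF Lp_translate(1)[OF assms(2)]]])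

lemma coef_bound:
  assumes "f \<in> Lp \<mu> p" "g \<in> Lp \<mu> q"
  shows "norm (coef f g x) \<le> pint \<mu> p f + pint \<mu> q g"
proof -
  have "pint \<mu> q (\<lambda>y. cnj (g (- x + y))) = pint \<mu> q g"
    using Lp_translate(2)[OF assms(2), of "-x"] by (simp add: pint_def)
  then show ?thesis
    using Lp_mult_integrable(2)[OF pq assms(1) Lp_cnj[OF Lp_translate(1)[OF assms(2)]], of "-x"]
    by (simp add: coef_eq)
qed

lemma coef_scale: "coef (\<lambda>x. c * f x) (\<lambda>x. d * g x) x = c * cnj d * coef f g x"
proof -
  have "coef (\<lambda>x. c * f x) (\<lambda>x. d * g x) x = (\<integral>y. (c * cnj d) * (f y * cnj (g (- x + y))) \<partial>\<mu>)"
    by (simp add: coef_eq mult_ac)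
  then show ?thesis by (simp add: coef_eq)
qed

text \<open>
  The parameter \<open>F\<close> restricts both factors to a class of functions; it will be \<open>UNIV\<close> or \<open>Cc\<close>.
\<close>

definition atoms :: "('a \<Rightarrow> complex) set \<Rightarrow> ('a \<Rightarrow> complex) set" where
  "atoms F = {coef f g | f g. f \<in> F \<and> f \<in> Lp \<mu> p \<and> pint \<mu> p f \<le> 1 \<and> g \<in> F \<and> g \<in> Lp \<mu> q \<and> pint \<mu> q g \<le> 1}"

lemma atomsI:
  assumes "f \<in> F" "f \<in> Lp \<mu> p" "pint \<mu> p f \<le> 1" "g \<in> F" "g \<in> Lp \<mu> q" "pint \<mu> q g \<le> 1"
  shows "coef f g \<in> atoms F"
  using assms unfolding atoms_def by blast

lemma atomsE:
  assumes "a \<in> atoms F"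
  obtains f g where "a = coef f g" "f \<in> F" "f \<in> Lp \<mu> p" "pint \<mu> p f \<le> 1" "g \<in> F" "g \<in> Lp \<mu> q" "pint \<mu> q g \<le> 1"
  using assms unfolding atoms_def by blast

lemma bounded_atoms_coef: "bounded_atoms (atoms F) 2"
  unfolding bounded_atoms_def
proof (intro ballI allI)
  fix a x assume "a \<in> atoms F"
  then obtain f g where fg: "a = coef f g" "f \<in> Lp \<mu> p" "pint \<mu> p f \<le> 1" "g \<in> Lp \<mu> q" "pint \<mu> q g \<le> 1"
    by (rule atomsE) blast
  show "norm (a x) \<le> 2" using coef_bound[OF fg(2,4), of x] fg by simp
qed

lemma atoms_nonempty: "atoms Cc \<noteq> {}"
proof -
  have "coef (\<lambda>x. 0) (\<lambda>x. 0) \<in> atoms Cc"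
    by (rule atomsI) (use zero_Cc in \<open>auto simp: Lp_def pint_def\<close>)
  then show ?thesis by blast
qed

text \<open>
  The factors are divided by \<open>a\<close> and \<open>b\<close>. The strict positivity of \<open>a\<close> and \<open>b\<close> covers functions of norm
  \<open>0\<close>, whose coefficients lie in the hulls of all positive radii.
\<close>

lemma coef_in_hull:
  assumes f: "f \<in> Lp \<mu> p" "pint \<mu> p f \<le> a powr p" "0 < a"
    and g: "g \<in> Lp \<mu> q" "pint \<mu> q g \<le> b powr q" "0 < b"
    and F: "f \<in> F" "g \<in> F" "\<And>c f. f \<in> F \<Longrightarrow> (\<lambda>x. c * f x) \<in> F"
  shows "coef f g \<in> l1_hull (atoms F) (a * b)"
proof -
  define f' g' where "f' = (\<lambda>x. complex_of_real (inverse a) * f x)" "g' = (\<lambda>x. complex_of_real (inverse b) * g x)"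
  have "pint \<mu> p f' = inverse a powr p * pint \<mu> p f"
    unfolding f'_g'_def using Lp_scale(2)[OF f(1)] f(3) by (simp del: of_real_inverse)
  also have "\<dots> \<le> inverse a powr p * a powr p" using f by (intro mult_left_mono) auto
  also have "\<dots> = 1" using f(3) by (simp add: powr_mult[symmetric])
  finally have 1: "pint \<mu> p f' \<le> 1" .
  have "pint \<mu> q g' = inverse b powr q * pint \<mu> q g"
    unfolding f'_g'_def using Lp_scale(2)[OF g(1)] g(3) by (simp del: of_real_inverse)
  also have "\<dots> \<le> inverse b powr q * b powr q" using g by (intro mult_left_mono) auto
  also have "\<dots> = 1" using g(3) by (simp add: powr_mult[symmetric])
  finally have 2: "pint \<mu> q g' \<le> 1" .
  have "coef f' g' \<in> atoms F"
    using 1 2 F Lp_scale(1)[OF f(1)] Lp_scale(1)[OF g(1)] unfolding f'_g'_def by (intro atomsI) blast+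
  from atom_in_hull[OF this, of "complex_of_real (a * b)"]
  have "(\<lambda>x. complex_of_real (a * b) * coef f' g' x) \<in> l1_hull (atoms F) (a * b)"
    using f g by (simp add: norm_mult)
  also have "(\<lambda>x. complex_of_real (a * b) * coef f' g' x) = coef f g"
    using f(3) g(3) unfolding f'_g'_def by (intro ext) (simp only: coef_scale, simp add: field_simps)
  finally show ?thesis .
qed

lemma coef_diff_left:
  assumes "f \<in> Lp \<mu> p" "f' \<in> Lp \<mu> p" "g \<in> Lp \<mu> q"
  shows "coef (\<lambda>x. f x - f' x) g x = coef f g x - coef f' g x"
  unfolding coef_eq left_diff_distrib using assms by (intro Bochner_Integration.integral_diff coef_integrable)

lemma coef_diff_right:
  assumes "f \<in> Lp \<mu> p" "g \<in> Lp \<mu> q" "g' \<in> Lp \<mu> q"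
  shows "coef f (\<lambda>x. g x - g' x) x = coef f g x - coef f g' x"
  unfolding coef_eq complex_cnj_diff right_diff_distrib using assms by (intro Bochner_Integration.integral_diff coef_integrable)

lemma pint_approx_le:
  assumes f: "f \<in> Lp \<mu> r" "pint \<mu> r f \<le> 1" and h: "(\<lambda>x. f x - h x) \<in> Lp \<mu> r" "pint \<mu> r (\<lambda>x. f x - h x) \<le> (1/16) powr r"
    and r: "1 < r"
  shows "pint \<mu> r h \<le> 4 powr r"
proof -
  have "(1/16::real) powr r \<le> 1 powr r" using r by (intro powr_mono2) auto
  then have 1: "(1/16::real) powr r \<le> 1" by simp
  have "pint \<mu> r (\<lambda>x. f x - (f x - h x)) \<le> 2 powr r * (1 + 1)"
    by (rule order_trans[OF Lp_diff(2)[OF f(1) h(1)]]) (use r f h 1 in \<open>auto intro!: mult_left_mono\<close>)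
  also have "\<dots> \<le> 2 powr r * 2 powr r" using r powr_mono[of 1 r "2::real"] by (intro mult_left_mono) auto
  also have "\<dots> = 4 powr r" by (simp add: powr_mult[symmetric])
  finally show ?thesis by simp
qed

text \<open>
  By density of \<open>Cc\<close> the factors of an atom \<open>coef f g\<close> are replaced by \<open>h\<close> and \<open>k\<close> at distance at most
  \<open>1/16\<close>, whose norms are at most 4 by \<open>pint_approx_le\<close>. The error
  \<open>coef (f - h) g + coef h (g - k)\<close> has size at most \<open>1/16 + 4/16 < 1/2\<close>, as \<open>hull_approx\<close> requires.
\<close>

lemma hull_atoms_Cc:
  assumes "u \<in> l1_hull (atoms UNIV) s"
  shows "u \<in> l1_hull (atoms Cc) (32 * s)"
proof -
  have "\<exists>h\<in>l1_hull (atoms Cc) 16. (\<lambda>x. a x - h x) \<in> l1_hull (atoms UNIV) (1/2)" if "a \<in> atoms UNIV" for a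
  proof -
    from that obtain f g where a: "a = coef f g"
      and f: "f \<in> Lp \<mu> p" "pint \<mu> p f \<le> 1" and g: "g \<in> Lp \<mu> q" "pint \<mu> q g \<le> 1"
      by (rule atomsE) blast
    obtain h where h: "h \<in> Cc" "(\<lambda>x. f x - h x) \<in> Lp \<mu> p" "pint \<mu> p (\<lambda>x. f x - h x) \<le> (1/16) powr p"
      using Cc_dense[OF f(1), unfolded Cc_approximable_def, rule_format, of "(1/16) powr p"] p_gt_1 by auto
    obtain k where k: "k \<in> Cc" "(\<lambda>x. g x - k x) \<in> Lp \<mu> q" "pint \<mu> q (\<lambda>x. g x - k x) \<le> (1/16) powr q"
      using Cc_dense[OF g(1), unfolded Cc_approximable_def, rule_format, of "(1/16) powr q"] q_gt_1 by auto
    have hL: "h \<in> Lp \<mu> p" and kL: "k \<in> Lp \<mu> q" using Cc_Lp h k pq by auto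
    have h4: "pint \<mu> p h \<le> 4 powr p" by (rule pint_approx_le[OF f h(2,3) p_gt_1])
    have k4: "pint \<mu> q k \<le> 4 powr q" by (rule pint_approx_le[OF g k(2,3) q_gt_1])
    have 1: "coef h k \<in> l1_hull (atoms Cc) 16"
      using coef_in_hull[OF hL h4 _ kL k4 _ h(1) k(1) Cc_scale] by simp
    have 2: "coef (\<lambda>x. f x - h x) g \<in> l1_hull (atoms UNIV) (1/16 * 1)"
      by (rule coef_in_hull[OF h(2,3) _ g(1)]) (use g in auto)
    have 3: "coef h (\<lambda>x. g x - k x) \<in> l1_hull (atoms UNIV) (4 * (1/16))"
      by (rule coef_in_hull[OF hL h4 _ k(2,3)]) auto
    have "(\<lambda>x. coef (\<lambda>x. f x - h x) g x + coef h (\<lambda>x. g x - k x) x) \<in> l1_hull (atoms UNIV) (1/16 * 1 + 4 * (1/16))"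
      by (rule hull_add[OF bounded_atoms_coef 2 3])
    also have "(\<lambda>x. coef (\<lambda>x. f x - h x) g x + coef h (\<lambda>x. g x - k x) x) = (\<lambda>x. a x - coef h k x)"
      by (auto simp: a coef_diff_left[OF f(1) hL g(1)] coef_diff_right[OF hL g(1) kL])
    finally have "(\<lambda>x. a x - coef h k x) \<in> l1_hull (atoms UNIV) (1/2)" by (rule hull_mono) simp
    with 1 show ?thesis by blast
  qed
  from hull_approx[OF bounded_atoms_coef bounded_atoms_coef this assms] show ?thesis by simp
qed

lemma atoms_mono: "atoms F \<subseteq> atoms UNIV"
  unfolding atoms_def by blast

text \<open>
  The terms of a representation are normalised one by one. Since norms may be \<open>0\<close>, both norms of the \<open>i\<close>-th term are
  enlarged by some \<open>\<eta> > 0\<close> that increases their product by at most \<open>d / 2 ^ (i + 1)\<close>; altogether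
  this uses up the gap \<open>d\<close> between the sum and \<open>C\<close>.
\<close>

lemma representation_in_hull:
  assumes rep: "Ap_representation \<mu> p f g u"
    and S: "(\<Sum>i. Lp_norm \<mu> p (f i) * Lp_norm \<mu> q (g i)) < C"
  shows "u \<in> l1_hull (atoms UNIV) C"
proof -
  define S' where "S' = (\<Sum>i. Lp_norm \<mu> p (f i) * Lp_norm \<mu> q (g i))"
  have f: "f i \<in> Lp \<mu> p" and g: "g i \<in> Lp \<mu> q" for i using rep by (auto simp: Ap_representation_def q_def)
  have sm: "summable (\<lambda>i. Lp_norm \<mu> p (f i) * Lp_norm \<mu> q (g i))"
    and sums: "\<And>x. (\<lambda>i. coef (f i) (g i) x) sums u x"
    using rep by (auto simp: Ap_representation_def q_def coef_def)
  define d where "d = C - S'"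
  have d: "d > 0" using S by (simp add: d_def S'_def)
  have "coef (f i) (g i) \<in> l1_hull (atoms UNIV) (Lp_norm \<mu> p (f i) * Lp_norm \<mu> q (g i) + d * (1/2) ^ Suc i)" for i
  proof -
    define A B \<delta> where "A = Lp_norm \<mu> p (f i)" "B = Lp_norm \<mu> q (g i)" "\<delta> = d * (1/2) ^ Suc i"
    have AB: "A \<ge> 0" "B \<ge> 0" and \<delta>: "\<delta> > 0" using d by (auto simp: A_B_\<delta>_def Lp_norm_def)
    \<comment> \<open>chosen such that \<open>(A + \<eta>) * (B + \<eta>) \<le> A * B + \<eta> * (A + B + 1)\<close> is at most \<open>A * B + \<delta>\<close>\<close>
    define \<eta> where "\<eta> = min 1 (\<delta> / (A + B + 1))"
    have \<eta>: "\<eta> > 0" "\<eta> \<le> 1" "\<eta> \<le> \<delta> / (A + B + 1)" using AB \<delta> by (auto simp: \<eta>_def)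
    have pA: "pint \<mu> p (f i) \<le> (A + \<eta>) powr p"
    proof -
      have "pint \<mu> p (f i) = A powr p" using p_gt_1 by (simp add: A_B_\<delta>_def Lp_norm_pint powr_powr)
      also have "\<dots> \<le> (A + \<eta>) powr p" using AB \<eta> p_gt_1 by (intro powr_mono2) auto
      finally show ?thesis .
    qed
    have pB: "pint \<mu> q (g i) \<le> (B + \<eta>) powr q"
    proof -
      have "pint \<mu> q (g i) = B powr q" using q_gt_1 by (simp add: A_B_\<delta>_def Lp_norm_pint powr_powr)
      also have "\<dots> \<le> (B + \<eta>) powr q" using AB \<eta> q_gt_1 by (intro powr_mono2) auto
      finally show ?thesis .
    qed
    have "coef (f i) (g i) \<in> l1_hull (atoms UNIV) ((A + \<eta>) * (B + \<eta>))"
      by (rule coef_in_hull[OF f pA _ g pB]) (use AB \<eta> in auto)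
    moreover have "(A + \<eta>) * (B + \<eta>) \<le> A * B + \<delta>"
    proof -
      have "(A + \<eta>) * (B + \<eta>) = A * B + \<eta> * (A + B + \<eta>)" by (simp add: algebra_simps)
      also have "\<eta> * (A + B + \<eta>) \<le> \<delta> / (A + B + 1) * (A + B + 1)"
        using AB \<eta> \<delta> by (intro mult_mono) auto
      also have "\<dots> = \<delta>" using AB by simp
      finally show ?thesis by simp
    qed
    ultimately show ?thesis unfolding A_B_\<delta>_def by (rule hull_mono)
  qed
  moreover have "(\<lambda>i. Lp_norm \<mu> p (f i) * Lp_norm \<mu> q (g i) + d * (1/2) ^ Suc i) sums (S' + d * 1)"
    unfolding S'_def using sm by (intro sums_add sums_mult power_half_series summable_sums)
  ultimately have "u \<in> l1_hull (atoms UNIV) (S' + d * 1)"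
    by (rule hull_sums_le[OF bounded_atoms_coef _ _ sums])
  then show ?thesis by (simp add: d_def)
qed

lemma Ap_in_hull:
  assumes "u \<in> Ap \<mu> p" "Ap_norm \<mu> p u < C"
  shows "u \<in> l1_hull (atoms UNIV) C"
proof -
  let ?S = "{(\<Sum>i. Lp_norm \<mu> p (f i) * Lp_norm \<mu> (conjugate_exponent p) (g i)) | f g. Ap_representation \<mu> p f g u}"
  have "?S \<noteq> {}" using assms(1) by (auto simp: Ap_def)
  then obtain s where "s \<in> ?S" "s < C"
    using assms(2) cInf_lessD[of ?S C] unfolding Ap_norm_def by blast
  then show ?thesis using representation_in_hull q_def by auto
qed

lemma hull_in_Ap:
  assumes "u \<in> l1_hull (atoms UNIV) r" "u \<in> C0"
  shows "u \<in> Ap \<mu> p"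
proof -
  from assms(1) obtain a c where ac: "\<And>i::nat. a i \<in> atoms UNIV" "summable (\<lambda>i. norm (c i))"
    "\<And>x. (\<lambda>i. c i * a i x) sums u x" by (rule hullE) blast
  have "\<forall>i. \<exists>f g. a i = coef f g \<and> f \<in> Lp \<mu> p \<and> pint \<mu> p f \<le> 1 \<and> g \<in> Lp \<mu> q \<and> pint \<mu> q g \<le> 1"
    using ac(1) unfolding atoms_def by blast
  then obtain f g where fg: "\<And>i. a i = coef (f i) (g i)" "\<And>i. f i \<in> Lp \<mu> p" "\<And>i. pint \<mu> p (f i) \<le> 1"
    "\<And>i. g i \<in> Lp \<mu> q" "\<And>i. pint \<mu> q (g i) \<le> 1" by metis
  define f' where "f' i = (\<lambda>x. c i * f i x)" for i
  have f': "f' i \<in> Lp \<mu> p" for i unfolding f'_def by (rule Lp_scale(1)[OF fg(2)])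
  have le: "Lp_norm \<mu> p (f' i) * Lp_norm \<mu> q (g i) \<le> norm (c i)" for i
  proof -
    have "Lp_norm \<mu> p (f' i) = norm (c i) * pint \<mu> p (f i) powr (1/p)"
      unfolding Lp_norm_pint f'_def Lp_scale(2)[OF fg(2)] using p_gt_1 by (simp add: powr_mult powr_powr)
    also have "\<dots> \<le> norm (c i) * 1 powr (1/p)"
      using fg(3) p_gt_1 by (intro mult_left_mono powr_mono2) auto
    finally have 1: "Lp_norm \<mu> p (f' i) \<le> norm (c i)" by simp
    have "Lp_norm \<mu> q (g i) \<le> 1 powr (1/q)"
      unfolding Lp_norm_pint using fg(5) q_gt_1 by (intro powr_mono2) auto
    then have "Lp_norm \<mu> p (f' i) * Lp_norm \<mu> q (g i) \<le> norm (c i) * 1"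
      using 1 by (intro mult_mono) (auto simp: Lp_norm_def)
    then show ?thesis by simp
  qed
  have "summable (\<lambda>i. Lp_norm \<mu> p (f' i) * Lp_norm \<mu> q (g i))"
    by (rule summable_comparison_test'[OF ac(2), of 0]) (use le in \<open>auto simp: Lp_norm_def\<close>)
  moreover have "(\<lambda>i. coef (f' i) (g i) x) sums u x" for x
    using ac(3)[of x] coef_scale[of "c i" "f i" 1 "g i" x for i] by (simp add: fg(1) f'_def)
  ultimately have "Ap_representation \<mu> p f' g u"
    unfolding Ap_representation_def using f' fg(4) by (simp add: q_def coef_def)
  then show ?thesis using assms(2) by (auto simp: Ap_def)
qed

lemma Ap_iff_hull: "u \<in> Ap \<mu> p \<longleftrightarrow> u \<in> C0 \<and> (\<exists>r. u \<in> l1_hull (atoms UNIV) r)"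
  using hull_in_Ap Ap_in_hull[of u "Ap_norm \<mu> p u + 1"] by (auto simp: Ap_def)

end


section \<open>Products of coefficient functions\<close>

context haar_group
begin

lemma right_translate_locally_uniform:
  fixes f :: "'a \<Rightarrow> 'b::metric_space"
  assumes f: "continuous_on UNIV f" and K: "compact K" and \<epsilon>: "0 < \<epsilon>"
  obtains N where "open N" "z0 \<in> N" "\<And>y z. y \<in> K \<Longrightarrow> z \<in> N \<Longrightarrow> dist (f (y + z)) (f (y + z0)) \<le> \<epsilon>"
proof -
  have c: "continuous_on (UNIV \<times> K) (\<lambda>(z, y). f (y + z))"
    unfolding case_prod_unfold
    by (rule continuous_on_compose2[OF f]) (auto intro!: continuous_intros)
  show ?thesis
    by (rule continuous_on_prod_compactE[OF c K UNIV_I \<epsilon>, of z0]) (use that in auto)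
qed

text \<open>
  For a finite subcover, \<open>s z\<close> is the centre of one of the chosen neighbourhoods that contains \<open>z\<close>. Taking values
  in a finite set, \<open>s\<close> plays the role of a tagged partition of \<open>Z\<close>.
\<close>

lemma simple_selection:
  assumes Z: "compact Z" and N: "\<And>z. z \<in> Z \<Longrightarrow> open (N z) \<and> z \<in> N z"
  obtains s :: "'a \<Rightarrow> 'a" where "finite (range s)" "\<And>a. s -` {a} \<in> sets \<mu>" "\<And>z. z \<in> Z \<Longrightarrow> z \<in> N (s z)"
proof -
  obtain T where T: "T \<subseteq> Z" "finite T" "Z \<subseteq> (\<Union>t\<in>T. N t)"
  proof (rule compactE_image[OF Z, of Z N])
    show "Z \<subseteq> \<Union> (N ` Z)" using N by blast
  qed (use N in auto)
  have "\<exists>s :: 'a \<Rightarrow> 'a. finite (range s) \<and> (\<forall>a. s -` {a} \<in> sets \<mu>) \<and> (\<forall>z\<in>\<Union>t\<in>T. N t. z \<in> N (s z))"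
    using T(2,1)
  proof (induction T)
    case empty
    have "(\<lambda>_::'a. 0::'a) -` {a} \<in> sets \<mu>" for a by (cases "a = 0") (auto simp: vimage_def)
    then show ?case by (intro exI[of _ "\<lambda>_. 0"]) auto
  next
    case (insert t T)
    have TZ: "T \<subseteq> Z" using insert.prems by simp
    from insert.IH[OF this] obtain s where s: "finite (range s)" "\<forall>a. s -` {a} \<in> sets \<mu>" "\<forall>z\<in>\<Union>t\<in>T. N t. z \<in> N (s z)" by blast
    define s' where "s' z = (if z \<in> N t then t else s z)" for z
    have Nt: "N t \<in> sets \<mu>" using N insert.prems by auto
    have "range s' \<subseteq> insert t (range s)" by (auto simp: s'_def)
    then have 1: "finite (range s')" using s(1) finite_subset by blast
    have "s' -` {a} = (if a = t then N t \<union> s -` {a} else s -` {a} - N t)" for a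
      by (rule set_eqI) (simp add: s'_def)
    then have 2: "s' -` {a} \<in> sets \<mu>" for a using s(2) Nt by auto
    have "\<forall>z\<in>\<Union>t\<in>insert t T. N t. z \<in> N (s' z)" using s(3) by (auto simp: s'_def)
    with 1 2 show ?case by blast
  qed
  then obtain s :: "'a \<Rightarrow> 'a" where s: "finite (range s)" "\<forall>a. s -` {a} \<in> sets \<mu>" "\<forall>z\<in>\<Union>t\<in>T. N t. z \<in> N (s z)" by blast
  show ?thesis
  proof (rule that[of s])
    show "z \<in> N (s z)" if "z \<in> Z" for z using s(3) T(3) that by blast
  qed (use s in auto)
qed

lemma integral_finite_range:
  fixes \<phi> :: "'c \<Rightarrow> 'b::{banach, second_countable_topology}"
  assumes Z: "compact Z" and fin: "finite (\<sigma> ` Z)" and lev: "\<And>c. \<sigma> -` {c} \<in> sets \<mu>"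
  shows "integrable \<mu> (\<lambda>z. indicator Z z *\<^sub>R \<phi> (\<sigma> z))"
    and "(\<integral>z. indicator Z z *\<^sub>R \<phi> (\<sigma> z) \<partial>\<mu>) = (\<Sum>c\<in>\<sigma> ` Z. measure \<mu> (Z \<inter> \<sigma> -` {c}) *\<^sub>R \<phi> c)"
proof -
  have eq: "(\<lambda>z. indicator Z z *\<^sub>R \<phi> (\<sigma> z)) = (\<lambda>z. \<Sum>c\<in>\<sigma> ` Z. indicator (Z \<inter> \<sigma> -` {c}) z *\<^sub>R \<phi> c)"
  proof
    fix z
    show "indicator Z z *\<^sub>R \<phi> (\<sigma> z) = (\<Sum>c\<in>\<sigma> ` Z. indicator (Z \<inter> \<sigma> -` {c}) z *\<^sub>R \<phi> c)"
    proof (cases "z \<in> Z")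
      case True
      have "(\<Sum>c\<in>\<sigma> ` Z. indicator (Z \<inter> \<sigma> -` {c}) z *\<^sub>R \<phi> c) = (\<Sum>c\<in>\<sigma> ` Z. if \<sigma> z = c then \<phi> c else 0)"
        using True by (intro sum.cong) (auto simp: indicator_def)
      also have "\<dots> = \<phi> (\<sigma> z)" using fin True by (simp add: sum.delta)
      finally show ?thesis using True by simp
    qed simp
  qed
  have S: "Z \<inter> \<sigma> -` {c} \<in> sets \<mu>" for c using Z lev by auto
  have F: "emeasure \<mu> (Z \<inter> \<sigma> -` {c}) < \<infinity>" for c
    by (rule le_less_trans[OF emeasure_mono emeasure_compact[OF Z]]) (use Z in auto)
  have i: "integrable \<mu> (\<lambda>z. indicator (Z \<inter> \<sigma> -` {c}) z *\<^sub>R \<phi> c)" for c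
    using S F by (intro integrable_scaleR_left) auto
  show "integrable \<mu> (\<lambda>z. indicator Z z *\<^sub>R \<phi> (\<sigma> z))"
    unfolding eq using i by (intro Bochner_Integration.integrable_sum) auto
  show "(\<integral>z. indicator Z z *\<^sub>R \<phi> (\<sigma> z) \<partial>\<mu>) = (\<Sum>c\<in>\<sigma> ` Z. measure \<mu> (Z \<inter> \<sigma> -` {c}) *\<^sub>R \<phi> c)"
    unfolding eq Bochner_Integration.integral_sum[OF i]
  proof (rule sum.cong)
    fix c
    have "integrable \<mu> (\<lambda>z. indicator (Z \<inter> \<sigma> -` {c}) z :: real)"
      using S F by (intro integrable_real_indicator)
    then show "(\<integral>z. indicator (Z \<inter> \<sigma> -` {c}) z *\<^sub>R \<phi> c \<partial>\<mu>) = measure \<mu> (Z \<inter> \<sigma> -` {c}) *\<^sub>R \<phi> c"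
      using S[of c] by (subst integral_scaleR_left) auto
  qed simp
qed

lemma bounded_compact_pint_le:
  assumes f: "f \<in> borel_measurable \<mu>" and K: "compact K" "\<And>x. x \<notin> K \<Longrightarrow> f x = 0"
    and M: "\<And>x. norm (f x) \<le> M" and r: "1 < r"
  shows "pint \<mu> r f \<le> (M * (1 + measure \<mu> K)) powr r"
proof -
  have M0: "0 \<le> M" using M norm_ge_zero order_trans by blast
  have "pint \<mu> r f \<le> M powr r * measure \<mu> K"
    using r by (intro bounded_compact_Lp(2)[OF f K M]) auto
  also have "\<dots> \<le> M powr r * (1 + measure \<mu> K) powr 1"
    by (intro mult_left_mono) auto
  also have "\<dots> \<le> M powr r * (1 + measure \<mu> K) powr r"
    using r by (intro mult_left_mono powr_mono) auto
  also have "\<dots> = (M * (1 + measure \<mu> K)) powr r" by (simp add: powr_mult)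
  finally show ?thesis .
qed

end

context haar_exponents
begin

text \<open>
  Young's inequality bounds the product of the norms by a sum of integrals, and such
  bounds can be added up over a partition. The slack \<open>\<eta>\<close> makes the norms positive.
\<close>

lemma coef_in_hull_sum:
  assumes f: "f \<in> Lp \<mu> p" and g: "g \<in> Lp \<mu> q" and \<eta>: "0 < \<eta>"
  shows "coef f g \<in> l1_hull (atoms UNIV) (pint \<mu> p f + pint \<mu> q g + 2 * \<eta>)"
proof -
  define a b where "a = (pint \<mu> p f + \<eta>) powr (1/p)" "b = (pint \<mu> q g + \<eta>) powr (1/q)"
  have pos: "pint \<mu> p f + \<eta> > 0" "pint \<mu> q g + \<eta> > 0" using \<eta> by (auto intro: add_nonneg_pos)
  have ap: "a powr p = pint \<mu> p f + \<eta>" "b powr q = pint \<mu> q g + \<eta>"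
    using pos p_gt_1 q_gt_1 by (simp_all add: a_b_def powr_powr)
  have ab: "0 < a" "0 < b" using pos by (auto simp: a_b_def)
  have "coef f g \<in> l1_hull (atoms UNIV) (a * b)"
    by (rule coef_in_hull[OF f _ _ g]) (use ap ab \<eta> in auto)
  moreover have "a * b \<le> a powr p / p + b powr q / q"
    using pq ab by (intro Youngs_inequality) auto
  moreover have "a powr p / p + b powr q / q \<le> a powr p + b powr q"
    using pq by (intro add_mono) (auto simp: divide_le_eq mult_le_cancel_left1)
  ultimately show ?thesis using ap by (auto elim!: hull_mono)
qed

end

text \<open>
  The data of the product of two coefficient functions with factors in \<open>Cc\<close>, where \<open>K\<close> contains the supports
  of \<open>f1\<close> and \<open>g1\<close>, and \<open>L\<close> those of \<open>f2\<close> and \<open>g2\<close>. By left invariance, \<open>coef f2 g2 x = \<integral> f2 (y + z) * cnj (g2 (- x + y + z)) dz\<close>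
  for every \<open>y\<close>; inserting this into the integral over \<open>y\<close> that defines \<open>coef f1 g1 x\<close> exhibits
  the product as the integral of \<open>H z x = coef (A z) (B z) x\<close> over \<open>z\<close>. Since \<open>f1\<close> is supported in
  \<open>K\<close> and \<open>f2\<close> in \<open>L\<close>, only \<open>z\<close> in the compact set \<open>Z = - K + L\<close> matter. For a finite-valued \<open>s\<close> near the identity
  on \<open>Z\<close>, \<open>w s\<close> is a Riemann sum of this integral, a finite combination of coefficient functions.
\<close>

locale coef_product = haar_exponents \<mu> p q
  for \<mu> :: "'a::{topological_group_add, t2_space} measure" and p q +
  fixes f1 g1 f2 g2 :: "'a \<Rightarrow> complex" and K L :: "'a set" and M :: real
  assumes cont: "continuous_on UNIV f1" "continuous_on UNIV g1" "continuous_on UNIV f2" "continuous_on UNIV g2"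
    and K: "compact K" and L: "compact L"
    and supp: "\<And>x. x \<notin> K \<Longrightarrow> f1 x = 0" "\<And>x. x \<notin> K \<Longrightarrow> g1 x = 0" "\<And>x. x \<notin> L \<Longrightarrow> f2 x = 0" "\<And>x. x \<notin> L \<Longrightarrow> g2 x = 0"
    and bnd: "\<And>x. norm (f1 x) \<le> M" "\<And>x. norm (g1 x) \<le> M" "\<And>x. norm (f2 x) \<le> M" "\<And>x. norm (g2 x) \<le> M"
    and unit: "pint \<mu> p f1 \<le> 1" "pint \<mu> q g1 \<le> 1" "pint \<mu> p f2 \<le> 1" "pint \<mu> q g2 \<le> 1"
begin

lemma M_nonneg: "0 \<le> M"
  using bnd(1) norm_ge_zero order_trans by blast

definition Z :: "'a set" where "Z = (\<lambda>(y, z). - y + z) ` (K \<times> L)"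

lemma compact_Z: "compact Z"
  unfolding Z_def case_prod_unfold using K L by (intro compact_continuous_image compact_Times continuous_intros)

lemma in_Z:
  assumes "y \<in> K" "y + z \<in> L" shows "z \<in> Z"
  unfolding Z_def using assms by (intro rev_image_eqI[of "(y, y + z)"]) (simp_all add: add.assoc[symmetric])

definition A :: "'a \<Rightarrow> 'a \<Rightarrow> complex" where "A a y = f1 y * f2 (y + a)"
definition B :: "'a \<Rightarrow> 'a \<Rightarrow> complex" where "B a y = g1 y * g2 (y + a)"
definition H :: "'a \<Rightarrow> 'a \<Rightarrow> complex" where "H a = coef (A a) (B a)"

text \<open>
  The estimates for \<open>f2\<close> and \<open>g2\<close> make Riemann sums close to each other and to the product. Those
  on the powers of the moduli, bound the sums in terms of the norms of the factors
  rather than of \<open>M\<close>, \<open>K\<close> and \<open>L\<close>.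
\<close>

definition fine_selection :: "real \<Rightarrow> ('a \<Rightarrow> 'a) \<Rightarrow> bool" where
  "fine_selection \<epsilon> s \<longleftrightarrow> finite (range s) \<and> (\<forall>a. s -` {a} \<in> sets \<mu>) \<and>
     (\<forall>y\<in>K. \<forall>z\<in>Z. norm (f2 (y + z) - f2 (y + s z)) \<le> \<epsilon> \<and> norm (g2 (y + z) - g2 (y + s z)) \<le> \<epsilon> \<and>
        norm (f2 (y + s z)) powr p \<le> norm (f2 (y + z)) powr p + \<epsilon> \<and>
        norm (g2 (y + s z)) powr q \<le> norm (g2 (y + z)) powr q + \<epsilon>)"

lemma fineD:
  assumes "fine_selection \<epsilon> s"
  shows "finite (range s)" "finite (s ` Z)" "s -` {a} \<in> sets \<mu>"
    "y \<in> K \<Longrightarrow> z \<in> Z \<Longrightarrow> norm (f2 (y + z) - f2 (y + s z)) \<le> \<epsilon>"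
    "y \<in> K \<Longrightarrow> z \<in> Z \<Longrightarrow> norm (g2 (y + z) - g2 (y + s z)) \<le> \<epsilon>"
    "y \<in> K \<Longrightarrow> z \<in> Z \<Longrightarrow> norm (f2 (y + s z)) powr p \<le> norm (f2 (y + z)) powr p + \<epsilon>"
    "y \<in> K \<Longrightarrow> z \<in> Z \<Longrightarrow> norm (g2 (y + s z)) powr q \<le> norm (g2 (y + z)) powr q + \<epsilon>"
  using assms unfolding fine_selection_def by (auto intro: finite_subset[OF image_mono])

lemma fine_exists:
  assumes "0 < \<epsilon>"
  obtains s where "fine_selection \<epsilon> s"
proof -
  have cp: "continuous_on UNIV (\<lambda>x. norm (f2 x) powr p)"
    using p_gt_1 by (intro continuous_on_powr' continuous_on_norm cont continuous_on_const) auto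
  have cq: "continuous_on UNIV (\<lambda>x. norm (g2 x) powr q)"
    using q_gt_1 by (intro continuous_on_powr' continuous_on_norm cont continuous_on_const) auto
  have "\<exists>N. open N \<and> a \<in> N \<and> (\<forall>y\<in>K. \<forall>z\<in>N. dist (f2 (y + z)) (f2 (y + a)) \<le> \<epsilon> \<and> dist (g2 (y + z)) (g2 (y + a)) \<le> \<epsilon> \<and>
      dist (norm (f2 (y + z)) powr p) (norm (f2 (y + a)) powr p) \<le> \<epsilon> \<and>
      dist (norm (g2 (y + z)) powr q) (norm (g2 (y + a)) powr q) \<le> \<epsilon>)" for a
  proof -
    obtain N1 where "open N1" "a \<in> N1" "\<And>y z. y \<in> K \<Longrightarrow> z \<in> N1 \<Longrightarrow> dist (f2 (y + z)) (f2 (y + a)) \<le> \<epsilon>"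
      using right_translate_locally_uniform[OF cont(3) K assms] by metis
    moreover obtain N2 where "open N2" "a \<in> N2" "\<And>y z. y \<in> K \<Longrightarrow> z \<in> N2 \<Longrightarrow> dist (g2 (y + z)) (g2 (y + a)) \<le> \<epsilon>"
      using right_translate_locally_uniform[OF cont(4) K assms] by metis
    moreover obtain N3 where "open N3" "a \<in> N3" "\<And>y z. y \<in> K \<Longrightarrow> z \<in> N3 \<Longrightarrow> dist (norm (f2 (y + z)) powr p) (norm (f2 (y + a)) powr p) \<le> \<epsilon>"
      using right_translate_locally_uniform[OF cp K assms] by metis
    moreover obtain N4 where "open N4" "a \<in> N4" "\<And>y z. y \<in> K \<Longrightarrow> z \<in> N4 \<Longrightarrow> dist (norm (g2 (y + z)) powr q) (norm (g2 (y + a)) powr q) \<le> \<epsilon>"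
      using right_translate_locally_uniform[OF cq K assms] by metis
    ultimately show ?thesis
      by (intro exI[of _ "N1 \<inter> N2 \<inter> N3 \<inter> N4"]) auto
  qed
  then obtain N where N0: "\<forall>a. open (N a) \<and> a \<in> N a \<and>
    (\<forall>y\<in>K. \<forall>z\<in>N a. dist (f2 (y + z)) (f2 (y + a)) \<le> \<epsilon> \<and> dist (g2 (y + z)) (g2 (y + a)) \<le> \<epsilon> \<and>
      dist (norm (f2 (y + z)) powr p) (norm (f2 (y + a)) powr p) \<le> \<epsilon> \<and>
      dist (norm (g2 (y + z)) powr q) (norm (g2 (y + a)) powr q) \<le> \<epsilon>)"
    using choice[of "\<lambda>a N. open N \<and> a \<in> N \<and>
    (\<forall>y\<in>K. \<forall>z\<in>N. dist (f2 (y + z)) (f2 (y + a)) \<le> \<epsilon> \<and> dist (g2 (y + z)) (g2 (y + a)) \<le> \<epsilon> \<and>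
      dist (norm (f2 (y + z)) powr p) (norm (f2 (y + a)) powr p) \<le> \<epsilon> \<and>
      dist (norm (g2 (y + z)) powr q) (norm (g2 (y + a)) powr q) \<le> \<epsilon>)"] by blast
  then have N: "\<And>a. open (N a)" "\<And>a. a \<in> N a"
    "\<And>a y z. y \<in> K \<Longrightarrow> z \<in> N a \<Longrightarrow> dist (f2 (y + z)) (f2 (y + a)) \<le> \<epsilon>"
    "\<And>a y z. y \<in> K \<Longrightarrow> z \<in> N a \<Longrightarrow> dist (g2 (y + z)) (g2 (y + a)) \<le> \<epsilon>"
    "\<And>a y z. y \<in> K \<Longrightarrow> z \<in> N a \<Longrightarrow> dist (norm (f2 (y + z)) powr p) (norm (f2 (y + a)) powr p) \<le> \<epsilon>"
    "\<And>a y z. y \<in> K \<Longrightarrow> z \<in> N a \<Longrightarrow> dist (norm (g2 (y + z)) powr q) (norm (g2 (y + a)) powr q) \<le> \<epsilon>"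
    by simp_all
  obtain s where s: "finite (range s)" "\<And>a. s -` {a} \<in> sets \<mu>" "\<And>z. z \<in> Z \<Longrightarrow> z \<in> N (s z)"
    using simple_selection[OF compact_Z, of N] N(1,2) by metis
  have "fine_selection \<epsilon> s"
    unfolding fine_selection_def
  proof (intro conjI allI ballI s(1,2))
    fix y z assume yz: "y \<in> K" "z \<in> Z"
    note zN = s(3)[OF yz(2)]
    show "norm (f2 (y + z) - f2 (y + s z)) \<le> \<epsilon>" using N(3)[OF yz(1) zN] by (simp add: dist_norm)
    show "norm (g2 (y + z) - g2 (y + s z)) \<le> \<epsilon>" using N(4)[OF yz(1) zN] by (simp add: dist_norm)
    show "norm (f2 (y + s z)) powr p \<le> norm (f2 (y + z)) powr p + \<epsilon>"
      using N(5)[OF yz(1) zN] by (simp add: dist_real_def abs_le_iff)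
    show "norm (g2 (y + s z)) powr q \<le> norm (g2 (y + z)) powr q + \<epsilon>"
      using N(6)[OF yz(1) zN] by (simp add: dist_real_def abs_le_iff)
  qed
  then show ?thesis by (rule that)
qed

definition w :: "('a \<Rightarrow> 'a) \<Rightarrow> 'a \<Rightarrow> complex" where
  "w s x = (\<integral>z. indicator Z z *\<^sub>R H (s z) x \<partial>\<mu>)"

lemma A_measurable: "A a \<in> borel_measurable \<mu>" and B_measurable: "B a \<in> borel_measurable \<mu>"
proof -
  have "continuous_on UNIV (\<lambda>y. f2 (y + a))" "continuous_on UNIV (\<lambda>y. g2 (y + a))"
    by (rule continuous_on_compose2[OF cont(3)] continuous_on_compose2[OF cont(4)]; auto intro!: continuous_intros)+
  then show "A a \<in> borel_measurable \<mu>" "B a \<in> borel_measurable \<mu>"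
    unfolding A_def[abs_def] B_def[abs_def] using cont by (auto intro!: continuous_measurable continuous_on_mult)
qed

lemma A_bound: "norm (A a y) \<le> M * M" and B_bound: "norm (B a y) \<le> M * M"
  unfolding A_def B_def norm_mult using bnd M_nonneg by (auto intro!: mult_mono)

lemma A_supp: "y \<notin> K \<Longrightarrow> A a y = 0" and B_supp: "y \<notin> K \<Longrightarrow> B a y = 0"
  using supp by (auto simp: A_def B_def)

lemma A_Lp: "A a \<in> Lp \<mu> p" and B_Lp: "B a \<in> Lp \<mu> q"
  using bounded_compact_Lp(1)[OF A_measurable K A_supp A_bound, where p=p] p_gt_1
    bounded_compact_Lp(1)[OF B_measurable K B_supp B_bound, where p=q] q_gt_1 by auto

text \<open>
  Under the integral over \<open>y\<close>, the sum over the values of \<open>s\<close> is the integral of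
  \<open>|F2 (y + s z)|\<^sup>r\<close> over \<open>z \<in> Z\<close>. By fineness and left invariance it exceeds the integral of \<open>|F2|\<^sup>r\<close> by at
  most \<open>\<epsilon>\<close> times the measure of \<open>Z\<close>, hence is at most 2.
\<close>

lemma sum_pint_le:
  assumes F1: "F1 \<in> Lp \<mu> r" "\<And>y. y \<notin> K \<Longrightarrow> F1 y = 0" "pint \<mu> r F1 \<le> 1"
    and F2: "F2 \<in> Lp \<mu> r" "pint \<mu> r F2 \<le> 1"
    and AL: "\<And>c. (\<lambda>y. F1 y * F2 (y + c)) \<in> Lp \<mu> r"
    and s: "finite (s ` Z)" "\<And>a. s -` {a} \<in> sets \<mu>"
    and le: "\<And>y z. y \<in> K \<Longrightarrow> z \<in> Z \<Longrightarrow> norm (F2 (y + s z)) powr r \<le> norm (F2 (y + z)) powr r + \<epsilon>"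
    and \<epsilon>: "0 \<le> \<epsilon>" "\<epsilon> * measure \<mu> Z \<le> 1"
  shows "(\<Sum>c\<in>s ` Z. measure \<mu> (Z \<inter> s -` {c}) * pint \<mu> r (\<lambda>y. F1 y * F2 (y + c))) \<le> 2"
proof -
  have i2: "integrable \<mu> (\<lambda>z. norm (F2 z) powr r)" by (rule Lp_integrable[OF F2(1)])
  have inner: "(\<Sum>c\<in>s ` Z. measure \<mu> (Z \<inter> s -` {c}) * norm (F2 (y + c)) powr r) \<le> 2" if y: "y \<in> K" for y
  proof -
    have "(\<Sum>c\<in>s ` Z. measure \<mu> (Z \<inter> s -` {c}) * norm (F2 (y + c)) powr r) =
        (\<integral>z. indicator Z z *\<^sub>R norm (F2 (y + s z)) powr r \<partial>\<mu>)"
      using integral_finite_range(2)[OF compact_Z s, of "\<lambda>c. norm (F2 (y + c)) powr r"] by simp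
    also have "\<dots> \<le> (\<integral>z. norm (F2 (y + z)) powr r + \<epsilon> * indicator Z z \<partial>\<mu>)"
    proof (rule integral_mono)
      show "integrable \<mu> (\<lambda>z. indicator Z z *\<^sub>R norm (F2 (y + s z)) powr r)"
        using integral_finite_range(1)[OF compact_Z s, of "\<lambda>c. norm (F2 (y + c)) powr r"] .
      show "integrable \<mu> (\<lambda>z. norm (F2 (y + z)) powr r + \<epsilon> * indicator Z z)"
        using Lp_integrable[OF Lp_translate(1)[OF F2(1)]] emeasure_compact[OF compact_Z] compact_Z
        by (intro Bochner_Integration.integrable_add Bochner_Integration.integrable_mult_right integrable_real_indicator) auto
      show "indicator Z z *\<^sub>R norm (F2 (y + s z)) powr r \<le> norm (F2 (y + z)) powr r + \<epsilon> * indicator Z z" for z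
        using le[OF y, of z] by (cases "z \<in> Z") auto
    qed
    also have "\<dots> = (\<integral>z. norm (F2 (y + z)) powr r \<partial>\<mu>) + \<epsilon> * measure \<mu> Z"
      using Lp_integrable[OF Lp_translate(1)[OF F2(1)]] emeasure_compact[OF compact_Z] compact_Z
      by (subst Bochner_Integration.integral_add) auto
    also have "(\<integral>z. norm (F2 (y + z)) powr r \<partial>\<mu>) = pint \<mu> r F2"
      using Lp_translate(2)[OF F2(1), of y] by (simp add: pint_def)
    finally show ?thesis using F2(2) \<epsilon> by simp
  qed
  have "(\<Sum>c\<in>s ` Z. measure \<mu> (Z \<inter> s -` {c}) * pint \<mu> r (\<lambda>y. F1 y * F2 (y + c))) =
     (\<integral>y. (\<Sum>c\<in>s ` Z. measure \<mu> (Z \<inter> s -` {c}) * norm (F1 y * F2 (y + c)) powr r) \<partial>\<mu>)"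
    unfolding pint_def using Lp_integrable[OF AL] by (subst Bochner_Integration.integral_sum) auto
  also have "\<dots> \<le> (\<integral>y. 2 * norm (F1 y) powr r \<partial>\<mu>)"
  proof (rule integral_mono)
    show "integrable \<mu> (\<lambda>y. \<Sum>c\<in>s ` Z. measure \<mu> (Z \<inter> s -` {c}) * norm (F1 y * F2 (y + c)) powr r)"
      using Lp_integrable[OF AL] by (intro Bochner_Integration.integrable_sum Bochner_Integration.integrable_mult_right) auto
    show "integrable \<mu> (\<lambda>y. 2 * norm (F1 y) powr r)" using Lp_integrable[OF F1(1)] by simp
    fix y
    show "(\<Sum>c\<in>s ` Z. measure \<mu> (Z \<inter> s -` {c}) * norm (F1 y * F2 (y + c)) powr r) \<le> 2 * norm (F1 y) powr r"
    proof (cases "y \<in> K")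
      case True
      have "(\<Sum>c\<in>s ` Z. measure \<mu> (Z \<inter> s -` {c}) * norm (F1 y * F2 (y + c)) powr r) =
          (\<Sum>c\<in>s ` Z. measure \<mu> (Z \<inter> s -` {c}) * norm (F2 (y + c)) powr r) * norm (F1 y) powr r"
        unfolding sum_distrib_right by (intro sum.cong) (auto simp: norm_mult powr_mult)
      also have "\<dots> \<le> 2 * norm (F1 y) powr r"
        by (intro mult_right_mono inner True) auto
      finally show ?thesis .
    qed (simp add: F1)
  qed
  also have "\<dots> = 2 * pint \<mu> r F1" by (simp add: pint_def)
  finally show ?thesis using F1(3) by simp
qed

lemma factors_Lp: "f1 \<in> Lp \<mu> p" "g1 \<in> Lp \<mu> q" "f2 \<in> Lp \<mu> p" "g2 \<in> Lp \<mu> q"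
  using bounded_compact_Lp(1)[OF continuous_measurable[OF cont(1)] K supp(1) bnd(1), of p]
    bounded_compact_Lp(1)[OF continuous_measurable[OF cont(2)] K supp(2) bnd(2), of q]
    bounded_compact_Lp(1)[OF continuous_measurable[OF cont(3)] L supp(3) bnd(3), of p]
    bounded_compact_Lp(1)[OF continuous_measurable[OF cont(4)] L supp(4) bnd(4), of q] p_gt_1 q_gt_1 by auto

lemma w_sum:
  assumes "fine_selection \<epsilon> s"
  shows "w s x = (\<Sum>c\<in>s ` Z. complex_of_real (measure \<mu> (Z \<inter> s -` {c})) * H c x)"
  unfolding w_def using integral_finite_range(2)[OF compact_Z fineD(2,3)[OF assms], of "\<lambda>c. H c x"]
  by (simp add: scaleR_conv_of_real)

lemma atoms_UNIV_nonempty: "atoms UNIV \<noteq> {}"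
  using atoms_nonempty atoms_mono by blast

text \<open>
  The contributions are 2 from the \<open>p\<close>-integrals, 2 from the \<open>q\<close>-integrals and at most 1 from the slack \<open>\<eta>\<close>.
\<close>

lemma w_in_hull:
  assumes s: "fine_selection \<epsilon> s" and \<epsilon>: "0 \<le> \<epsilon>" "\<epsilon> * measure \<mu> Z \<le> 1"
  shows "w s \<in> l1_hull (atoms UNIV) 6"
proof -
  define \<eta> where "\<eta> = 1 / (2 * (measure \<mu> Z + 1))"
  have mZ: "measure \<mu> Z + 1 > 0" using measure_nonneg[of \<mu> Z] by linarith
  have \<eta>: "\<eta> > 0" using mZ by (simp add: \<eta>_def)
  define W where "W c = measure \<mu> (Z \<inter> s -` {c})" for c
  have "(\<lambda>x. complex_of_real (W c) * H c x) \<in> l1_hull (atoms UNIV) (W c * (pint \<mu> p (A c) + pint \<mu> q (B c) + 2 * \<eta>))" for c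
    using hull_scale[OF coef_in_hull_sum[OF A_Lp B_Lp \<eta>], of "complex_of_real (W c)" c c]
    by (simp add: H_def W_def)
  then have "(\<lambda>x. \<Sum>c\<in>s ` Z. complex_of_real (W c) * H c x) \<in>
      l1_hull (atoms UNIV) (\<Sum>c\<in>s ` Z. W c * (pint \<mu> p (A c) + pint \<mu> q (B c) + 2 * \<eta>))"
    by (intro hull_finite_sum[OF bounded_atoms_coef atoms_UNIV_nonempty fineD(2)[OF s]])
  moreover have "(\<lambda>x. \<Sum>c\<in>s ` Z. complex_of_real (W c) * H c x) = w s"
    using w_sum[OF s] by (auto simp: W_def)
  moreover have "(\<Sum>c\<in>s ` Z. W c * (pint \<mu> p (A c) + pint \<mu> q (B c) + 2 * \<eta>)) \<le> 6"
  proof -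
    have 1: "(\<Sum>c\<in>s ` Z. W c * pint \<mu> p (A c)) \<le> 2"
      unfolding W_def A_def[abs_def]
      by (rule sum_pint_le[OF factors_Lp(1) supp(1) unit(1) factors_Lp(3) unit(3) A_Lp[unfolded A_def[abs_def]] fineD(2,3)[OF s] fineD(6)[OF s] \<epsilon>])
    have 2: "(\<Sum>c\<in>s ` Z. W c * pint \<mu> q (B c)) \<le> 2"
      unfolding W_def B_def[abs_def]
      by (rule sum_pint_le[OF factors_Lp(2) supp(2) unit(2) factors_Lp(4) unit(4) B_Lp[unfolded B_def[abs_def]] fineD(2,3)[OF s] fineD(7)[OF s] \<epsilon>])
    have "(\<Sum>c\<in>s ` Z. W c) = measure \<mu> Z"
      using integral_finite_range(2)[OF compact_Z fineD(2,3)[OF s], of "\<lambda>c. 1::real"] compact_Z by (simp add: W_def)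
    then have "(\<Sum>c\<in>s ` Z. W c * (2 * \<eta>)) = measure \<mu> Z * (2 * \<eta>)"
      by (simp add: sum_distrib_right[symmetric])
    also have "\<dots> \<le> 1" using mZ by (simp add: \<eta>_def divide_le_eq)
    finally have 3: "(\<Sum>c\<in>s ` Z. W c * (2 * \<eta>)) \<le> 1" .
    have "(\<Sum>c\<in>s ` Z. W c * (pint \<mu> p (A c) + pint \<mu> q (B c) + 2 * \<eta>)) =
      (\<Sum>c\<in>s ` Z. W c * pint \<mu> p (A c)) + (\<Sum>c\<in>s ` Z. W c * pint \<mu> q (B c)) + (\<Sum>c\<in>s ` Z. W c * (2 * \<eta>))"
      by (simp add: sum.distrib distrib_left)
    then show ?thesis using 1 2 3 by linarith
  qed
  ultimately show ?thesis by (auto elim!: hull_mono)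
qed

text \<open>
  A Lipschitz constant of \<open>a \<mapsto> H a\<close>, with respect to the uniform distance of the translates of
  \<open>f2\<close> and \<open>g2\<close> on \<open>K\<close> and the size in the hull. The added ones keep all factors positive.
\<close>

definition D :: real where
  "D = 2 * ((M + 1) * (1 + measure \<mu> K) * ((M * M + 1) * (1 + measure \<mu> K)))"

lemma H_diff_in_hull:
  assumes e: "0 < e"
    and d: "\<And>y. y \<in> K \<Longrightarrow> norm (f2 (y + a) - f2 (y + b)) \<le> e" "\<And>y. y \<in> K \<Longrightarrow> norm (g2 (y + a) - g2 (y + b)) \<le> e"
  shows "(\<lambda>x. H a x - H b x) \<in> l1_hull (atoms UNIV) (2 * ((M + 1) * e * (1 + measure \<mu> K) * ((M * M + 1) * (1 + measure \<mu> K))))"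
proof -
  define m where "m = 1 + measure \<mu> K"
  have m: "m \<ge> 1" by (simp add: m_def)
  have dA: "(\<lambda>y. A a y - A b y) \<in> borel_measurable \<mu>" "(\<lambda>y. B a y - B b y) \<in> borel_measurable \<mu>"
    by (intro borel_measurable_diff A_measurable B_measurable)+
  have AM: "norm (A c y) \<le> M * M + 1" "norm (B c y) \<le> M * M + 1" for c y
    using A_bound[of c y] B_bound[of c y] by auto
  have leA: "norm (A a y - A b y) \<le> (M + 1) * e" for y
  proof (cases "y \<in> K")
    case True
    have "norm (A a y - A b y) = norm (f1 y) * norm (f2 (y + a) - f2 (y + b))"
      by (simp add: A_def right_diff_distrib[symmetric] norm_mult)
    also have "\<dots> \<le> M * e" using bnd d True M_nonneg by (intro mult_mono) auto
    also have "\<dots> \<le> (M + 1) * e" using e by (simp add: algebra_simps)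
    finally show ?thesis .
  qed (use e M_nonneg in \<open>simp add: A_supp\<close>)
  have leB: "norm (B a y - B b y) \<le> (M + 1) * e" for y
  proof (cases "y \<in> K")
    case True
    have "norm (B a y - B b y) = norm (g1 y) * norm (g2 (y + a) - g2 (y + b))"
      by (simp add: B_def right_diff_distrib[symmetric] norm_mult)
    also have "\<dots> \<le> M * e" using bnd d True M_nonneg by (intro mult_mono) auto
    also have "\<dots> \<le> (M + 1) * e" using e by (simp add: algebra_simps)
    finally show ?thesis .
  qed (use e M_nonneg in \<open>simp add: B_supp\<close>)
  have sA: "A a y - A b y = 0" "B a y - B b y = 0" if "y \<notin> K" for y using that by (auto simp: A_supp B_supp)
  have pos: "0 < (M + 1) * e * m" "0 < (M * M + 1) * m"
    using M_nonneg e m by (auto intro!: mult_pos_pos add_nonneg_pos)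
  have 1: "coef (\<lambda>y. A a y - A b y) (B a) \<in> l1_hull (atoms UNIV) ((M + 1) * e * m * ((M * M + 1) * m))"
    unfolding m_def
    by (rule coef_in_hull[OF Lp_diff(1)[OF A_Lp A_Lp] bounded_compact_pint_le[OF dA(1) K sA(1) leA p_gt_1] _ B_Lp
          bounded_compact_pint_le[OF B_measurable K B_supp AM(2) q_gt_1]])
       (use pos p_gt_1 in \<open>auto simp: m_def\<close>)
  have 2: "coef (A b) (\<lambda>y. B a y - B b y) \<in> l1_hull (atoms UNIV) ((M * M + 1) * m * ((M + 1) * e * m))"
    unfolding m_def
    by (rule coef_in_hull[OF A_Lp bounded_compact_pint_le[OF A_measurable K A_supp AM(1) p_gt_1] _ Lp_diff(1)[OF B_Lp B_Lp]
           bounded_compact_pint_le[OF dA(2) K sA(2) leB q_gt_1]])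
       (use pos q_gt_1 in \<open>auto simp: m_def\<close>)
  have "(\<lambda>x. coef (\<lambda>y. A a y - A b y) (B a) x + coef (A b) (\<lambda>y. B a y - B b y) x) = (\<lambda>x. H a x - H b x)"
    by (auto simp: H_def coef_diff_left[OF A_Lp A_Lp B_Lp] coef_diff_right[OF A_Lp B_Lp B_Lp])
  with hull_add[OF bounded_atoms_coef 1 2] show ?thesis by (simp add: m_def mult_ac)
qed

text \<open>
  Both Riemann sums are written over the common refinement of their partitions, that is, over
  the level sets of \<open>z \<mapsto> (s z, t z)\<close>. On each of these the translates by
  the two tags are close to the translate by a common point \<open>z\<close>.
\<close>

lemma w_diff_in_hull:
  assumes s: "fine_selection \<epsilon> s" and t: "fine_selection \<epsilon>' t" and e: "0 < \<epsilon> + \<epsilon>'"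
  shows "(\<lambda>x. w s x - w t x) \<in> l1_hull (atoms UNIV) ((\<epsilon> + \<epsilon>') * (measure \<mu> Z * D))"
proof -
  define \<sigma> where "\<sigma> z = (s z, t z)" for z
  have "\<sigma> ` Z \<subseteq> s ` Z \<times> t ` Z" by (auto simp: \<sigma>_def)
  then have fin: "finite (\<sigma> ` Z)" using fineD(2)[OF s] fineD(2)[OF t] finite_subset by blast
  have "\<sigma> -` {c} = s -` {fst c} \<inter> t -` {snd c}" for c by (auto simp: \<sigma>_def)
  then have lev: "\<sigma> -` {c} \<in> sets \<mu>" for c using fineD(3)[OF s] fineD(3)[OF t] by auto
  define R where "R = (\<epsilon> + \<epsilon>') * D"
  define V where "V c = measure \<mu> (Z \<inter> \<sigma> -` {c})" for c
  have "(\<lambda>x. complex_of_real (V c) * (H (fst c) x - H (snd c) x)) \<in> l1_hull (atoms UNIV) (V c * R)"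
    if c: "c \<in> \<sigma> ` Z" for c
  proof -
    obtain z where z: "z \<in> Z" "c = (s z, t z)" using c by (auto simp: \<sigma>_def)
    have f: "norm (f2 (y + s z) - f2 (y + t z)) \<le> \<epsilon> + \<epsilon>'" if "y \<in> K" for y
      using norm_triangle_ineq4[of "f2 (y + z) - f2 (y + t z)" "f2 (y + z) - f2 (y + s z)"]
        fineD(4)[OF s that z(1)] fineD(4)[OF t that z(1)] by simp
    have g: "norm (g2 (y + s z) - g2 (y + t z)) \<le> \<epsilon> + \<epsilon>'" if "y \<in> K" for y
      using norm_triangle_ineq4[of "g2 (y + z) - g2 (y + t z)" "g2 (y + z) - g2 (y + s z)"]
        fineD(5)[OF s that z(1)] fineD(5)[OF t that z(1)] by simp
    have "(\<lambda>x. H (s z) x - H (t z) x) \<in> l1_hull (atoms UNIV) R"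
      using H_diff_in_hull[OF e f g] by (simp add: R_def D_def mult_ac)
    from hull_scale[OF this, of "complex_of_real (V c)"] show ?thesis
      by (simp add: z(2) V_def)
  qed
  then have "(\<lambda>x. \<Sum>c\<in>\<sigma> ` Z. complex_of_real (V c) * (H (fst c) x - H (snd c) x)) \<in>
      l1_hull (atoms UNIV) (\<Sum>c\<in>\<sigma> ` Z. V c * R)"
    by (intro hull_finite_sum[OF bounded_atoms_coef atoms_UNIV_nonempty fin])
  moreover have "(\<Sum>c\<in>\<sigma> ` Z. V c * R) = measure \<mu> Z * R"
    using integral_finite_range(2)[OF compact_Z fin lev, of "\<lambda>c. 1::real"] compact_Z
    by (simp add: V_def sum_distrib_right[symmetric])
  moreover have "(\<lambda>x. \<Sum>c\<in>\<sigma> ` Z. complex_of_real (V c) * (H (fst c) x - H (snd c) x)) = (\<lambda>x. w s x - w t x)"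
  proof
    fix x
    have "(\<Sum>c\<in>\<sigma> ` Z. complex_of_real (V c) * (H (fst c) x - H (snd c) x)) =
        (\<integral>z. indicator Z z *\<^sub>R (H (s z) x - H (t z) x) \<partial>\<mu>)"
      using integral_finite_range(2)[OF compact_Z fin lev, of "\<lambda>c. H (fst c) x - H (snd c) x"]
      by (simp add: \<sigma>_def V_def scaleR_conv_of_real)
    also have "\<dots> = w s x - w t x"
      unfolding w_def scaleR_diff_right
      by (rule Bochner_Integration.integral_diff[OF integral_finite_range(1)[OF compact_Z fineD(2,3)[OF s], of "\<lambda>c. H c x"]
            integral_finite_range(1)[OF compact_Z fineD(2,3)[OF t], of "\<lambda>c. H c x"]])
    finally show "(\<Sum>c\<in>\<sigma> ` Z. complex_of_real (V c) * (H (fst c) x - H (snd c) x)) = w s x - w t x" .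
  qed
  ultimately show ?thesis by (simp add: R_def mult_ac)
qed

lemma riemann_sum_close:
  assumes s: "fine_selection \<epsilon> s" and \<epsilon>: "0 \<le> \<epsilon>" and y: "y \<in> K" "- x + y \<in> K"
  shows "norm ((\<integral>z. indicator Z z *\<^sub>R (f2 (y + s z) * cnj (g2 (- x + y + s z))) \<partial>\<mu>) - coef f2 g2 x)
     \<le> 2 * M * \<epsilon> * measure \<mu> Z"
proof -
  define F where "F z = f2 (y + z) * cnj (g2 (- x + y + z))" for z
  have Fc: "continuous_on UNIV F"
    unfolding F_def
    by (intro continuous_on_mult continuous_on_cnj continuous_on_compose2[OF cont(3)] continuous_on_compose2[OF cont(4)] continuous_intros) auto
  have Fm: "F \<in> borel_measurable \<mu>" by (rule continuous_measurable[OF Fc])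
  have F0: "F z = 0" if "z \<notin> Z" for z
    using in_Z[OF y(1), of z] supp(3)[of "y + z"] that by (auto simp: F_def)
  have FM: "norm (F z) \<le> M * M" for z
    unfolding F_def norm_mult complex_mod_cnj using bnd M_nonneg by (intro mult_mono) auto
  have Fi: "integrable \<mu> (\<lambda>z. indicator Z z *\<^sub>R F z)"
    using bounded_compact_integrable(1)[OF Fm compact_Z F0 FM] compact_Z by (intro integrable_mult_indicator) auto
  have "coef f2 g2 x = (\<integral>z. F z \<partial>\<mu>)"
  proof -
    have m: "(\<lambda>z. f2 z * cnj (g2 (- x + z))) \<in> borel_measurable \<mu>"
      by (intro continuous_measurable continuous_on_mult continuous_on_cnj cont continuous_on_compose2[OF cont(4)] continuous_intros) auto
    show ?thesis unfolding coef_eq F_def using integral_translate[OF m, of y] by (simp add: add.assoc)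
  qed
  also have "\<dots> = (\<integral>z. indicator Z z *\<^sub>R F z \<partial>\<mu>)"
    using F0 by (intro Bochner_Integration.integral_cong) (auto simp: indicator_def)
  finally have c: "coef f2 g2 x = (\<integral>z. indicator Z z *\<^sub>R F z \<partial>\<mu>)" .
  have i: "integrable \<mu> (\<lambda>z. indicator Z z *\<^sub>R F (s z))"
    by (rule integral_finite_range(1)[OF compact_Z fineD(2,3)[OF s]])
  have "(\<integral>z. indicator Z z *\<^sub>R F (s z) \<partial>\<mu>) - coef f2 g2 x = (\<integral>z. indicator Z z *\<^sub>R F (s z) - indicator Z z *\<^sub>R F z \<partial>\<mu>)"
    unfolding c using i Fi by simp
  also have "norm \<dots> \<le> 2 * M * \<epsilon> * measure \<mu> Z"
  proof (rule bounded_compact_integrable(2)[OF _ compact_Z])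
    show "(\<lambda>z. indicator Z z *\<^sub>R F (s z) - indicator Z z *\<^sub>R F z) \<in> borel_measurable \<mu>"
      using i Fi by (intro borel_measurable_diff borel_measurable_integrable)
    show "norm (indicator Z z *\<^sub>R F (s z) - indicator Z z *\<^sub>R F z) \<le> 2 * M * \<epsilon>" for z
    proof (cases "z \<in> Z")
      case True
      have "F (s z) - F z = (f2 (y + s z) - f2 (y + z)) * cnj (g2 (- x + y + s z)) +
          f2 (y + z) * cnj (g2 (- x + y + s z) - g2 (- x + y + z))"
        unfolding F_def complex_cnj_diff by (simp add: algebra_simps)
      also have "norm \<dots> \<le> norm (f2 (y + s z) - f2 (y + z)) * norm (g2 (- x + y + s z)) +
          norm (f2 (y + z)) * norm (g2 (- x + y + s z) - g2 (- x + y + z))"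
        by (rule order_trans[OF norm_triangle_ineq]) (simp only: norm_mult complex_mod_cnj order_refl)
      also have "\<dots> \<le> \<epsilon> * M + M * \<epsilon>"
        using fineD(4)[OF s y(1) True] fineD(5)[OF s y(2) True] bnd M_nonneg \<epsilon>
        by (intro add_mono mult_mono) (auto simp: norm_minus_commute)
      finally show ?thesis using True by simp
    qed (use M_nonneg \<epsilon> in simp)
  qed auto
  finally show ?thesis by (simp add: F_def)
qed

text \<open>
  For fixed \<open>y\<close>, the Riemann sum of the inner integral approximates \<open>coef f2 g2 x\<close>, by
  \<open>riemann_sum_close\<close>; the estimate is then integrated against \<open>f1 y * cnj (g1 (- x + y))\<close>.
\<close>

lemma w_close:
  assumes s: "fine_selection \<epsilon> s" and \<epsilon>: "0 \<le> \<epsilon>"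
  shows "norm (w s x - coef f1 g1 x * coef f2 g2 x) \<le> \<epsilon> * (M * M * (2 * M * measure \<mu> Z) * measure \<mu> K)"
proof -
  define I where "I y = (\<integral>z. indicator Z z *\<^sub>R (f2 (y + s z) * cnj (g2 (- x + y + s z))) \<partial>\<mu>)" for y
  define W where "W c = complex_of_real (measure \<mu> (Z \<inter> s -` {c}))" for c
  have I: "I y = (\<Sum>c\<in>s ` Z. W c * (f2 (y + c) * cnj (g2 (- x + y + c))))" for y
    unfolding I_def W_def
    using integral_finite_range(2)[OF compact_Z fineD(2,3)[OF s], of "\<lambda>c. f2 (y + c) * cnj (g2 (- x + y + c))"]
    by (simp add: scaleR_conv_of_real)
  have "w s x = (\<Sum>c\<in>s ` Z. W c * (\<integral>y. A c y * cnj (B c (- x + y)) \<partial>\<mu>))"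
    unfolding w_sum[OF s] W_def H_def coef_eq ..
  also have "\<dots> = (\<integral>y. (\<Sum>c\<in>s ` Z. W c * (A c y * cnj (B c (- x + y)))) \<partial>\<mu>)"
    using coef_integrable[OF A_Lp B_Lp, of _ _ x] by (subst Bochner_Integration.integral_sum) auto
  also have "\<dots> = (\<integral>y. f1 y * cnj (g1 (- x + y)) * I y \<partial>\<mu>)"
    unfolding I sum_distrib_left
    by (intro Bochner_Integration.integral_cong sum.cong) (auto simp: A_def B_def mult_ac)
  finally have ws: "w s x = (\<integral>y. f1 y * cnj (g1 (- x + y)) * I y \<partial>\<mu>)" .
  have i1: "integrable \<mu> (\<lambda>y. f1 y * cnj (g1 (- x + y)) * I y)"
  proof -
    have "integrable \<mu> (\<lambda>y. \<Sum>c\<in>s ` Z. W c * (A c y * cnj (B c (- x + y))))"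
      using coef_integrable[OF A_Lp B_Lp, of _ _ x]
      by (intro Bochner_Integration.integrable_sum Bochner_Integration.integrable_mult_right) auto
    also have "(\<lambda>y. \<Sum>c\<in>s ` Z. W c * (A c y * cnj (B c (- x + y)))) = (\<lambda>y. f1 y * cnj (g1 (- x + y)) * I y)"
      unfolding I sum_distrib_left
      by (intro ext sum.cong) (auto simp: A_def B_def mult_ac)
    finally show ?thesis .
  qed
  have i2: "integrable \<mu> (\<lambda>y. f1 y * cnj (g1 (- x + y)) * coef f2 g2 x)"
    by (intro Bochner_Integration.integrable_mult_left coef_integrable factors_Lp)
  have "w s x - coef f1 g1 x * coef f2 g2 x =
      (\<integral>y. f1 y * cnj (g1 (- x + y)) * I y - f1 y * cnj (g1 (- x + y)) * coef f2 g2 x \<partial>\<mu>)"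
    unfolding ws Bochner_Integration.integral_diff[OF i1 i2] by (simp add: coef_eq[of f1 g1])
  also have "norm \<dots> \<le> M * M * (2 * M * \<epsilon> * measure \<mu> Z) * measure \<mu> K"
  proof (rule bounded_compact_integrable(2)[OF _ K])
    show "(\<lambda>y. f1 y * cnj (g1 (- x + y)) * I y - f1 y * cnj (g1 (- x + y)) * coef f2 g2 x) \<in> borel_measurable \<mu>"
      using i1 i2 by (intro borel_measurable_diff borel_measurable_integrable)
    show "norm (f1 y * cnj (g1 (- x + y)) * I y - f1 y * cnj (g1 (- x + y)) * coef f2 g2 x)
        \<le> M * M * (2 * M * \<epsilon> * measure \<mu> Z)" for y
    proof (cases "y \<in> K \<and> - x + y \<in> K")
      case True
      have "norm (f1 y * cnj (g1 (- x + y)) * I y - f1 y * cnj (g1 (- x + y)) * coef f2 g2 x) =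
         norm (f1 y) * norm (g1 (- x + y)) * norm (I y - coef f2 g2 x)"
        by (simp add: right_diff_distrib[symmetric] norm_mult)
      also have "\<dots> \<le> M * M * (2 * M * \<epsilon> * measure \<mu> Z)"
        using riemann_sum_close[OF s \<epsilon>] True bnd M_nonneg \<epsilon> unfolding I_def
        by (intro mult_mono) (auto intro!: mult_nonneg_nonneg)
      finally show ?thesis .
    next
      case False
      then have "f1 y = 0 \<or> g1 (- x + y) = 0" using supp by blast
      then show ?thesis using M_nonneg \<epsilon> by auto
    qed
  qed (simp add: supp)
  finally show ?thesis by (simp add: mult_ac)
qed

text \<open>
  The product is the first of a sequence of Riemann sums plus the series of their successive
  differences, whose sizes are at most \<open>2 / 2 ^ n\<close>. This gives the constant \<open>6 + 4\<close>, which does not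
  depend on the supports and bounds of the factors; so it survives the passage from \<open>Cc\<close> to \<open>L\<^sup>p\<close>.
\<close>

lemma product_in_hull: "(\<lambda>x. coef f1 g1 x * coef f2 g2 x) \<in> l1_hull (atoms UNIV) 10"
proof -
  define mZ where "mZ = measure \<mu> Z"
  define D' where "D' = mZ * D"
  have mZ: "0 \<le> mZ" by (simp add: mZ_def)
  have D': "0 \<le> D'" using mZ M_nonneg by (auto simp: D'_def D_def intro!: mult_nonneg_nonneg)
  \<comment> \<open>small enough for \<open>w_in_hull\<close> and for the differences of Riemann sums at once\<close>
  define c where "c = 1 / (mZ + D' + 1)"
  have c: "0 < c" "c * mZ \<le> 1" "c * D' \<le> 1" using mZ D' by (auto simp: c_def divide_le_eq)
  define \<epsilon> where "\<epsilon> n = c * (1/2) ^ n" for n :: nat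
  have \<epsilon>: "0 < \<epsilon> n" for n using c by (simp add: \<epsilon>_def)
  have "\<forall>n. \<exists>s. fine_selection (\<epsilon> n) s" using fine_exists[OF \<epsilon>] by metis
  then obtain s where s: "\<And>n. fine_selection (\<epsilon> n) (s n)" by metis
  have 0: "w (s 0) \<in> l1_hull (atoms UNIV) 6"
    by (rule w_in_hull[OF s]) (use \<epsilon>[of 0] c in \<open>auto simp: \<epsilon>_def mZ_def\<close>)
  have d: "(\<lambda>x. w (s (Suc n)) x - w (s n) x) \<in> l1_hull (atoms UNIV) (2 * (1/2) ^ n)" for n
  proof (rule hull_mono[OF w_diff_in_hull[OF s s]])
    show "0 < \<epsilon> (Suc n) + \<epsilon> n" using \<epsilon> by (simp add: add_pos_pos)
    have "\<epsilon> (Suc n) + \<epsilon> n \<le> 2 * (c * (1/2) ^ n)" using c by (simp add: \<epsilon>_def)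
    then have "(\<epsilon> (Suc n) + \<epsilon> n) * D' \<le> 2 * (c * (1/2) ^ n) * D'" using D' by (rule mult_right_mono)
    also have "\<dots> = (c * D') * (2 * (1/2) ^ n)" by simp
    also have "\<dots> \<le> 1 * (2 * (1/2) ^ n)" using c(3) by (intro mult_right_mono) auto
    finally show "(\<epsilon> (Suc n) + \<epsilon> n) * (measure \<mu> Z * D) \<le> 2 * (1/2) ^ n"
      by (simp add: D'_def mZ_def)
  qed
  have lim: "(\<lambda>n. w (s n) x) \<longlonglongrightarrow> coef f1 g1 x * coef f2 g2 x" for x
  proof -
    define E where "E = M * M * (2 * M * measure \<mu> Z) * measure \<mu> K"
    have "(\<lambda>n. w (s n) x - coef f1 g1 x * coef f2 g2 x) \<longlonglongrightarrow> 0"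
    proof (rule Lim_null_comparison)
      have "norm (w (s n) x - coef f1 g1 x * coef f2 g2 x) \<le> \<epsilon> n * E" for n
        unfolding E_def using w_close[OF s, of n x] \<epsilon>[of n] by simp
      then show "\<forall>\<^sub>F n in sequentially. norm (w (s n) x - coef f1 g1 x * coef f2 g2 x) \<le> \<epsilon> n * E" by simp
      have "(\<lambda>n. c * (1/2) ^ n * E) \<longlonglongrightarrow> c * 0 * E" by (intro tendsto_intros) auto
      then show "(\<lambda>n. \<epsilon> n * E) \<longlonglongrightarrow> 0" by (simp add: \<epsilon>_def)
    qed
    then show ?thesis by (simp add: LIM_zero_iff)
  qed
  have "(\<lambda>x. coef f1 g1 x * coef f2 g2 x - w (s 0) x) \<in> l1_hull (atoms UNIV) 4"
  proof (rule hull_sums_le[OF bounded_atoms_coef d])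
    show "(\<lambda>n. 2 * (1/2) ^ n :: real) sums 4" using sums_mult[OF geometric_sums[of "1/2::real"], of 2] by simp
    show "(\<lambda>n. w (s (Suc n)) x - w (s n) x) sums (coef f1 g1 x * coef f2 g2 x - w (s 0) x)" for x
      by (rule telescope_sums[OF lim])
  qed
  from hull_add[OF bounded_atoms_coef this 0] show ?thesis by simp
qed

end

context haar_exponents
begin

lemma Cc_atoms_product:
  assumes "a \<in> atoms Cc" "b \<in> atoms Cc"
  shows "(\<lambda>x. a x * b x) \<in> l1_hull (atoms UNIV) 10"
proof -
  from assms(1) obtain f1 g1 where 1: "a = coef f1 g1" "f1 \<in> Cc" "pint \<mu> p f1 \<le> 1" "g1 \<in> Cc" "pint \<mu> q g1 \<le> 1"
    by (rule atomsE) blast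
  from assms(2) obtain f2 g2 where 2: "b = coef f2 g2" "f2 \<in> Cc" "pint \<mu> p f2 \<le> 1" "g2 \<in> Cc" "pint \<mu> q g2 \<le> 1"
    by (rule atomsE) blast
  obtain K1 where K1: "compact K1" "\<And>x. x \<notin> K1 \<Longrightarrow> f1 x = 0" using 1(2) by (rule CcE) blast
  obtain K2 where K2: "compact K2" "\<And>x. x \<notin> K2 \<Longrightarrow> g1 x = 0" using 1(4) by (rule CcE) blast
  obtain L1 where L1: "compact L1" "\<And>x. x \<notin> L1 \<Longrightarrow> f2 x = 0" using 2(2) by (rule CcE) blast
  obtain L2 where L2: "compact L2" "\<And>x. x \<notin> L2 \<Longrightarrow> g2 x = 0" using 2(4) by (rule CcE) blast
  obtain M1 where M1: "\<And>x. norm (f1 x) \<le> M1" using Cc_bounded[OF 1(2)] by blast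
  obtain M2 where M2: "\<And>x. norm (g1 x) \<le> M2" using Cc_bounded[OF 1(4)] by blast
  obtain M3 where M3: "\<And>x. norm (f2 x) \<le> M3" using Cc_bounded[OF 2(2)] by blast
  obtain M4 where M4: "\<And>x. norm (g2 x) \<le> M4" using Cc_bounded[OF 2(4)] by blast
  define M where "M = max (max M1 M2) (max M3 M4)"
  have M: "M1 \<le> M" "M2 \<le> M" "M3 \<le> M" "M4 \<le> M" by (auto simp: M_def)
  interpret coef_product \<mu> p q f1 g1 f2 g2 "K1 \<union> K2" "L1 \<union> L2" M
  proof unfold_locales
    show "norm (f1 x) \<le> M" "norm (g1 x) \<le> M" "norm (f2 x) \<le> M" "norm (g2 x) \<le> M" for x
      using M1 M2 M3 M4 M order_trans by blast+
  qed (use 1 2 K1 K2 L1 L2 in \<open>auto intro: Cc_continuous\<close>)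
  show ?thesis using product_in_hull 1 2 by simp
qed

text \<open>
  Both functions are expanded into atoms with factors in \<open>Cc\<close>; all pairwise products lie in one
  hull.
\<close>

lemma Ap_mult:
  assumes u: "u \<in> Ap \<mu> p" and v: "v \<in> Ap \<mu> p"
  shows "(\<lambda>x. u x * v x) \<in> Ap \<mu> p"
proof -
  obtain r where "u \<in> l1_hull (atoms UNIV) r" using u unfolding Ap_iff_hull by blast
  then have u': "u \<in> l1_hull (atoms Cc) (32 * r)" by (rule hull_atoms_Cc)
  obtain t where "v \<in> l1_hull (atoms UNIV) t" using v unfolding Ap_iff_hull by blast
  then have v': "v \<in> l1_hull (atoms Cc) (32 * t)" by (rule hull_atoms_Cc)
  have 1: "(\<lambda>x. u x * v x) \<in> l1_hull (atoms UNIV) (10 * (32 * t) * (32 * r))"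
    by (rule hull_times[OF bounded_atoms_coef Cc_atoms_product u' v'])
  have uC: "u \<in> C0" and vC: "v \<in> C0" using u v by (auto simp: Ap_def)
  have vb: "norm (v x) \<le> 2 * (32 * t)" for x
    by (rule hull_bound[OF _ v']) (use bounded_atoms_coef in \<open>auto simp: bounded_atoms_def\<close>)
  then have t0: "0 \<le> 2 * (32 * t)" using norm_ge_zero order_trans by blast
  have "(\<lambda>x. u x * v x) \<in> C0"
    unfolding C0_def
  proof (intro CollectI conjI allI impI)
    show "continuous_on UNIV (\<lambda>x. u x * v x)" using uC vC by (auto simp: C0_def intro: continuous_on_mult)
    fix e :: real assume e: "e > 0"
    then have "e / (2 * (32 * t) + 1) > 0" using t0 by simp
    then obtain K where K: "compact K" "\<And>x. x \<notin> K \<Longrightarrow> norm (u x) < e / (2 * (32 * t) + 1)"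
      using uC unfolding C0_def by blast
    have "norm (u x * v x) < e" if "x \<notin> K" for x
    proof -
      have "norm (u x * v x) \<le> norm (u x) * (2 * (32 * t) + 1)"
        unfolding norm_mult using vb[of x] by (intro mult_left_mono) auto
      also have "\<dots> < e" using K(2)[OF that] t0 by (simp add: pos_less_divide_eq)
      finally show ?thesis .
    qed
    with K(1) show "\<exists>K. compact K \<and> (\<forall>x. x \<notin> K \<longrightarrow> norm (u x * v x) < e)" by blast
  qed
  with 1 show ?thesis by (rule hull_in_Ap)
qed

lemma C0_add: "u \<in> C0 \<Longrightarrow> v \<in> C0 \<Longrightarrow> (\<lambda>x. u x + v x :: complex) \<in> C0"
  unfolding C0_def
proof (intro CollectI conjI allI impI; elim CollectE conjE)
  assume "continuous_on UNIV u" "continuous_on UNIV v"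
  then show "continuous_on UNIV (\<lambda>x. u x + v x)" by (rule continuous_on_add)
next
  fix e :: real assume e: "e > 0"
    and u: "\<forall>e>0. \<exists>K. compact K \<and> (\<forall>x. x \<notin> K \<longrightarrow> norm (u x) < e)"
    and v: "\<forall>e>0. \<exists>K. compact K \<and> (\<forall>x. x \<notin> K \<longrightarrow> norm (v x) < e)"
  obtain K where K: "compact K" "\<And>x. x \<notin> K \<Longrightarrow> norm (u x) < e / 2" using u e half_gt_zero by blast
  obtain L where L: "compact L" "\<And>x. x \<notin> L \<Longrightarrow> norm (v x) < e / 2" using v e half_gt_zero by blast
  have "norm (u x + v x) < e" if "x \<notin> K \<union> L" for x
    using norm_triangle_ineq[of "u x" "v x"] K(2)[of x] L(2)[of x] that by auto
  then show "\<exists>K. compact K \<and> (\<forall>x. x \<notin> K \<longrightarrow> norm (u x + v x) < e)"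
    using compact_Un[OF K(1) L(1)] by blast
qed

lemma C0_scale: "u \<in> C0 \<Longrightarrow> (\<lambda>x. c * u x :: complex) \<in> C0"
  unfolding C0_def
proof (intro CollectI conjI allI impI; elim CollectE conjE)
  assume "continuous_on UNIV u"
  then show "continuous_on UNIV (\<lambda>x. c * u x)" by (rule continuous_on_mult_left)
next
  fix e :: real assume e: "e > 0"
    and u: "\<forall>e>0. \<exists>K. compact K \<and> (\<forall>x. x \<notin> K \<longrightarrow> norm (u x) < e)"
  have "e / (norm c + 1) > 0" using e by (simp add: add_nonneg_pos)
  then obtain K where K: "compact K" "\<And>x. x \<notin> K \<Longrightarrow> norm (u x) < e / (norm c + 1)" using u by blast
  have "norm (c * u x) < e" if "x \<notin> K" for x
  proof -
    have "norm (c * u x) \<le> (norm c + 1) * norm (u x)" by (simp add: norm_mult algebra_simps)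
    also have "\<dots> < e" using K(2)[OF that] by (simp add: pos_less_divide_eq add_nonneg_pos mult.commute)
    finally show ?thesis .
  qed
  with K(1) show "\<exists>K. compact K \<and> (\<forall>x. x \<notin> K \<longrightarrow> norm (c * u x) < e)" by blast
qed

lemma Ap_add:
  assumes "u \<in> Ap \<mu> p" "v \<in> Ap \<mu> p"
  shows "(\<lambda>x. u x + v x) \<in> Ap \<mu> p"
  using assms unfolding Ap_iff_hull by (blast intro: hull_add[OF bounded_atoms_coef] C0_add)

lemma Ap_scale:
  assumes "u \<in> Ap \<mu> p"
  shows "(\<lambda>x. c * u x) \<in> Ap \<mu> p"
  using assms unfolding Ap_iff_hull by (blast intro: hull_scale C0_scale)

end


section \<open>Evaluations as characters\<close>

context haar_exponents
begin

lemma coef_Cc_vanishes: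
  assumes K: "\<And>x. x \<notin> K \<Longrightarrow> f x = 0" and L: "\<And>x. x \<notin> L \<Longrightarrow> g x = 0"
    and t: "t \<notin> (\<lambda>(s, k). s - k) ` (K \<times> L)"
  shows "coef f g t = 0"
proof -
  have "f y * cnj (g (- t + y)) = 0" for y
  proof (rule ccontr)
    assume "f y * cnj (g (- t + y)) \<noteq> 0"
    then have "y \<in> K" "- t + y \<in> L" using K L by auto
    moreover have "y - (- t + y) = t" by (simp only: diff_conv_add_uminus minus_add add.assoc[symmetric]) simp
    ultimately have "t \<in> (\<lambda>(s, k). s - k) ` (K \<times> L)"
      by (intro rev_image_eqI[of "(y, - t + y)"]) auto
    then show False using t by blast
  qed
  then have "(\<lambda>y. f y * cnj (g (- t + y))) = (\<lambda>y. 0)" by (rule ext)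
  then show ?thesis unfolding coef_eq by simp
qed

lemma coef_Cc_continuous:
  assumes f: "f \<in> Cc" and g: "g \<in> Cc"
  shows "continuous_on UNIV (coef f g)"
proof -
  obtain K where K: "compact K" "\<And>x. x \<notin> K \<Longrightarrow> f x = 0" using f by (rule CcE) blast
  obtain M where M: "0 \<le> M" "\<And>x. norm (f x) \<le> M" using Cc_bounded[OF f] by blast
  have fL: "f \<in> Lp \<mu> p" and gL: "g \<in> Lp \<mu> q" using f g Cc_Lp pq by auto
  have g': "continuous_on UNIV (\<lambda>x. g (- x))"
    by (rule continuous_on_compose2[OF Cc_continuous[OF g]]) (auto intro: continuous_intros)
  have K': "compact (uminus ` K)"
    using K(1) by (intro compact_continuous_image continuous_intros) auto
  have "isCont (coef f g) t0" for t0
    unfolding isCont_def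
  proof (rule tendstoI)
    fix e :: real assume e: "0 < e"
    define \<epsilon> where "\<epsilon> = e / (M * measure \<mu> K + 1)"
    have pos: "M * measure \<mu> K + 1 > 0" using M by (intro add_nonneg_pos) auto
    have \<epsilon>: "\<epsilon> > 0" using e pos by (simp add: \<epsilon>_def)
    obtain N where N: "open N" "t0 \<in> N"
      "\<And>y z. y \<in> uminus ` K \<Longrightarrow> z \<in> N \<Longrightarrow> dist (g (- (y + z))) (g (- (y + t0))) \<le> \<epsilon>"
      using right_translate_locally_uniform[OF g' K' \<epsilon>, of t0] by metis
    have "dist (coef f g t) (coef f g t0) < e" if t: "t \<in> N" for t
    proof -
      have "coef f g t - coef f g t0 = (\<integral>y. f y * cnj (g (- t + y)) - f y * cnj (g (- t0 + y)) \<partial>\<mu>)"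
        unfolding coef_eq using coef_integrable[OF fL gL, of t] coef_integrable[OF fL gL, of t0] by simp
      also have "norm \<dots> \<le> M * \<epsilon> * measure \<mu> K"
      proof (rule bounded_compact_integrable(2)[OF _ K(1)])
        show "(\<lambda>y. f y * cnj (g (- t + y)) - f y * cnj (g (- t0 + y))) \<in> borel_measurable \<mu>"
          using coef_integrable[OF fL gL] by (intro borel_measurable_diff borel_measurable_integrable)
        show "norm (f y * cnj (g (- t + y)) - f y * cnj (g (- t0 + y))) \<le> M * \<epsilon>" for y
        proof (cases "y \<in> K")
          case True
          have "norm (f y * cnj (g (- t + y)) - f y * cnj (g (- t0 + y))) = norm (f y) * norm (g (- t + y) - g (- t0 + y))"
            by (simp add: right_diff_distrib[symmetric] norm_mult complex_cnj_diff[symmetric] del: complex_cnj_diff)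
          also have "\<dots> \<le> M * \<epsilon>"
          proof (rule mult_mono)
            have "- y \<in> uminus ` K" using True by (rule imageI)
            from N(3)[OF this t] show "norm (g (- t + y) - g (- t0 + y)) \<le> \<epsilon>"
              by (simp add: dist_norm minus_add)
          qed (use M in auto)
          finally show ?thesis .
        qed (use M \<epsilon> K(2) in auto)
      qed (use K(2) in auto)
      also have "\<dots> < \<epsilon> * (M * measure \<mu> K + 1)" using \<epsilon> by (simp add: algebra_simps)
      also have "\<dots> = e" using pos by (simp add: \<epsilon>_def)
      finally show ?thesis by (simp add: dist_norm)
    qed
    then show "\<forall>\<^sub>F t in at t0. dist (coef f g t) (coef f g t0) < e"
      unfolding eventually_at_topological using N by blast
  qed
  then show ?thesis by (simp add: continuous_at_imp_continuous_on)
qed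

lemma coef_Cc_in_Ap:
  assumes f: "f \<in> Cc" and g: "g \<in> Cc"
  shows "coef f g \<in> Ap \<mu> p"
proof (rule hull_in_Ap)
  show "coef f g \<in> l1_hull (atoms UNIV) (pint \<mu> p f + pint \<mu> q g + 2 * 1)"
    by (rule coef_in_hull_sum) (use f g Cc_Lp pq in auto)
  obtain K where K: "compact K" "\<And>x. x \<notin> K \<Longrightarrow> f x = 0" using f by (rule CcE) blast
  obtain L where L: "compact L" "\<And>x. x \<notin> L \<Longrightarrow> g x = 0" using g by (rule CcE) blast
  have "compact ((\<lambda>(s, k). s - k) ` (K \<times> L))"
    unfolding case_prod_unfold diff_conv_add_uminus
    using K(1) L(1) by (intro compact_continuous_image compact_Times continuous_intros)
  then show "coef f g \<in> C0"
    unfolding C0_def using coef_Cc_continuous[OF f g] coef_Cc_vanishes[OF K(2) L(2)]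
    by (intro CollectI conjI allI impI exI[of _ "(\<lambda>(s, k). s - k) ` (K \<times> L)"]) auto
qed

lemma Cc_translate:
  assumes "f \<in> Cc" shows "(\<lambda>y. f (x + y)) \<in> Cc"
proof -
  obtain K where K: "compact K" "\<And>x. x \<notin> K \<Longrightarrow> f x = 0" using assms by (rule CcE) blast
  show ?thesis
  proof (rule CcI)
    show "continuous_on UNIV (\<lambda>y. f (x + y))"
      by (rule continuous_on_compose2[OF Cc_continuous[OF assms]]) (auto intro!: continuous_intros)
    show "compact ((\<lambda>y. - x + y) ` K)"
      using K(1) by (intro compact_continuous_image continuous_intros)
    fix y assume y: "y \<notin> (\<lambda>y. - x + y) ` K"
    have "x + y \<notin> K"
    proof
      assume "x + y \<in> K"
      then have "- x + (x + y) \<in> (\<lambda>y. - x + y) ` K" by (rule imageI)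
      then show False using y by (simp add: add.assoc[symmetric])
    qed
    then show "f (x + y) = 0" by (rule K(2))
  qed
qed

text \<open>
  For a bump function \<open>h\<close> supported in \<open>V\<close>, the coefficient of its translate to \<open>x\<close> against
  \<open>h\<close> has at \<open>x\<close> the value \<open>\<integral> h\<^sup>2 > 0\<close>. At \<open>y\<close> it is the integral of the product of the translates
  of \<open>h\<close> to \<open>x\<close> and \<open>y\<close>, which is \<open>0\<close> if the translates of \<open>V\<close> are disjoint.
\<close>

lemma Ap_peak:
  assumes V: "open V" "0 \<in> V"
  shows "\<exists>u\<in>Ap \<mu> p. u x \<noteq> 0 \<and> (\<forall>y. (\<forall>s. - x + s \<in> V \<longrightarrow> - y + s \<notin> V) \<longrightarrow> u y = 0)"
proof -
  have K0: "compact {0::'a}" "{0} \<subseteq> V" using V by auto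
  obtain h where h: "continuous_on UNIV h" "\<And>x. 0 \<le> h x" "\<And>x. h x \<le> 1" "\<And>x. x \<in> {0} \<Longrightarrow> h x = 1"
    "\<And>x. x \<notin> V \<Longrightarrow> h x = 0" "(\<lambda>x. complex_of_real (h x)) \<in> Cc"
    using Urysohn_compact_open[OF K0(1) V(1) K0(2)] by metis
  define g where "g x = complex_of_real (h x)" for x
  have g: "g \<in> Cc" using h(6) by (simp add: g_def[abs_def])
  define u where "u = coef (\<lambda>s. g (- x + s)) g"
  have "u \<in> Ap \<mu> p" unfolding u_def by (intro coef_Cc_in_Ap Cc_translate g)
  moreover have "u y = 0" if y: "\<forall>s. - x + s \<in> V \<longrightarrow> - y + s \<notin> V" for y
  proof -
    have "h (- x + s) = 0 \<or> h (- y + s) = 0" for s using h(5) y by blast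
    then have "g (- x + s) * cnj (g (- y + s)) = 0" for s by (auto simp: g_def)
    then have "(\<lambda>s. g (- x + s) * cnj (g (- y + s))) = (\<lambda>s. 0)" by (rule ext)
    then show ?thesis unfolding u_def coef_eq by simp
  qed
  moreover have "u x \<noteq> 0"
  proof
    assume "u x = 0"
    have gL: "g \<in> Lp \<mu> p" "g \<in> Lp \<mu> q" using g Cc_Lp pq by auto
    have i: "integrable \<mu> (\<lambda>y. g y * cnj (g (- 0 + y)))" by (rule coef_integrable[OF gL])
    then have i2: "integrable \<mu> (\<lambda>y. complex_of_real (h y * h y))" by (simp add: g_def)
    then have ir: "integrable \<mu> (\<lambda>y. h y * h y)" by (simp only: complex_of_real_integrable_eq)
    have m: "(\<lambda>y. g y * cnj (g y)) \<in> borel_measurable \<mu>" using i by auto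
    have "u x = (\<integral>y. g y * cnj (g y) \<partial>\<mu>)"
      unfolding u_def coef_eq using integral_translate[OF m, of "- x"] by simp
    also have "\<dots> = (\<integral>y. complex_of_real (h y * h y) \<partial>\<mu>)" by (simp add: g_def)
    also have "\<dots> = complex_of_real (\<integral>y. h y * h y \<partial>\<mu>)" by (rule integral_complex_of_real)
    finally have "(\<integral>y. h y * h y \<partial>\<mu>) = 0" using \<open>u x = 0\<close> by simp
    then have AE: "AE y in \<mu>. h y * h y = 0"
      using ir by (subst (asm) integral_nonneg_eq_0_iff_AE) auto
    have o: "open (h -` (- {0}))" by (intro open_vimage h(1)) auto
    have ne: "0 \<in> h -` (- {0})" using h(4)[of 0] by simp
    have "AE y in \<mu>. y \<notin> h -` (- {0})" using AE by (rule AE_mp) (auto intro!: AE_I2)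
    then have "h -` (- {0}) \<in> null_sets \<mu>" using o by (subst AE_iff_null_sets) auto
    then have "emeasure \<mu> (h -` (- {0})) = 0" by auto
    moreover have "emeasure \<mu> (h -` (- {0})) > 0" using o ne by (intro open_emeasure_pos) blast+
    ultimately show False by simp
  qed
  ultimately show ?thesis by blast
qed

lemma Ap_separates:
  assumes "x \<noteq> y" shows "\<exists>u\<in>Ap \<mu> p. u x \<noteq> 0 \<and> u y = 0"
proof -
  obtain U W where UW: "open U" "open W" "x \<in> U" "y \<in> W" "U \<inter> W = {}" using hausdorff[OF assms] by blast
  define V where "V = (\<lambda>v. x + v) -` U \<inter> (\<lambda>v. y + v) -` W"
  have V: "open V" unfolding V_def using UW by (intro open_Int open_vimage continuous_intros)
  have V0: "0 \<in> V" using UW by (simp add: V_def)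
  have "- y + s \<notin> V" if "- x + s \<in> V" for s
  proof
    assume "- y + s \<in> V"
    then have "x + (- x + s) \<in> U" "y + (- y + s) \<in> W" using that by (auto simp: V_def)
    then have "s \<in> U" "s \<in> W" by (simp_all add: add.assoc[symmetric])
    then show False using UW by blast
  qed
  then show ?thesis using Ap_peak[OF V V0, of x] by blast
qed

lemma Ap_nonvanishing: "\<exists>u\<in>Ap \<mu> p. u x \<noteq> 0"
  using Ap_peak[of UNIV x] by auto

text \<open>
  Characters are extensional functions, hence the restriction to \<open>A\<^sub>p\<close>.
\<close>

definition evaluation :: "'a \<Rightarrow> ('a \<Rightarrow> complex) \<Rightarrow> complex" where
  "evaluation x = restrict (\<lambda>u. u x) (Ap \<mu> p)"

lemma evaluation_character: "evaluation x \<in> character_space (Ap \<mu> p)"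
proof -
  obtain u where u: "u \<in> Ap \<mu> p" "u x \<noteq> 0" using Ap_nonvanishing by blast
  then have "evaluation x u \<noteq> zero_functional (Ap \<mu> p) u"
    by (simp add: evaluation_def zero_functional_def)
  then have "evaluation x \<noteq> zero_functional (Ap \<mu> p)" by auto
  moreover have "evaluation x \<in> homomorphisms (Ap \<mu> p)"
    unfolding homomorphisms_def by (auto simp: evaluation_def Ap_add Ap_mult Ap_scale)
  ultimately show ?thesis by (simp add: character_space_def)
qed

text \<open>
  If \<open>\<phi> \<noteq> 0\<close> and the kernel of \<open>\<phi>\<close> vanishes at \<open>x\<close>, then evaluation at \<open>x\<close> is a multiple
  of \<open>\<phi>\<close>. For two such points, the evaluations would be proportional, and \<open>A\<^sub>p\<close> could not separate the points.
\<close>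

lemma ker_zeros_unique:
  assumes \<phi>: "\<phi> \<in> character_space (Ap \<mu> p) \<union> {zero_functional (Ap \<mu> p)}"
    and x: "\<And>b. b \<in> ker (Ap \<mu> p) \<phi> \<Longrightarrow> b x = 0"
    and y: "\<And>b. b \<in> ker (Ap \<mu> p) \<phi> \<Longrightarrow> b y = 0"
  shows "x = y"
proof (rule ccontr)
  assume xy: "x \<noteq> y"
  show False
  proof (cases "\<phi> = zero_functional (Ap \<mu> p)")
    case True
    then have "ker (Ap \<mu> p) \<phi> = Ap \<mu> p" by (auto simp: ker_def zero_functional_def)
    then show False using x Ap_nonvanishing by blast
  next
    case False
    then have hom: "\<phi> \<in> homomorphisms (Ap \<mu> p)" using \<phi> by (auto simp: character_space_def)
    have "\<exists>u0\<in>Ap \<mu> p. \<phi> u0 \<noteq> 0"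
    proof (rule ccontr)
      assume "\<not> (\<exists>u0\<in>Ap \<mu> p. \<phi> u0 \<noteq> 0)"
      then have "\<phi> = zero_functional (Ap \<mu> p)"
        using hom by (intro extensionalityI[of _ "Ap \<mu> p"]) (auto simp: homomorphisms_def zero_functional_def)
      then show False using False by blast
    qed
    then obtain u0 where u0: "u0 \<in> Ap \<mu> p" "\<phi> u0 \<noteq> 0" by blast
    have "v z = \<phi> v / \<phi> u0 * u0 z" if v: "v \<in> Ap \<mu> p" and z: "\<And>b. b \<in> ker (Ap \<mu> p) \<phi> \<Longrightarrow> b z = 0" for v z
    proof -
      define c where "c = - (\<phi> v / \<phi> u0)"
      have cu: "(\<lambda>x. c * u0 x) \<in> Ap \<mu> p" by (rule Ap_scale[OF u0(1)])
      have A: "(\<lambda>x. v x + c * u0 x) \<in> Ap \<mu> p" by (rule Ap_add[OF v cu])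
      have "\<phi> (\<lambda>x. v x + c * u0 x) = \<phi> v + c * \<phi> u0"
        using hom v cu u0(1) by (auto simp: homomorphisms_def)
      also have "\<dots> = 0" using u0(2) by (simp add: c_def)
      finally have "(\<lambda>x. v x + c * u0 x) \<in> ker (Ap \<mu> p) \<phi>" using A by (simp add: ker_def)
      from z[OF this] show ?thesis by (simp add: c_def)
    qed
    note rep = this
    obtain u where u: "u \<in> Ap \<mu> p" "u x \<noteq> 0" "u y = 0" using Ap_separates[OF xy] by blast
    have rx: "u x = \<phi> u / \<phi> u0 * u0 x" by (rule rep[OF u(1)]) (rule x)
    have ry: "v y = \<phi> v / \<phi> u0 * u0 y" if "v \<in> Ap \<mu> p" for v by (rule rep[OF that]) (rule y)
    have "\<phi> u \<noteq> 0" using rx u(2) by auto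
    then have "u0 y = 0" using ry[OF u(1)] u(3) u0(2) by auto
    then have "v y = 0" if "v \<in> Ap \<mu> p" for v using ry[OF that] by simp
    then show False using Ap_nonvanishing by blast
  qed
qed

text \<open>
  The defining property of the net is applied to the compact set consisting of one
  evaluation. Only for \<open>i \<in> I\<close> is \<open>b * e i\<close> known to lie in \<open>A\<^sub>p\<close>, so that the values agree eventually.
\<close>

lemma ai_pointwise_limit:
  fixes I :: "'i set"
  assumes I: "directed_set I le" and e: "\<And>i. i \<in> I \<Longrightarrow> e i \<in> Ap \<mu> p"
    and lim: "\<And>K. compactin (gelfand_topology (Ap \<mu> p)) K \<Longrightarrow>
       ((\<lambda>i. SUP \<phi>\<in>K. ennreal (norm (\<phi> (\<lambda>x. b x * e i x) - \<phi> b))) \<longlongrightarrow> 0) (net_filter I le)"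
    and b: "b \<in> Ap \<mu> p" "b x \<noteq> 0"
  shows "((\<lambda>i. e i x) \<longlongrightarrow> 1) (net_filter I le)"
proof -
  have "evaluation x \<in> topspace (gelfand_topology (Ap \<mu> p))"
    using evaluation_character[of x] by (auto simp: gelfand_topology_def evaluation_def)
  then have "compactin (gelfand_topology (Ap \<mu> p)) {evaluation x}" by simp
  from lim[OF this]
  have "((\<lambda>i. ennreal (norm (evaluation x (\<lambda>x. b x * e i x) - evaluation x b))) \<longlongrightarrow> 0) (net_filter I le)" by simp
  moreover have "\<forall>\<^sub>F i in net_filter I le. ennreal (norm (evaluation x (\<lambda>x. b x * e i x) - evaluation x b)) = ennreal (norm (b x * e i x - b x))"
  proof -
    obtain a where a: "a \<in> I" using I by (auto simp: directed_set_def)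
    have "ennreal (norm (evaluation x (\<lambda>x. b x * e i x) - evaluation x b)) = ennreal (norm (b x * e i x - b x))"
      if "i \<in> I" for i
      using b(1) Ap_mult[OF b(1) e[OF that]] by (simp add: evaluation_def)
    then show ?thesis unfolding eventually_net_filter[OF I] using a by blast
  qed
  ultimately have "((\<lambda>i. ennreal (norm (b x * e i x - b x))) \<longlongrightarrow> 0) (net_filter I le)"
    by (rule Lim_transform_eventually)
  then have "((\<lambda>i. norm (b x * e i x - b x)) \<longlongrightarrow> 0) (net_filter I le)"
    using tendsto_ennreal_iff[of "\<lambda>i. norm (b x * e i x - b x)" "net_filter I le" 0] by simp
  then have "((\<lambda>i. b x * e i x - b x) \<longlongrightarrow> 0) (net_filter I le)"
    by (rule tendsto_norm_zero_cancel)
  then have "((\<lambda>i. b x * e i x) \<longlongrightarrow> b x) (net_filter I le)" by (simp add: LIM_zero_iff)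
  then have "((\<lambda>i. b x * e i x / b x) \<longlongrightarrow> b x / b x) (net_filter I le)"
    using b(2) by (intro tendsto_divide tendsto_const)
  then show ?thesis using b(2) by simp
qed

end

section \<open>Averages of left translations\<close>

context haar_group
begin

text \<open>
  The operator \<open>T\<close>. It acts on the vectors \<open>f\<close> as well as on the functions in \<open>A\<^sub>p\<close>.
\<close>

definition avg :: "'a set \<Rightarrow> ('a \<Rightarrow> complex) \<Rightarrow> 'a \<Rightarrow> complex" where
  "avg F f y = (\<Sum>s\<in>F. f (s + y)) / of_nat (card F)"

lemma Lp_finite_sum:
  assumes "finite J" "\<And>j. j \<in> J \<Longrightarrow> f j \<in> Lp \<mu> p" "0 \<le> p"
  shows "(\<lambda>x. \<Sum>j\<in>J. f j x) \<in> Lp \<mu> p"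
  using assms(1,2) by (induction J) (auto intro: Lp_add(1)[OF _ _ assms(3)], simp add: Lp_def)

lemma avg_Lp:
  assumes "finite F" "f \<in> Lp \<mu> p" "0 \<le> p"
  shows "avg F f \<in> Lp \<mu> p"
proof -
  have "(\<lambda>y. \<Sum>s\<in>F. f (s + y)) \<in> Lp \<mu> p"
    using assms by (intro Lp_finite_sum Lp_translate)
  from Lp_scale(1)[OF this, of "1 / of_nat (card F)"] show ?thesis by (simp add: avg_def[abs_def])
qed

lemma avg_pow_Lp:
  assumes "finite F" "f \<in> Lp \<mu> p" "0 \<le> p"
  shows "(avg F ^^ m) f \<in> Lp \<mu> p"
  by (induction m) (auto intro: avg_Lp assms)

lemma avg_pow_Suc: "(avg F ^^ Suc m) f y = (\<Sum>s\<in>F. (avg F ^^ m) f (s + y)) / of_nat (card F)"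
  by (simp add: avg_def)

lemma avg_pow_sums:
  assumes "\<And>x. (\<lambda>i. c i * a i x) sums u x"
  shows "(\<lambda>i. c i * (avg F ^^ m) (a i) x) sums (avg F ^^ m) u x"
proof (induction m arbitrary: x)
  case (Suc m)
  have "(\<lambda>i. (\<Sum>s\<in>F. c i * (avg F ^^ m) (a i) (s + x)) / of_nat (card F)) sums
       ((\<Sum>s\<in>F. (avg F ^^ m) u (s + x)) / of_nat (card F))"
    by (intro sums_divide sums_sum Suc)
  then show ?case by (simp only: avg_pow_Suc sum_distrib_left times_divide_eq_right)
qed (simp add: assms)

text \<open>
  The \<open>m\<close>-th iterated average at \<open>t\<close> is a mean of values at points \<open>q + t\<close>, where \<open>q\<close> runs over the
  sums of \<open>m\<close> elements of \<open>F\<close>. Convergence holds as soon as these points avoid \<open>x0\<close>.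
\<close>

lemma avg_pow_tendsto:
  assumes F: "finite F" "F \<noteq> {}" and lim: "\<And>x. x \<noteq> x0 \<Longrightarrow> ((\<lambda>i. e i x) \<longlongrightarrow> 1) \<F>"
  shows "\<exists>Q. finite Q \<and> (\<forall>t. (\<forall>q\<in>Q. q + t \<noteq> x0) \<longrightarrow> ((\<lambda>i. (avg F ^^ m) (e i) t) \<longlongrightarrow> 1) \<F>)"
proof (induction m)
  case 0 then show ?case using lim by (intro exI[of _ "{0}"]) auto
next
  case (Suc m)
  then obtain Q where Q: "finite Q" "\<And>t. (\<forall>q\<in>Q. q + t \<noteq> x0) \<Longrightarrow> ((\<lambda>i. (avg F ^^ m) (e i) t) \<longlongrightarrow> 1) \<F>" by blast
  define Q' where "Q' = (\<lambda>(q, s). q + s) ` (Q \<times> F)"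
  have "((\<lambda>i. (avg F ^^ Suc m) (e i) t) \<longlongrightarrow> 1) \<F>" if t: "\<forall>q\<in>Q'. q + t \<noteq> x0" for t
  proof -
    have "((\<lambda>i. (avg F ^^ m) (e i) (s + t)) \<longlongrightarrow> 1) \<F>" if s: "s \<in> F" for s
    proof (rule Q(2), rule ballI)
      fix q assume "q \<in> Q"
      then have "q + s \<in> Q'" using s by (force simp: Q'_def)
      then show "q + (s + t) \<noteq> x0" using t by (simp add: add.assoc[symmetric])
    qed
    then have "((\<lambda>i. (\<Sum>s\<in>F. (avg F ^^ m) (e i) (s + t)) / of_nat (card F)) \<longlongrightarrow> (\<Sum>s\<in>F. 1) / of_nat (card F)) \<F>"
      using F by (intro tendsto_divide tendsto_sum tendsto_const) auto
    moreover have "(\<Sum>s\<in>F. 1) / of_nat (card F) = (1::complex)" using F by simp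
    ultimately show ?thesis by (simp only: avg_pow_Suc)
  qed
  moreover have "finite Q'" using Q(1) F by (simp add: Q'_def)
  ultimately show ?case by blast
qed

end

context haar_exponents
begin

lemma coef_avg:
  assumes F: "finite F" and f: "f \<in> Lp \<mu> p" and g: "g \<in> Lp \<mu> q"
  shows "coef (avg F f) g = avg F (coef f g)"
proof
  fix x
  have fs: "(\<lambda>y. f (s + y)) \<in> Lp \<mu> p" for s by (rule Lp_translate(1)[OF f])
  have i: "integrable \<mu> (\<lambda>y. f (s + (x + y)) * cnj (g y))" for s
    by (rule Lp_mult_integrable(1)[OF pq Lp_translate(1)[OF fs] Lp_cnj[OF g]])
  have "coef (avg F f) g x = (\<integral>y. (\<Sum>s\<in>F. f (s + (x + y)) * cnj (g y)) / of_nat (card F) \<partial>\<mu>)"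
    using p_gt_1 F by (subst coef_translate[OF avg_Lp[OF F f] g]) (auto simp: avg_def sum_distrib_right)
  also have "\<dots> = (\<Sum>s\<in>F. \<integral>y. f (s + (x + y)) * cnj (g y) \<partial>\<mu>) / of_nat (card F)"
    using i by (simp add: Bochner_Integration.integral_sum)
  also have "\<dots> = avg F (coef f g) x"
    by (simp add: avg_def coef_translate[OF f g] add.assoc)
  finally show "coef (avg F f) g x = avg F (coef f g) x" .
qed

lemma coef_avg_pow:
  assumes F: "finite F" and f: "f \<in> Lp \<mu> p" and g: "g \<in> Lp \<mu> q"
  shows "coef ((avg F ^^ m) f) g = (avg F ^^ m) (coef f g)"
proof (induction m)
  case (Suc m)
  then show ?case using coef_avg[OF F avg_pow_Lp[OF F f] g, of m] p_gt_1 by simp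
qed simp

text \<open>
  Otherwise the norm of the average on \<open>L\<^sup>p\<close> is at most \<open>\<kappa> < 1\<close>, and the \<open>m\<close>-th iterated averages of all
  \<open>e i\<close> are bounded by \<open>2 * \<kappa> ^ m * (C + 1)\<close>. At some point they tend to 1 along the net, so that this
  bound is at least 1 for every \<open>m\<close>, which is absurd.
\<close>

lemma almost_norm_attaining:
  fixes I :: "'i set"
  assumes inf: "infinite (UNIV :: 'a set)"
    and I: "directed_set I le" and e: "\<And>i. i \<in> I \<Longrightarrow> e i \<in> Ap \<mu> p"
    and C: "\<And>i. i \<in> I \<Longrightarrow> Ap_norm \<mu> p (e i) \<le> C"
    and lim: "\<And>x. x \<noteq> x0 \<Longrightarrow> ((\<lambda>i. e i x) \<longlongrightarrow> 1) (net_filter I le)"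
    and F: "finite F" "F \<noteq> {}" and \<kappa>: "0 < \<kappa>" "\<kappa> < 1"
  shows "\<exists>f\<in>Lp \<mu> p. \<kappa> powr p * pint \<mu> p f < pint \<mu> p (avg F f)"
proof (rule ccontr)
  assume "\<not> ?thesis"
  then have H: "pint \<mu> p (avg F f) \<le> \<kappa> powr p * pint \<mu> p f" if "f \<in> Lp \<mu> p" for f
    using that by force
  have pw: "pint \<mu> p ((avg F ^^ m) f) \<le> (\<kappa> ^ m) powr p * pint \<mu> p f" if f: "f \<in> Lp \<mu> p" for f m
  proof (induction m)
    case (Suc m)
    have "pint \<mu> p ((avg F ^^ Suc m) f) \<le> \<kappa> powr p * pint \<mu> p ((avg F ^^ m) f)"
      using H[OF avg_pow_Lp[OF F(1) f]] p_gt_1 by simp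
    also have "\<dots> \<le> \<kappa> powr p * ((\<kappa> ^ m) powr p * pint \<mu> p f)"
      by (intro mult_left_mono Suc) auto
    also have "\<dots> = (\<kappa> ^ Suc m) powr p * pint \<mu> p f" by (simp add: powr_mult)
    finally show ?case .
  qed simp
  have bound: "norm ((avg F ^^ m) (e i) t) \<le> 2 * \<kappa> ^ m * (C + 1)" if i: "i \<in> I" for m i t
  proof -
    \<comment> \<open>The norm is an infimum that need not be attained, hence the \<open>+ 1\<close>.\<close>
    have "e i \<in> l1_hull (atoms UNIV) (C + 1)"
      by (rule Ap_in_hull[OF e[OF i]]) (use C[OF i] in simp)
    then obtain a c where ac: "\<And>i::nat. a i \<in> atoms UNIV" "summable (\<lambda>i. norm (c i))" "(\<Sum>i. norm (c i)) \<le> C + 1"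
      "\<And>x. (\<lambda>j. c j * a j x) sums e i x" by (rule hullE) blast
    have h1: "(avg F ^^ m) (e i) \<in> l1_hull ((avg F ^^ m) ` atoms UNIV) (C + 1)"
      by (rule hullI[OF imageI[OF ac(1)] ac(2,3) avg_pow_sums[OF ac(4)]])
    have h2: "norm (b t) \<le> 2 * \<kappa> ^ m" if b: "b \<in> (avg F ^^ m) ` atoms UNIV" for b
    proof -
      obtain f g where fg: "b = (avg F ^^ m) (coef f g)" "f \<in> Lp \<mu> p" "pint \<mu> p f \<le> 1" "g \<in> Lp \<mu> q" "pint \<mu> q g \<le> 1"
        using b by (auto elim!: atomsE)
      have "pint \<mu> p ((avg F ^^ m) f) \<le> (\<kappa> ^ m) powr p * 1"
        by (rule order_trans[OF pw[OF fg(2)]]) (use fg(3) in \<open>intro mult_left_mono; simp\<close>)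
      then have "coef ((avg F ^^ m) f) g \<in> l1_hull (atoms UNIV) (\<kappa> ^ m * 1)"
        using fg \<kappa> p_gt_1 F(1) by (intro coef_in_hull avg_pow_Lp) auto
      from hull_bound[OF _ this, of t 2] show ?thesis
        using bounded_atoms_coef[of UNIV] coef_avg_pow[OF F(1) fg(2,4)] by (simp add: fg(1) bounded_atoms_def)
    qed
    show ?thesis using hull_bound[OF h2 h1] \<kappa> by simp
  qed
  obtain i0 where i0: "i0 \<in> I" using I by (auto simp: directed_set_def)
  have refl: "le i i" if "i \<in> I" for i using I that by (simp add: directed_set_def)
  have "\<not> eventually (\<lambda>_. False) (net_filter I le)"
    unfolding eventually_net_filter[OF I] using refl by blast
  then have nb: "net_filter I le \<noteq> bot" by (simp add: trivial_limit_def)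
  have le: "1 \<le> 2 * \<kappa> ^ m * (C + 1)" for m
  proof -
    obtain Q where Q: "finite Q" "\<And>t. (\<forall>q\<in>Q. q + t \<noteq> x0) \<Longrightarrow> ((\<lambda>i. (avg F ^^ m) (e i) t) \<longlongrightarrow> 1) (net_filter I le)"
      using avg_pow_tendsto[where e=e and m=m and \<F>="net_filter I le", OF F lim] by blast
    \<comment> \<open>a point whose translates by \<open>Q\<close> all avoid \<open>x0\<close>\<close>
    obtain t where t: "t \<notin> (\<lambda>q. - q + x0) ` Q"
      using ex_new_if_finite[OF inf, of "(\<lambda>q. - q + x0) ` Q"] Q(1) by blast
    have "\<forall>q\<in>Q. q + t \<noteq> x0"
    proof (intro ballI notI)
      fix q assume "q \<in> Q" "q + t = x0"
      then have "t = - q + x0" by (simp add: add.assoc[symmetric] flip: \<open>q + t = x0\<close>)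
      then show False using t \<open>q \<in> Q\<close> by blast
    qed
    from tendsto_norm[OF Q(2)[OF this]]
    have "((\<lambda>i. norm ((avg F ^^ m) (e i) t)) \<longlongrightarrow> 1) (net_filter I le)" by simp
    moreover have "\<forall>\<^sub>F i in net_filter I le. norm ((avg F ^^ m) (e i) t) \<le> 2 * \<kappa> ^ m * (C + 1)"
      unfolding eventually_net_filter[OF I] using bound i0 by blast
    ultimately show ?thesis by (rule tendsto_upperbound[OF _ _ nb])
  qed
  have "(\<lambda>m. 2 * \<kappa> ^ m * (C + 1)) \<longlonglongrightarrow> 2 * 0 * (C + 1)"
    using \<kappa> by (intro tendsto_intros) auto
  from tendsto_lowerbound[OF this, of 1] le show False by auto
qed

end


section \<open>The deficit in Jensen's inequality and almost invariant densities\<close>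

text \<open>
  The mean value theorem on both halves of the interval: the derivative of \<open>x \<mapsto> x\<^sup>p\<close> is strictly
  increasing.
\<close>

lemma powr_midpoint_strict:
  fixes a b p :: real
  assumes ab: "0 \<le> a" "a < b" and p: "1 < p"
  shows "2 * ((a + b) / 2) powr p < a powr p + b powr p"
proof -
  define c where "c = (a + b) / 2"
  have c: "a < c" "c < b" "0 < c" using ab by (auto simp: c_def)
  have der: "((\<lambda>x. x powr p) has_real_derivative p * x powr (p - 1)) (at x)" if "0 < x" for x :: real
    using has_real_derivative_powr[OF that, of p] .
  have cont: "continuous_on {u..v} (\<lambda>x. x powr p)" if "0 \<le> u" for u v :: real
    using p that by (intro continuous_on_powr' continuous_intros) auto
  have mvt: "\<exists>z>u. z < v \<and> v powr p - u powr p = (v - u) * (p * z powr (p - 1))" if "0 \<le> u" "u < v" for u v :: real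
  proof -
    have df: "(\<lambda>x. x powr p) differentiable (at x)" if "u < x" for x
    proof -
      have "0 < x" using that \<open>0 \<le> u\<close> by simp
      from der[OF this] show ?thesis unfolding real_differentiable_def by blast
    qed
    have "\<exists>l z. u < z \<and> z < v \<and> ((\<lambda>x. x powr p) has_real_derivative l) (at z) \<and> v powr p - u powr p = (v - u) * l"
      by (rule MVT[OF that(2) cont[OF that(1)]]) (rule df)
    then obtain l z where z: "u < z" "z < v" "((\<lambda>x. x powr p) has_real_derivative l) (at z)" "v powr p - u powr p = (v - u) * l" by blast
    have "l = p * z powr (p - 1)" using DERIV_unique[OF z(3) der] z that by auto
    with z show ?thesis by blast
  qed
  obtain x where x: "a < x" "x < c" "c powr p - a powr p = (c - a) * (p * x powr (p - 1))" using mvt[of a c] ab c by auto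
  obtain y where y: "c < y" "y < b" "b powr p - c powr p = (b - c) * (p * y powr (p - 1))" using mvt[of c b] c by auto
  have "x powr (p - 1) < y powr (p - 1)" using x y ab p by (intro powr_less_mono2) auto
  then have "(c - a) * (p * x powr (p - 1)) < (c - a) * (p * y powr (p - 1))" using c p by simp
  moreover have "b - c = c - a" by (simp add: c_def field_simps)
  ultimately have "c powr p - a powr p < b powr p - c powr p" using x y by simp
  then show ?thesis by (simp add: c_def)
qed

lemma powr_midpoint_le:
  fixes a b p :: real
  assumes ab: "0 \<le> a" "0 \<le> b" and p: "1 < p"
  shows "2 * ((a + b) / 2) powr p \<le> a powr p + b powr p"
proof (cases a b rule: linorder_cases)
  case less
  then show ?thesis using powr_midpoint_strict[OF ab(1) less p] by simp
next
  case greater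
  then show ?thesis using powr_midpoint_strict[OF ab(2) greater p] by (simp add: add.commute[of b])
qed simp

text \<open>
  Where \<open>1 - t\<^sup>p \<ge> \<eta>\<close>, \<open>t\<close> stays away from 1, so that the convexity deficit is bounded below by
  a positive constant \<open>D m\<close>, by compactness; there \<open>C = 1 / D m\<close> works since the left-hand side is at most 1. Elsewhere the
  term \<open>\<eta>\<close> suffices.
\<close>

lemma powr_gap_unit:
  fixes p \<eta> :: real
  assumes p: "1 < p" and \<eta>: "0 < \<eta>"
  shows "\<exists>C\<ge>0. \<forall>t\<in>{0..1}. 1 - t powr p \<le> \<eta> + C * (1 + t powr p - 2 * ((1 + t) / 2) powr p)"
proof -
  define D where "D t = 1 + t powr p - 2 * ((1 + t) / 2) powr p" for t :: real
  have D0: "0 \<le> D t" if "t \<in> {0..1}" for t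
    using powr_midpoint_le[of 1 t p] that p by (simp add: D_def)
  define S where "S = {t \<in> {0..1}. \<eta> \<le> 1 - t powr p}"
  have cp: "continuous_on {0..1} (\<lambda>t::real. t powr p)"
    using p by (intro continuous_on_powr' continuous_intros) auto
  have cD: "continuous_on {0..1} D"
    unfolding D_def using p by (intro continuous_intros continuous_on_powr' cp) auto
  have "continuous_on {0..1} (\<lambda>t. 1 - t powr p)" by (intro continuous_on_diff continuous_on_const cp)
  from continuous_on_closed_Collect_le[OF continuous_on_const this closed_atLeastAtMost]
  have "closed S" unfolding S_def .
  from compact_Int_closed[OF compact_Icc this, of 0 1] have "compact ({0..1} \<inter> S)" .
  moreover have "{0..1} \<inter> S = S" by (auto simp: S_def)
  ultimately have S: "compact S" by simp
  show ?thesis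
  proof (cases "S = {}")
    case True
    then have "1 - t powr p \<le> \<eta>" if "t \<in> {0..1}" for t using that by (force simp: S_def)
    then show ?thesis by (intro exI[of _ 0]) auto
  next
    case False
    have "continuous_on S D" by (rule continuous_on_subset[OF cD]) (auto simp: S_def)
    from continuous_attains_inf[OF S False this] obtain m where m: "m \<in> S" "\<And>t. t \<in> S \<Longrightarrow> D m \<le> D t" by blast
    have "m \<noteq> 1" using m(1) \<eta> by (auto simp: S_def)
    then have "0 \<le> m" "m < 1" using m(1) by (auto simp: S_def)
    from powr_midpoint_strict[OF this p] have Dm: "0 < D m" by (simp add: D_def add.commute)
    have "1 - t powr p \<le> \<eta> + 1 / D m * D t" if t: "t \<in> {0..1}" for t
    proof (cases "t \<in> S")
      case True
      have "1 - t powr p \<le> 1" by simp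
      also have "1 \<le> 1 / D m * D t" using m(2)[OF True] Dm by (simp add: field_simps)
      finally show ?thesis using \<eta> by simp
    next
      case False
      then have "1 - t powr p \<le> \<eta>" using t by (simp add: S_def)
      moreover have "0 \<le> 1 / D m * D t" using D0[OF t] Dm by simp
      ultimately show ?thesis by linarith
    qed
    then show ?thesis unfolding D_def[symmetric] using Dm by (intro exI[of _ "1 / D m"]) auto
  qed
qed

text \<open>
  A quantitative form of strict convexity: if the midpoint deficit of \<open>t \<mapsto> t\<^sup>p\<close> at \<open>a, b\<close> is small relative to
  \<open>a\<^sup>p + b\<^sup>p\<close>, then \<open>a\<^sup>p\<close> and \<open>b\<^sup>p\<close> are close. By symmetry and homogeneity it reduces to \<open>a = 1\<close>, \<open>b = t \<le> 1\<close>.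
\<close>

lemma powr_gap:
  fixes p \<eta> :: real
  assumes p: "1 < p" and \<eta>: "0 < \<eta>"
  shows "\<exists>C\<ge>0. \<forall>a\<ge>0. \<forall>b\<ge>0. \<bar>a powr p - b powr p\<bar> \<le>
     \<eta> * (a powr p + b powr p) + C * (a powr p + b powr p - 2 * ((a + b) / 2) powr p)"
proof -
  obtain C where C: "C \<ge> 0" "\<And>t. t \<in> {0..1} \<Longrightarrow> 1 - t powr p \<le> \<eta> + C * (1 + t powr p - 2 * ((1 + t) / 2) powr p)"
    using powr_gap_unit[OF p \<eta>] by blast
  have main: "a powr p - b powr p \<le> \<eta> * (a powr p + b powr p) + C * (a powr p + b powr p - 2 * ((a + b) / 2) powr p)"
    if ab: "0 \<le> b" "b \<le> a" for a b
  proof (cases "a = 0")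
    case True then show ?thesis using ab by simp
  next
    case False
    then have a: "a > 0" using ab by simp
    have 1: "a powr p * (b / a) powr p = b powr p" using a ab by (simp add: powr_divide)
    have "a powr p * ((1 + b / a) / 2) powr p = (a * ((1 + b / a) / 2)) powr p"
      by (rule powr_mult[symmetric])
    also have "a * ((1 + b / a) / 2) = (a + b) / 2" using a by (simp add: field_simps)
    finally have 2: "a powr p * ((1 + b / a) / 2) powr p = ((a + b) / 2) powr p" .
    have "a powr p * (1 - (b / a) powr p) \<le> a powr p * (\<eta> + C * (1 + (b / a) powr p - 2 * ((1 + b / a) / 2) powr p))"
      using a ab by (intro mult_left_mono C(2)) auto
    also have "\<dots> = \<eta> * a powr p + C * (a powr p + a powr p * (b / a) powr p - 2 * (a powr p * ((1 + b / a) / 2) powr p))"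
      by (simp add: algebra_simps)
    also have "a powr p * (1 - (b / a) powr p) = a powr p - a powr p * (b / a) powr p" by (simp add: algebra_simps)
    finally have "a powr p - b powr p \<le> \<eta> * a powr p + C * (a powr p + b powr p - 2 * ((a + b) / 2) powr p)"
      unfolding 1 2 .
    moreover have "\<eta> * a powr p \<le> \<eta> * (a powr p + b powr p)" using \<eta> by simp
    ultimately show ?thesis by linarith
  qed
  have "\<bar>a powr p - b powr p\<bar> \<le> \<eta> * (a powr p + b powr p) + C * (a powr p + b powr p - 2 * ((a + b) / 2) powr p)"
    if ab: "0 \<le> a" "0 \<le> b" for a b
  proof (cases "b \<le> a")
    case True
    then have "b powr p \<le> a powr p" using ab p by (intro powr_mono2) auto
    then show ?thesis using main[OF ab(2) True] by simp
  next
    case False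
    then have "a powr p \<le> b powr p" using ab p by (intro powr_mono2) auto
    then show ?thesis using main[of a b] ab False by (simp add: add.commute)
  qed
  with C(1) show ?thesis by blast
qed

text \<open>
  Jensen's inequality. With \<open>c\<close> the mean, summing Young's inequality for \<open>a s\<close> and \<open>c\<^sup>p\<^sup>-\<^sup>1\<close> over \<open>s\<close> gives
  \<open>n c\<^sup>p \<le> (\<Sum> a\<^sup>p) / p + n c\<^sup>p / q\<close>.
\<close>

lemma powr_mean_le:
  fixes a :: "'s \<Rightarrow> real"
  assumes F: "finite F" "F \<noteq> {}" and a: "\<And>s. s \<in> F \<Longrightarrow> 0 \<le> a s" and p: "1 < p"
  shows "real (card F) * ((\<Sum>s\<in>F. a s) / card F) powr p \<le> (\<Sum>s\<in>F. a s powr p)"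
proof -
  define n where "n = real (card F)"
  have n: "n > 0" using F by (simp add: n_def card_gt_0_iff)
  define c where "c = (\<Sum>s\<in>F. a s) / n"
  have c0: "0 \<le> c" unfolding c_def using n a by (intro divide_nonneg_pos sum_nonneg) auto
  define q where "q = p / (p - 1)"
  have q: "1 < q" "1 / p + 1 / q = 1" "(p - 1) * q = p" using p by (auto simp: q_def field_simps)
  have "a s * c powr (p - 1) \<le> a s powr p / p + c powr p / q" if "s \<in> F" for s
  proof -
    have "a s * c powr (p - 1) \<le> a s powr p / p + (c powr (p - 1)) powr q / q"
      by (intro Youngs_inequality p q a that) auto
    then show ?thesis by (simp add: powr_powr q(3))
  qed
  then have "(\<Sum>s\<in>F. a s * c powr (p - 1)) \<le> (\<Sum>s\<in>F. a s powr p / p + c powr p / q)" by (rule sum_mono)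
  also have "\<dots> = (\<Sum>s\<in>F. a s powr p) / p + n * (c powr p / q)"
    by (simp add: sum.distrib sum_divide_distrib n_def)
  also have "(\<Sum>s\<in>F. a s * c powr (p - 1)) = n * (c * c powr (p - 1))"
    using n by (simp add: sum_distrib_right[symmetric] c_def)
  also have "c * c powr (p - 1) = c powr p"
    using c0 p powr_mult_base[of c "p - 1"] by simp
  finally have "n * c powr p * (1 - 1 / q) \<le> (\<Sum>s\<in>F. a s powr p) / p" by (simp add: algebra_simps)
  also have "1 - 1 / q = 1 / p" using q by simp
  finally show ?thesis using p by (simp add: n_def c_def field_simps)
qed

text \<open>
  The deficit of Jensen's inequality controls the deficit of any pair: replacing \<open>a s\<close> and \<open>a r\<close>
  by their mean does not change the average, and Jensen's inequality applies to the new values.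
\<close>

lemma powr_mean_pair_le:
  fixes a :: "'s \<Rightarrow> real"
  assumes F: "finite F" "s \<in> F" "r \<in> F" "s \<noteq> r" and a: "\<And>s. s \<in> F \<Longrightarrow> 0 \<le> a s" and p: "1 < p"
  shows "a s powr p + a r powr p - 2 * ((a s + a r) / 2) powr p \<le>
    (\<Sum>s\<in>F. a s powr p) - real (card F) * ((\<Sum>s\<in>F. a s) / card F) powr p"
proof -
  define b where "b t = (if t = s \<or> t = r then (a s + a r) / 2 else a t)" for t
  define F' where "F' = F - {s, r}"
  have FF: "F = insert s (insert r F')" "s \<notin> insert r F'" "r \<notin> F'" "finite F'" using F by (auto simp: F'_def)
  have b': "b t = a t" if "t \<in> F'" for t using that by (auto simp: b_def F'_def)
  have S1: "(\<Sum>t\<in>F. b t) = (\<Sum>t\<in>F. a t)"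
    using FF b' by (simp add: b_def cong: sum.cong)
  have S2: "(\<Sum>t\<in>F. b t powr p) = (\<Sum>t\<in>F. a t powr p) - a s powr p - a r powr p + 2 * ((a s + a r) / 2) powr p"
    using FF b' by (simp add: b_def cong: sum.cong)
  have b0: "0 \<le> b t" if "t \<in> F" for t using that a F by (auto simp: b_def)
  have "real (card F) * ((\<Sum>t\<in>F. b t) / card F) powr p \<le> (\<Sum>t\<in>F. b t powr p)"
    by (rule powr_mean_le[OF F(1) _ b0 p]) (use F in auto)
  then show ?thesis unfolding S1 S2 by simp
qed

context haar_group
begin

text \<open>
  Reiter's condition \<open>P\<^sub>1\<close> for finite sets.
\<close>

definition reiter_condition :: bool where
  "reiter_condition \<longleftrightarrow> (\<forall>F \<epsilon>. finite F \<longrightarrow> 0 < \<epsilon> \<longrightarrow>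
     (\<exists>h::'a \<Rightarrow> real. integrable \<mu> h \<and> (\<forall>y. 0 \<le> h y) \<and> (\<integral>y. h y \<partial>\<mu>) = 1 \<and>
        (\<forall>s\<in>F. (\<integral>y. \<bar>h (s + y) - h y\<bar> \<partial>\<mu>) \<le> \<epsilon>)))"

text \<open>
  For \<open>f\<close> whose average has nearly the same norm, the deficit \<open>E\<close> of Jensen's inequality for the
  values \<open>|f (s + y)|\<close>, \<open>s \<in> F\<close>, has small integral. As \<open>0 \<in> F\<close>, the deficit bounds the difference of \<open>|f (s + y)|\<^sup>p\<close> and
  \<open>|f y|\<^sup>p\<close> by \<open>powr_gap\<close>, and \<open>|f|\<^sup>p\<close> divided by its integral is the required density.
\<close>

lemma reiter_if_almost_norm_attaining:
  assumes p: "1 < p"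
    and norm: "\<And>F \<kappa>. finite F \<Longrightarrow> F \<noteq> {} \<Longrightarrow> 0 < \<kappa> \<Longrightarrow> \<kappa> < 1 \<Longrightarrow>
      \<exists>f\<in>Lp \<mu> p. \<kappa> powr p * pint \<mu> p f < pint \<mu> p (avg F f)"
  shows reiter_condition
  unfolding reiter_condition_def
proof (intro allI impI)
  fix F0 :: "'a set" and \<epsilon> :: real
  assume F0: "finite F0" and \<epsilon>: "0 < \<epsilon>"
  define F where "F = insert 0 F0"
  have F: "finite F" "F \<noteq> {}" "0 \<in> F" using F0 by (auto simp: F_def)
  define n where "n = real (card F)"
  have n: "n > 0" using F by (simp add: n_def card_gt_0_iff)
  obtain C where C: "C \<ge> 0" "\<And>a b. 0 \<le> a \<Longrightarrow> 0 \<le> b \<Longrightarrow> \<bar>a powr p - b powr p\<bar> \<le>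
     \<epsilon> / 4 * (a powr p + b powr p) + C * (a powr p + b powr p - 2 * ((a + b) / 2) powr p)"
    using powr_gap[OF p, of "\<epsilon> / 4"] \<epsilon> by auto
  \<comment> \<open>so small that the deficit contributes at most \<open>C * n * \<theta> \<le> \<epsilon> / 2\<close>; the other half of \<open>\<epsilon>\<close> is \<open>\<epsilon> / 4 * (1 + 1)\<close>\<close>
  define \<theta> where "\<theta> = min (1/2) (\<epsilon> / (2 * (C * n + 1)))"
  have Cn: "C * n + 1 > 0" using C n by (simp add: add_nonneg_pos)
  have \<theta>: "0 < \<theta>" "\<theta> < 1" "\<theta> \<le> \<epsilon> / (2 * (C * n + 1))" using \<epsilon> Cn by (auto simp: \<theta>_def)
  define \<kappa> where "\<kappa> = (1 - \<theta>) powr (1 / p)"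
  have \<kappa>: "0 < \<kappa>" "\<kappa> < 1" "\<kappa> powr p = 1 - \<theta>"
    using \<theta> p powr_less_mono2[of "1/p" "1 - \<theta>" 1] by (auto simp: \<kappa>_def powr_powr)
  obtain f where f: "f \<in> Lp \<mu> p" "(1 - \<theta>) * pint \<mu> p f < pint \<mu> p (avg F f)"
    using norm[OF F(1,2) \<kappa>(1,2)] \<kappa>(3) by auto
  define P where "P = pint \<mu> p f"
  have fi: "integrable \<mu> (\<lambda>y. norm (f (s + y)) powr p)" for s
    by (rule Lp_integrable[OF Lp_translate(1)[OF f(1)]])
  have fP: "(\<integral>y. norm (f (s + y)) powr p \<partial>\<mu>) = P" for s
    using Lp_translate(2)[OF f(1), of s] by (simp add: pint_def P_def)
  have ai: "integrable \<mu> (\<lambda>y. norm (avg F f y) powr p)"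
    using Lp_integrable[OF avg_Lp[OF F(1) f(1)]] p by simp
  have avg_le: "norm (avg F f y) powr p \<le> ((\<Sum>s\<in>F. norm (f (s + y))) / n) powr p" for y
  proof -
    have "norm (avg F f y) \<le> (\<Sum>s\<in>F. norm (f (s + y))) / n"
      unfolding avg_def norm_divide using n by (simp add: n_def divide_right_mono norm_sum)
    then show ?thesis using p by (intro powr_mono2) auto
  qed
  define E where "E y = (\<Sum>s\<in>F. norm (f (s + y)) powr p) - n * norm (avg F f y) powr p" for y
  have Ei: "integrable \<mu> E"
    unfolding E_def using fi ai by (intro Bochner_Integration.integrable_diff Bochner_Integration.integrable_sum Bochner_Integration.integrable_mult_right)
  have EI: "(\<integral>y. E y \<partial>\<mu>) = n * (P - pint \<mu> p (avg F f))"
    unfolding E_def using fi ai by (simp add: fP pint_def n_def algebra_simps)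
  have E0: "0 \<le> E y" for y
  proof -
    have "n * norm (avg F f y) powr p \<le> n * ((\<Sum>s\<in>F. norm (f (s + y))) / n) powr p"
      using avg_le n by (intro mult_left_mono) auto
    also have "\<dots> \<le> (\<Sum>s\<in>F. norm (f (s + y)) powr p)"
      unfolding n_def by (rule powr_mean_le[OF F(1,2) _ p]) simp
    finally show ?thesis by (simp add: E_def)
  qed
  \<comment> \<open>If the integral \<open>P\<close> of \<open>|f|\<^sup>p\<close> were \<open>0\<close>, so would be that of the average, against the strict inequality.\<close>
  have P0: "0 < P"
  proof (rule ccontr)
    assume "\<not> 0 < P"
    then have "P = 0" using pint_nonneg[of \<mu> p f] by (simp add: P_def)
    moreover have "0 \<le> n * (P - pint \<mu> p (avg F f))" using E0 unfolding EI[symmetric] by (intro integral_nonneg_AE) auto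
    ultimately have "pint \<mu> p (avg F f) \<le> 0" using n by (simp add: mult_le_0_iff zero_le_mult_iff)
    then show False using f(2) \<open>P = 0\<close> by (simp add: P_def)
  qed
  have EP: "(\<integral>y. E y \<partial>\<mu>) \<le> n * (\<theta> * P)"
    unfolding EI using n f(2) by (intro mult_left_mono) (auto simp: P_def algebra_simps)
  define h where "h y = norm (f y) powr p / P" for y
  have h1: "integrable \<mu> h" using fi[of 0] by (simp add: h_def[abs_def])
  have h2: "(\<integral>y. h y \<partial>\<mu>) = 1" using fP[of 0] P0 by (simp add: h_def)
  have h3: "(\<integral>y. \<bar>h (s + y) - h y\<bar> \<partial>\<mu>) \<le> \<epsilon>" if s: "s \<in> F" for s
  proof (cases "s = 0")
    case True then show ?thesis using \<epsilon> by simp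
  next
    case False
    have pw: "\<bar>norm (f (s + y)) powr p - norm (f y) powr p\<bar> \<le> \<epsilon> / 4 * (norm (f (s + y)) powr p + norm (f y) powr p) + C * E y" for y
    proof -
      have "norm (f (s + y)) powr p + norm (f (0 + y)) powr p - 2 * ((norm (f (s + y)) + norm (f (0 + y))) / 2) powr p
          \<le> (\<Sum>s\<in>F. norm (f (s + y)) powr p) - n * ((\<Sum>s\<in>F. norm (f (s + y))) / n) powr p"
        unfolding n_def by (rule powr_mean_pair_le[OF F(1) s F(3) False]) (use p in auto)
      also have "\<dots> \<le> E y" unfolding E_def using avg_le[of y] n by simp
      finally have "C * (norm (f (s + y)) powr p + norm (f y) powr p - 2 * ((norm (f (s + y)) + norm (f y)) / 2) powr p) \<le> C * E y"
        using C(1) by (intro mult_left_mono) auto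
      then show ?thesis using C(2)[of "norm (f (s + y))" "norm (f y)"] by simp
    qed
    have "(\<integral>y. \<bar>norm (f (s + y)) powr p - norm (f y) powr p\<bar> \<partial>\<mu>) \<le>
        (\<integral>y. \<epsilon> / 4 * (norm (f (s + y)) powr p + norm (f y) powr p) + C * E y \<partial>\<mu>)"
      using fi[of s] fi[of 0] Ei pw by (intro integral_mono) auto
    also have "\<dots> = \<epsilon> / 4 * (P + P) + C * (\<integral>y. E y \<partial>\<mu>)"
      using fi[of s] fi[of 0] Ei fP[of s] fP[of 0] by simp
    also have "\<dots> \<le> \<epsilon> / 4 * (P + P) + C * (n * (\<theta> * P))"
      using EP C(1) by (intro add_left_mono mult_left_mono)
    also have "\<dots> \<le> \<epsilon> / 4 * (P + P) + \<epsilon> / 2 * P"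
    proof -
      have "(C * n) * \<theta> \<le> (C * n + 1) * (\<epsilon> / (2 * (C * n + 1)))"
        using \<theta> C n by (intro mult_mono) auto
      also have "X * (\<epsilon> / (2 * X)) = \<epsilon> / 2" if "X > 0" for X using that by simp
      note this[OF Cn]
      finally have "(C * n) * \<theta> * P \<le> \<epsilon> / 2 * P" using P0 by (intro mult_right_mono) auto
      then have "C * (n * (\<theta> * P)) \<le> \<epsilon> / 2 * P" by (simp only: mult.assoc)
      then show ?thesis by (rule add_left_mono)
    qed
    also have "\<dots> = \<epsilon> * P" by (simp add: field_simps)
    finally have "(\<integral>y. \<bar>norm (f (s + y)) powr p - norm (f y) powr p\<bar> \<partial>\<mu>) \<le> \<epsilon> * P" .
    moreover have "\<bar>h (s + y) - h y\<bar> = \<bar>norm (f (s + y)) powr p - norm (f y) powr p\<bar> / P" for y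
      using P0 by (simp add: h_def diff_divide_distrib[symmetric] abs_divide)
    ultimately show ?thesis using P0 by (simp add: divide_le_eq)
  qed
  have "0 \<le> h y" for y using P0 by (simp add: h_def)
  with h1 h2 h3 show "\<exists>h::'a \<Rightarrow> real. integrable \<mu> h \<and> (\<forall>y. 0 \<le> h y) \<and> (\<integral>y. h y \<partial>\<mu>) = 1 \<and>
        (\<forall>s\<in>F0. (\<integral>y. \<bar>h (s + y) - h y\<bar> \<partial>\<mu>) \<le> \<epsilon>)"
    by (intro exI[of _ h]) (auto simp: F_def)
qed

lemma reiter_finite:
  assumes fin: "finite (UNIV :: 'a set)"
  shows reiter_condition
  unfolding reiter_condition_def
proof (intro allI impI)
  fix F :: "'a set" and \<epsilon> :: real
  assume "0 < \<epsilon>"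
  have cU: "compact (UNIV :: 'a set)" by (rule finite_imp_compact[OF fin])
  have "0 < emeasure \<mu> UNIV" by (rule open_emeasure_pos) auto
  then have mp: "measure \<mu> UNIV > 0"
    using emeasure_compact[OF cU] by (simp add: measure_def enn2real_positive_iff)
  define h :: "'a \<Rightarrow> real" where "h = (\<lambda>_. 1 / measure \<mu> UNIV)"
  have hm: "h \<in> borel_measurable \<mu>" unfolding h_def by (rule borel_measurable_const)
  have 1: "integrable \<mu> h"
    by (rule bounded_compact_integrable(1)[OF hm cU, of "1 / measure \<mu> UNIV"]) (simp_all add: h_def)
  have 2: "(\<integral>y. h y \<partial>\<mu>) = 1" unfolding h_def lebesgue_integral_const using mp by simp
  have 3: "\<forall>y. 0 \<le> h y" by (simp add: h_def)
  have 4: "\<forall>s\<in>F. (\<integral>y. \<bar>h (s + y) - h y\<bar> \<partial>\<mu>) \<le> \<epsilon>" using \<open>0 < \<epsilon>\<close> by (simp add: h_def)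
  show "\<exists>h::'a \<Rightarrow> real. integrable \<mu> h \<and> (\<forall>y. 0 \<le> h y) \<and> (\<integral>y. h y \<partial>\<mu>) = 1 \<and>
        (\<forall>s\<in>F. (\<integral>y. \<bar>h (s + y) - h y\<bar> \<partial>\<mu>) \<le> \<epsilon>)"
    using 1 2 3 4 by blast
qed

end


section \<open>From almost invariant densities to an invariant mean\<close>

context haar_group
begin

lemma AE_translate:
  assumes "AE z in \<mu>. P z" shows "AE y in \<mu>. P (x + y)"
proof -
  have "AE z in distr \<mu> \<mu> (\<lambda>y. x + y). P z" unfolding distr_translate by (rule assms)
  from AE_distrD[OF translate_measurable(1) this] show ?thesis .
qed

lemma locally_AE_translate:
  assumes "locally_AE \<mu> P" shows "locally_AE \<mu> (\<lambda>y. P (x + y))"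
  unfolding locally_AE_def
proof (intro allI impI)
  fix K :: "'a set" assume "compact K"
  then have "compact ((\<lambda>y. x + y) ` K)" by (intro compact_continuous_image continuous_intros)
  then have "AE z in \<mu>. z \<in> (\<lambda>y. x + y) ` K \<longrightarrow> P z" using assms unfolding locally_AE_def by blast
  from AE_translate[OF this, of x] show "AE y in \<mu>. y \<in> K \<longrightarrow> P (x + y)" by (rule AE_mp) (auto intro!: AE_I2)
qed

lemma left_translate_Linf:
  assumes "f \<in> Linf \<mu>" shows "left_translate x f \<in> Linf \<mu>"
proof -
  obtain C where C: "locally_AE \<mu> (\<lambda>x. norm (f x) \<le> C)" using assms by (auto simp: Linf_def)
  have fm: "f \<in> borel_measurable \<mu>" using assms by (simp add: Linf_def)
  have "left_translate x f \<in> borel_measurable \<mu>"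
    using borel_translate(1)[OF fm, of "- x"] unfolding left_translate_def[abs_def] .
  moreover have "locally_AE \<mu> (\<lambda>y. norm (left_translate x f y) \<le> C)"
    using locally_AE_translate[OF C, of "- x"] by (simp add: left_translate_def)
  ultimately show ?thesis by (auto simp: Linf_def)
qed

lemma locally_AE_conj:
  assumes "locally_AE \<mu> P" "locally_AE \<mu> Q" "\<And>x. P x \<Longrightarrow> Q x \<Longrightarrow> R x"
  shows "locally_AE \<mu> R"
  unfolding locally_AE_def
proof (intro allI impI)
  fix K :: "'a set" assume "compact K"
  then have "AE x in \<mu>. x \<in> K \<longrightarrow> P x" "AE x in \<mu>. x \<in> K \<longrightarrow> Q x"
    using assms(1,2) by (auto simp: locally_AE_def)
  then show "AE x in \<mu>. x \<in> K \<longrightarrow> R x" by eventually_elim (use assms(3) in auto)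
qed

lemma Linf_add:
  assumes "f \<in> Linf \<mu>" "g \<in> Linf \<mu>" shows "(\<lambda>x. f x + g x) \<in> Linf \<mu>"
proof -
  obtain C D where C: "locally_AE \<mu> (\<lambda>x. norm (f x) \<le> C)" and D: "locally_AE \<mu> (\<lambda>x. norm (g x) \<le> D)"
    using assms by (auto simp: Linf_def)
  have "locally_AE \<mu> (\<lambda>x. norm (f x + g x) \<le> C + D)"
    by (rule locally_AE_conj[OF C D]) (rule norm_triangle_mono)
  then show ?thesis using assms by (auto simp: Linf_def)
qed

lemma Linf_scale:
  assumes "f \<in> Linf \<mu>" shows "(\<lambda>x. c * f x) \<in> Linf \<mu>"
proof -
  obtain C where C: "locally_AE \<mu> (\<lambda>x. norm (f x) \<le> C)" using assms by (auto simp: Linf_def)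
  have "locally_AE \<mu> (\<lambda>x. norm (c * f x) \<le> norm c * C)"
    by (rule locally_AE_conj[OF C C]) (auto simp: norm_mult mult_left_mono)
  then show ?thesis using assms by (auto simp: Linf_def)
qed

lemma one_Linf: "(\<lambda>_. 1) \<in> Linf \<mu>"
  by (auto simp: Linf_def locally_AE_def intro!: exI[of _ 1])

text \<open>
  An open set of finite measure around \<open>E\<close> is, up to a null set, a countable union of compact sets.
\<close>

lemma locally_AE_on_finite_measure:
  assumes P: "locally_AE \<mu> P" and E: "E \<in> sets \<mu>" "emeasure \<mu> E < \<infinity>"
  shows "AE x in \<mu>. x \<in> E \<longrightarrow> P x"
proof -
  obtain U where U: "open U" "E \<subseteq> U" "emeasure \<mu> U < emeasure \<mu> E + ennreal 1"
    using outer_approx[OF E zero_less_one] by blast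
  have Uf: "emeasure \<mu> U < \<infinity>" using U(3) E(2) by (auto intro: less_trans)
  have "\<exists>K. compact K \<and> K \<subseteq> U \<and> emeasure \<mu> (U - K) \<le> ennreal (1 / real (Suc m))" for m
  proof -
    have "0 < 1 / real (Suc m)" by simp
    from inner_approx[OF U(1) Uf this] show ?thesis by blast
  qed
  then obtain K where K: "\<And>m. compact (K m)" "\<And>m. emeasure \<mu> (U - K m) \<le> ennreal (1 / real (Suc m))" by metis
  define N where "N = U - (\<Union>m. K m)"
  have "N \<in> sets \<mu>" unfolding N_def using U(1) K(1) by (intro sets.Diff sets.countable_UN) auto
  moreover have "emeasure \<mu> N \<le> ennreal (1 / real (Suc m))" for m
    by (rule order_trans[OF emeasure_mono K(2)]) (use U(1) K(1) in \<open>auto simp: N_def intro!: sets.Diff\<close>)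
  then have "emeasure \<mu> N \<le> 0"
  proof -
    have "(\<lambda>m. ennreal (1 / real (Suc m))) \<longlonglongrightarrow> ennreal 0"
      by (intro tendsto_ennrealI LIMSEQ_inverse_real_of_nat[unfolded inverse_eq_divide])
    then show ?thesis using \<open>\<And>m. emeasure \<mu> N \<le> ennreal (1 / real (Suc m))\<close>
      by (intro LIMSEQ_le_const[of "\<lambda>m. ennreal (1 / real (Suc m))"]) auto
  qed
  ultimately have "N \<in> null_sets \<mu>" by auto
  then have 1: "AE x in \<mu>. x \<notin> N" by (rule AE_not_in)
  have 2: "AE x in \<mu>. \<forall>m. x \<in> K m \<longrightarrow> P x"
    unfolding AE_all_countable using P K(1) by (auto simp: locally_AE_def)
  from 1 2 show ?thesis by eventually_elim (use U(2) in \<open>auto simp: N_def\<close>)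
qed

text \<open>
  The support of an integrable function is a countable union of sets of finite measure.
\<close>

lemma locally_AE_on_support:
  fixes k :: "'a \<Rightarrow> real"
  assumes P: "locally_AE \<mu> P" and k: "integrable \<mu> k"
  shows "AE x in \<mu>. k x \<noteq> 0 \<longrightarrow> P x"
proof -
  define E where "E n = {x. 1 / real (Suc n) < \<bar>k x\<bar>}" for n
  have km: "k \<in> borel_measurable \<mu>" using k by auto
  have ES: "E n \<in> sets \<mu>" for n
    using borel_measurable_less[of "\<lambda>_. 1 / real (Suc n)" \<mu> "\<lambda>x. \<bar>k x\<bar>"] km
    by (simp add: E_def Int_def)
  have EP: "AE x in \<mu>. x \<in> E n \<longrightarrow> P x" for n
  proof (rule locally_AE_on_finite_measure[OF P ES])
    have "integrable \<mu> (\<lambda>x. indicator (E n) x :: real)"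
    proof (rule Bochner_Integration.integrable_bound)
      show "integrable \<mu> (\<lambda>x. real (Suc n) * k x)" using k by simp
      show "AE x in \<mu>. norm (indicator (E n) x :: real) \<le> norm (real (Suc n) * k x)"
        by (rule AE_I2) (auto simp: E_def indicator_def abs_mult field_simps)
    qed (use ES in auto)
    then show "emeasure \<mu> (E n) < \<infinity>" by (simp add: integrable_indicator_iff)
  qed
  have "AE x in \<mu>. \<forall>n. x \<in> E n \<longrightarrow> P x" unfolding AE_all_countable by (intro allI EP)
  then show ?thesis
  proof eventually_elim
    case (elim x)
    show ?case
    proof
      assume "k x \<noteq> 0"
      then have "0 < \<bar>k x\<bar>" by simp
      then obtain n where "1 / real (Suc n) < \<bar>k x\<bar>" using nat_approx_posE by blast
      then have "x \<in> E n" by (simp add: E_def)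
      then show "P x" using elim by blast
    qed
  qed
qed

text \<open>
  Locally null sets are null on the support of \<open>k\<close>. This is what makes integration against a density a bounded functional on
  \<open>L\<^sup>\<infinity>\<close>, for the norm modulo locally null functions.
\<close>

lemma Linf_pairing:
  fixes k :: "'a \<Rightarrow> real"
  assumes f: "f \<in> Linf \<mu>" and k: "integrable \<mu> k"
  shows "integrable \<mu> (\<lambda>x. f x * of_real (k x))"
    and "norm (\<integral>x. f x * of_real (k x) \<partial>\<mu>) \<le> Linf_norm \<mu> f * (\<integral>x. \<bar>k x\<bar> \<partial>\<mu>)"
proof -
  have fm: "f \<in> borel_measurable \<mu>" using f by (simp add: Linf_def)
  have m: "(\<lambda>x. f x * of_real (k x)) \<in> borel_measurable \<mu>"
    using fm k by (intro borel_measurable_times borel_measurable_of_real) auto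
  have ae: "AE x in \<mu>. norm (f x * of_real (k x)) \<le> C * \<bar>k x\<bar>" if "locally_AE \<mu> (\<lambda>x. norm (f x) \<le> C)" for C
    using locally_AE_on_support[OF that k] by eventually_elim (auto simp: norm_mult mult_right_mono)
  have i: "integrable \<mu> (\<lambda>x. C * \<bar>k x\<bar>)" for C using k by simp
  have I: "integrable \<mu> (\<lambda>x. f x * of_real (k x))" if C: "locally_AE \<mu> (\<lambda>x. norm (f x) \<le> C)" for C
    by (rule Bochner_Integration.integrable_bound[OF i[of C] m])
       (use ae[OF C] in \<open>eventually_elim; auto intro: order_trans\<close>)
  obtain C0 where C0: "locally_AE \<mu> (\<lambda>x. norm (f x) \<le> C0)" using f by (auto simp: Linf_def)
  show int: "integrable \<mu> (\<lambda>x. f x * of_real (k x))" by (rule I[OF C0])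
  have le: "norm (\<integral>x. f x * of_real (k x) \<partial>\<mu>) \<le> C * (\<integral>x. \<bar>k x\<bar> \<partial>\<mu>)" if C: "locally_AE \<mu> (\<lambda>x. norm (f x) \<le> C)" for C
  proof -
    have "norm (\<integral>x. f x * of_real (k x) \<partial>\<mu>) \<le> (\<integral>x. norm (f x * of_real (k x)) \<partial>\<mu>)" by (rule integral_norm_bound)
    also have "\<dots> \<le> (\<integral>x. C * \<bar>k x\<bar> \<partial>\<mu>)" by (rule integral_mono_AE[OF integrable_norm[OF int] i ae[OF C]])
    finally show ?thesis by simp
  qed
  define J where "J = (\<integral>x. \<bar>k x\<bar> \<partial>\<mu>)"
  have J0: "0 \<le> J" unfolding J_def by (rule integral_nonneg_AE) simp
  show "norm (\<integral>x. f x * of_real (k x) \<partial>\<mu>) \<le> Linf_norm \<mu> f * (\<integral>x. \<bar>k x\<bar> \<partial>\<mu>)"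
  proof (cases "J = 0")
    case True then show ?thesis using le[OF C0] by (simp add: J_def)
  next
    case False
    then have Jp: "0 < J" using J0 by simp
    have "norm (\<integral>x. f x * of_real (k x) \<partial>\<mu>) / J \<le> Linf_norm \<mu> f"
      unfolding Linf_norm_def
    proof (rule cInf_greatest)
      have "locally_AE \<mu> (\<lambda>x. norm (f x) \<le> max 0 C0)" by (rule locally_AE_conj[OF C0 C0]) auto
      then show "{C. 0 \<le> C \<and> locally_AE \<mu> (\<lambda>x. norm (f x) \<le> C)} \<noteq> {}" by force
      show "norm (\<integral>x. f x * of_real (k x) \<partial>\<mu>) / J \<le> C" if "C \<in> {C. 0 \<le> C \<and> locally_AE \<mu> (\<lambda>x. norm (f x) \<le> C)}" for C
        using le[of C] that Jp by (simp add: J_def divide_le_eq)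
    qed
    then show ?thesis using Jp by (simp add: J_def divide_le_eq)
  qed
qed

definition mean_of_density :: "('a \<Rightarrow> real) \<Rightarrow> ('a \<Rightarrow> complex) \<Rightarrow> complex" where
  "mean_of_density h f = (if f \<in> Linf \<mu> then \<integral>x. f x * of_real (h x) \<partial>\<mu> else 0)"

text \<open>
  The functionals are normalised to \<open>0\<close> off \<open>L\<^sup>\<infinity>\<close>, so that \<open>means\<close> is a compact set in the product
  topology on all functions.
\<close>

definition means :: "(('a \<Rightarrow> complex) \<Rightarrow> complex) set" where
  "means = {m. (\<forall>f. norm (m f) \<le> (if f \<in> Linf \<mu> then Linf_norm \<mu> f else 0)) \<and>
     (\<forall>f\<in>Linf \<mu>. \<forall>g\<in>Linf \<mu>. m (\<lambda>x. f x + g x) = m f + m g) \<and>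
     (\<forall>c. \<forall>f\<in>Linf \<mu>. m (\<lambda>x. c * f x) = c * m f) \<and>
     (\<forall>f\<in>Linf \<mu>. locally_AE \<mu> (\<lambda>x. f x \<in> \<real>\<^sub>\<ge>\<^sub>0) \<longrightarrow> m f \<in> \<real>\<^sub>\<ge>\<^sub>0) \<and>
     m (\<lambda>_. 1) = 1}"

definition almost_invariant :: "'a \<Rightarrow> real \<Rightarrow> (('a \<Rightarrow> complex) \<Rightarrow> complex) set" where
  "almost_invariant s \<epsilon> = {m. \<forall>f\<in>Linf \<mu>. norm (m (left_translate s f) - m f) \<le> Linf_norm \<mu> f * \<epsilon>}"

lemma continuous_evaluation: "continuous_on UNIV (\<lambda>m :: ('a \<Rightarrow> complex) \<Rightarrow> complex. m f)"
  by (rule continuous_on_product_coordinates)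

text \<open>
  By Tychonoff's theorem; linearity, positivity and normalisation are closed conditions on finitely
  many coordinates each.
\<close>

lemma compact_means: "compact means"
proof -
  define B where "B f = (if f \<in> Linf \<mu> then Linf_norm \<mu> f else 0)" for f
  have "compactin (product_topology (\<lambda>_. euclidean) UNIV) (PiE UNIV (\<lambda>f :: 'a \<Rightarrow> complex. cball (0::complex) (B f)))"
    by (subst compactin_PiE) (auto simp: compactin_euclidean_iff)
  then have c: "compact (PiE UNIV (\<lambda>f :: 'a \<Rightarrow> complex. cball (0::complex) (B f)))"
    by (simp add: euclidean_product_topology compactin_euclidean_iff)
  have cl: "closed {m :: ('a \<Rightarrow> complex) \<Rightarrow> complex. (\<forall>f\<in>Linf \<mu>. \<forall>g\<in>Linf \<mu>. m (\<lambda>x. f x + g x) = m f + m g) \<and>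
     (\<forall>c. \<forall>f\<in>Linf \<mu>. m (\<lambda>x. c * f x) = c * m f) \<and>
     (\<forall>f\<in>Linf \<mu>. locally_AE \<mu> (\<lambda>x. f x \<in> \<real>\<^sub>\<ge>\<^sub>0) \<longrightarrow> m f \<in> \<real>\<^sub>\<ge>\<^sub>0) \<and> m (\<lambda>_. 1) = 1}" (is "closed ?L")
  proof -
    have "?L = (\<Inter>f\<in>Linf \<mu>. \<Inter>g\<in>Linf \<mu>. {m. m (\<lambda>x. f x + g x) = m f + m g}) \<inter>
      (\<Inter>c. \<Inter>f\<in>Linf \<mu>. {m. m (\<lambda>x. c * f x) = c * m f}) \<inter>
      (\<Inter>f\<in>{f \<in> Linf \<mu>. locally_AE \<mu> (\<lambda>x. f x \<in> \<real>\<^sub>\<ge>\<^sub>0)}. (\<lambda>m. m f) -` \<real>\<^sub>\<ge>\<^sub>0) \<inter> {m. m (\<lambda>_. 1) = 1}"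
      by auto
    also have "closed \<dots>"
      by (intro closed_Int closed_INT ballI closed_Collect_eq closed_vimage closed_nonneg_Reals_complex
          continuous_on_add continuous_on_mult continuous_on_const continuous_evaluation)
    finally show ?thesis .
  qed
  have "means = PiE UNIV (\<lambda>f. cball 0 (B f)) \<inter> ?L" 
    by (auto simp: means_def B_def PiE_UNIV_domain Pi_iff split: if_splits)
  then show ?thesis using compact_Int_closed[OF c cl] by simp
qed

lemma closed_almost_invariant: "closed (almost_invariant s \<epsilon>)"
proof -
  have "almost_invariant s \<epsilon> = (\<Inter>f\<in>Linf \<mu>. {m. norm (m (left_translate s f) - m f) \<le> Linf_norm \<mu> f * \<epsilon>})"
    by (auto simp: almost_invariant_def)
  also have "closed \<dots>"
    by (intro closed_INT ballI closed_Collect_le continuous_on_norm continuous_on_diff continuous_on_const continuous_evaluation)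
  finally show ?thesis .
qed

lemma mean_of_density_in_means:
  assumes h: "integrable \<mu> h" "\<And>x. 0 \<le> h x" "(\<integral>x. h x \<partial>\<mu>) = 1"
  shows "mean_of_density h \<in> means"
  unfolding means_def
proof (intro CollectI conjI allI ballI impI)
  show "norm (mean_of_density h f) \<le> (if f \<in> Linf \<mu> then Linf_norm \<mu> f else 0)" for f
    using Linf_pairing(2)[of f h] h by (simp add: mean_of_density_def)
  show "mean_of_density h (\<lambda>x. f x + g x) = mean_of_density h f + mean_of_density h g"
    if "f \<in> Linf \<mu>" "g \<in> Linf \<mu>" for f g
    using that Linf_add[OF that] Linf_pairing(1)[OF that(1) h(1)] Linf_pairing(1)[OF that(2) h(1)]
    by (simp add: mean_of_density_def distrib_right)
  show "mean_of_density h (\<lambda>x. c * f x) = c * mean_of_density h f" if "f \<in> Linf \<mu>" for c f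
    using that Linf_scale[OF that] by (simp add: mean_of_density_def mult.assoc)
  have "(\<integral>x. complex_of_real (h x) \<partial>\<mu>) = 1" using h(3) by (simp add: integral_complex_of_real)
  then show "mean_of_density h (\<lambda>_. 1) = 1" using one_Linf by (simp add: mean_of_density_def)
  show "mean_of_density h f \<in> \<real>\<^sub>\<ge>\<^sub>0" if f: "f \<in> Linf \<mu>" and pos: "locally_AE \<mu> (\<lambda>x. f x \<in> \<real>\<^sub>\<ge>\<^sub>0)" for f
  proof -
    have fm: "f \<in> borel_measurable \<mu>" using f by (simp add: Linf_def)
    have ae: "AE x in \<mu>. f x * of_real (h x) = of_real (Re (f x) * h x)"
      using locally_AE_on_support[OF pos h(1)]
      by eventually_elim (auto simp: complex_nonneg_Reals_iff complex_eq_iff)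
    have ae2: "AE x in \<mu>. 0 \<le> Re (f x) * h x"
      using locally_AE_on_support[OF pos h(1)]
      by eventually_elim (use h(2) in \<open>auto simp: complex_nonneg_Reals_iff\<close>)
    have "mean_of_density h f = (\<integral>x. of_real (Re (f x) * h x) \<partial>\<mu>)"
      using f fm h(1) ae by (auto simp: mean_of_density_def intro!: integral_cong_AE)
    also have "\<dots> = of_real (\<integral>x. Re (f x) * h x \<partial>\<mu>)" by (rule integral_complex_of_real)
    finally show ?thesis using integral_nonneg_AE[OF ae2] by (simp add: nonneg_Reals_of_real_iff)
  qed
qed

text \<open>
  By left invariance, translating \<open>f\<close> amounts to translating the density the other way.
\<close>

lemma mean_of_density_almost_invariant:
  assumes h: "integrable \<mu> h" and s: "(\<integral>y. \<bar>h (s + y) - h y\<bar> \<partial>\<mu>) \<le> \<epsilon>"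
  shows "mean_of_density h \<in> almost_invariant s \<epsilon>"
  unfolding almost_invariant_def
proof (intro CollectI ballI)
  fix f assume f: "f \<in> Linf \<mu>"
  have fm: "f \<in> borel_measurable \<mu>" using f by (simp add: Linf_def)
  have hs: "integrable \<mu> (\<lambda>y. h (s + y))" using integrable_translate[of h s] h by auto
  have m: "(\<lambda>y. f (- s + y) * of_real (h y)) \<in> borel_measurable \<mu>"
    using borel_translate(1)[OF fm] h by (intro borel_measurable_times borel_measurable_of_real) auto
  have "mean_of_density h (left_translate s f) = (\<integral>y. f (- s + y) * of_real (h y) \<partial>\<mu>)"
    using left_translate_Linf[OF f, of s] by (simp add: mean_of_density_def) (simp add: left_translate_def)
  also have "\<dots> = (\<integral>y. f y * of_real (h (s + y)) \<partial>\<mu>)"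
    using integral_translate[OF m, of s] by (simp add: add.assoc[symmetric])
  finally have "mean_of_density h (left_translate s f) - mean_of_density h f = (\<integral>y. f y * of_real (h (s + y) - h y) \<partial>\<mu>)"
    using f Linf_pairing(1)[OF f h] Linf_pairing(1)[OF f hs]
    by (simp add: mean_of_density_def right_diff_distrib)
  also have "norm \<dots> \<le> Linf_norm \<mu> f * (\<integral>y. \<bar>h (s + y) - h y\<bar> \<partial>\<mu>)"
    by (rule Linf_pairing(2)[OF f]) (use h hs in auto)
  also have "\<dots> \<le> Linf_norm \<mu> f * \<epsilon>"
  proof (rule mult_left_mono[OF s])
    obtain C0 where C0: "locally_AE \<mu> (\<lambda>x. norm (f x) \<le> C0)" using f by (auto simp: Linf_def)
    have "locally_AE \<mu> (\<lambda>x. norm (f x) \<le> max 0 C0)" by (rule locally_AE_conj[OF C0 C0]) auto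
    then show "0 \<le> Linf_norm \<mu> f"
      unfolding Linf_norm_def by (intro cInf_greatest) force+
  qed
  finally show "norm (mean_of_density h (left_translate s f) - mean_of_density h f) \<le> Linf_norm \<mu> f * \<epsilon>" .
qed

text \<open>
  The closed sets \<open>almost_invariant s \<epsilon>\<close> have the finite intersection property within \<open>means\<close>:
  a density that is invariant up to the smallest \<open>\<epsilon>\<close> under all the finitely many \<open>s\<close> gives a
  common element. By compactness, all of them have a common element, and it is invariant.
\<close>

lemma amenable_if_reiter:
  assumes reiter_condition shows "amenable \<mu>"
proof -
  let ?F = "(\<lambda>(s, \<epsilon>). almost_invariant s \<epsilon>) ` (UNIV \<times> {0<..})"
  have "means \<inter> \<Inter> ?F \<noteq> {}"
  proof (rule compact_imp_fip[OF compact_means])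
    show "closed T" if "T \<in> ?F" for T using that closed_almost_invariant by auto
    fix F' assume F': "finite F'" "F' \<subseteq> ?F"
    then obtain J where J: "finite J" "J \<subseteq> UNIV \<times> {0<..}" "F' = (\<lambda>(s, \<epsilon>). almost_invariant s \<epsilon>) ` J"
      by (meson finite_subset_image)
    define \<epsilon> where "\<epsilon> = Min (insert 1 (snd ` J))"
    have \<epsilon>: "0 < \<epsilon>" using J by (auto simp: \<epsilon>_def)
    have fin: "finite (fst ` J)" using J by simp
    obtain h where h: "integrable \<mu> h" "\<And>y. 0 \<le> h y" "(\<integral>y. h y \<partial>\<mu>) = 1"
      "\<And>s. s \<in> fst ` J \<Longrightarrow> (\<integral>y. \<bar>h (s + y) - h y\<bar> \<partial>\<mu>) \<le> \<epsilon>"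
      using assms fin \<epsilon> unfolding reiter_condition_def by metis
    have "mean_of_density h \<in> T" if "T \<in> F'" for T
    proof -
      obtain s \<delta> where s: "(s, \<delta>) \<in> J" "T = almost_invariant s \<delta>" using \<open>T \<in> F'\<close> J by auto
      have sJ: "s \<in> fst ` J" using s(1) by (rule image_eqI[rotated]) simp
      have "\<delta> \<in> insert 1 (snd ` J)" using s(1) by (intro insertI2 image_eqI[of _ _ "(s, \<delta>)"]) auto
      then have "\<epsilon> \<le> \<delta>" unfolding \<epsilon>_def using J(1) by (intro Min_le) auto
      then show ?thesis unfolding s(2)
        by (intro mean_of_density_almost_invariant[OF h(1)] order_trans[OF h(4)[OF sJ]])
    qed
    then show "means \<inter> \<Inter> F' \<noteq> {}" using mean_of_density_in_means[OF h(1-3)] by blast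
  qed
  then obtain m where m: "m \<in> means" "\<And>s \<epsilon>. 0 < \<epsilon> \<Longrightarrow> m \<in> almost_invariant s \<epsilon>" by auto
  have inv: "m (left_translate s f) = m f" if f: "f \<in> Linf \<mu>" for s f
  proof -
    have b: "norm (m (left_translate s f) - m f) \<le> Linf_norm \<mu> f * \<epsilon>" if "0 < \<epsilon>" for \<epsilon>
      using m(2)[OF that, of s] f by (simp add: almost_invariant_def)
    have "norm (m (left_translate s f) - m f) \<le> Linf_norm \<mu> f * (1 / real (Suc n))" for n
      by (rule b) simp
    moreover have "(\<lambda>n. Linf_norm \<mu> f * (1 / real (Suc n))) \<longlonglongrightarrow> Linf_norm \<mu> f * 0"
      by (intro tendsto_mult tendsto_const LIMSEQ_inverse_real_of_nat[unfolded inverse_eq_divide])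
    ultimately have "norm (m (left_translate s f) - m f) \<le> Linf_norm \<mu> f * 0"
      by (intro LIMSEQ_le_const) auto
    then show ?thesis by simp
  qed
  show ?thesis
    unfolding amenable_def
  proof (rule bexI[of _ m])
    have "norm (m f) \<le> 1 * Linf_norm \<mu> f" if f: "f \<in> Linf \<mu>" for f
    proof -
      have "norm (m f) \<le> (if f \<in> Linf \<mu> then Linf_norm \<mu> f else 0)" using m(1) unfolding means_def by blast
      then show ?thesis using f by simp
    qed
    then show "m \<in> Linf_dual \<mu>"
      using m(1) unfolding Linf_dual_def means_def by blast
    show "(\<forall>f\<in>Linf \<mu>. locally_AE \<mu> (\<lambda>x. f x \<in> \<real>\<^sub>\<ge>\<^sub>0) \<longrightarrow> m f \<in> \<real>\<^sub>\<ge>\<^sub>0) \<and> m (\<lambda>_. 1) = 1 \<and>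
        (\<forall>x. \<forall>f\<in>Linf \<mu>. m (left_translate x f) = m f)"
      using m(1) inv unfolding means_def by blast
  qed
qed

end

section \<open>Amenability\<close>

theorem theorem2p6:
  fixes \<mu> :: "'a::{topological_group_add, t2_space} measure"
    and p :: real
    and \<phi> :: "('a \<Rightarrow> complex) \<Rightarrow> complex"
  assumes "locally_compact_space (euclidean :: 'a topology)"
    and "left_haar_measure \<mu>"
    and "1 < p"
    and "\<phi> \<in> character_space (Ap \<mu> p) \<union> {zero_functional (Ap \<mu> p)}"
    and "has_bounded_Delta_weak_ai TYPE('i) (Ap \<mu> p) (Ap_norm \<mu> p) (ker (Ap \<mu> p) \<phi>)"
  shows "amenable \<mu>"
proof -
  interpret haar_exponents \<mu> p "conjugate_exponent p"
    using assms(1-3) by unfold_locales auto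
  show ?thesis
  proof (cases "finite (UNIV :: 'a set)")
    case True
    \<comment> \<open>A finite group may have no room to avoid the exceptional point; a constant density serves.\<close>
    then show ?thesis by (intro amenable_if_reiter reiter_finite)
  next
    case inf: False
    let ?A = "Ap \<mu> p" and ?B = "ker (Ap \<mu> p) \<phi>"
    obtain I :: "'i set" and le e C where I: "directed_set I le" and eB: "\<And>i. i \<in> I \<Longrightarrow> e i \<in> ?B"
      and C: "\<And>i. i \<in> I \<Longrightarrow> Ap_norm \<mu> p (e i) \<le> C"
      and lim: "\<And>b K. b \<in> ?B \<Longrightarrow> compactin (gelfand_topology ?A) K \<Longrightarrow>
           ((\<lambda>i. SUP \<phi>\<in>K. ennreal (norm (\<phi> (\<lambda>x. b x * e i x) - \<phi> b))) \<longlongrightarrow> 0) (net_filter I le)"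
      using assms(5) unfolding has_bounded_Delta_weak_ai_def by blast
    have eA: "e i \<in> ?A" if "i \<in> I" for i using eB[OF that] by (simp add: ker_def)
    \<comment> \<open>the exceptional point, or any point if there is none\<close>
    define x0 where "x0 = (SOME x. \<forall>b\<in>?B. b x = 0)"
    have pointwise: "((\<lambda>i. e i x) \<longlongrightarrow> 1) (net_filter I le)" if x: "x \<noteq> x0" for x
    proof -
      have "\<exists>b\<in>?B. b x \<noteq> 0"
      proof (rule ccontr)
        assume "\<not> (\<exists>b\<in>?B. b x \<noteq> 0)"
        then have 1: "\<forall>b\<in>?B. b x = 0" by blast
        then have 2: "\<forall>b\<in>?B. b x0 = 0" unfolding x0_def by (rule someI)
        have "x = x0" by (rule ker_zeros_unique[OF assms(4)]) (use 1 2 in blast)+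
        then show False using x by blast
      qed
      then obtain b where b: "b \<in> ?B" "b x \<noteq> 0" by blast
      show ?thesis
        by (rule ai_pointwise_limit[OF I eA lim[OF b(1)] _ b(2)]) (use b(1) in \<open>auto simp: ker_def\<close>)
    qed
    show ?thesis
      by (intro amenable_if_reiter reiter_if_almost_norm_attaining[OF assms(3)]
          almost_norm_attaining[OF inf I eA C pointwise])
  qed
qed


end
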